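(* Set $C_0:=\sup_{x\in\Sigma}\frac{\boldsymbol{c}(x)}{2\pi}$. Then for any fixed $t\in\,]0,1[$ and $\gamma\in\,]0,\frac12[$, we have for $p\gg1$ $$\sup_{x\in\Sigma_{p,t,\gamma}}B_p(x)\leq C_0\,(1+o(1))\,p,$$ where the term $o(1)$ is uniform in $x\in\Sigma_{p,t,\gamma}$ as $p\to+\infty$.
   Context: Setting. $\overline{\Sigma}$ is a compact Riemann surface, $D=\{a_1,\dots,a_N\}\subset\overline{\Sigma}$ a finite set, $\Sigma=\overline{\Sigma}\setminus D$ with complex structure $J$, and $\omega_\Sigma$ is a smooth real $(1,1)$-form on $\Sigma$ such that $g^{T\Sigma}=\omega_\Sigma(\cdot,J\cdot)$ is a Riemannian metric. $L$ is a holomorphic line bundle on $\overline{\Sigma}$ with a singular Hermitian metric $h$ such that: (α) $h$ is smooth over $\Sigma$, and for each $j\in\{1,\dots,N\}$ there is a trivialization of $L$ on a neighbourhood $\overline{V}_j$ of $a_j$ in $\overline{\Sigma}$ with coordinate $z_j$ ($a_j$ corresponding to $z_j=0$) in which $|1|_h^2(z_j)=|\log|z_j|^2|$; (β) the Chern curvature $R^L$ of $h$ satisfies: (i) $\sqrt{-1}R^L\geq0$ on $\Sigma$; (ii) $\sqrt{-1}R^L=\omega_\Sigma$ on $V_j:=\overline{V}_j\setminus\{a_j\}$ for each $j$; (iii) $R^L$ vanishes to at most finite order at every $x\in\Sigma$, i.e. $\mathrm{ord}_x(R^L):=\min\{\ell\in\mathbb{N}: j_x^\ell R^L\neq0\}<\infty$,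 where $j^\ell_x$ denotes the $\ell$-th jet at $x$. $E$ is a holomorphic line bundle over $\Sigma$ with smooth Hermitian metric $h^E$ such that on each $V_j$, $(E,h^E)$ is the trivial line bundle with the trivial metric. $h_p=h^{\otimes p}\otimes h^E$ on $L^p\otimes E$. $H^0_{(2)}(\Sigma,L^p\otimes E)$ is the (finite-dimensional) space of holomorphic sections of $L^p\otimes E$ on $\Sigma$ with $\int_\Sigma|s|_{h_p}^2\omega_\Sigma<\infty$, and $B_p(x)=\sum_i|S_i^p(x)|^2_{h_p}$ for any orthonormal basis $\{S^p_i\}$ of it. $\boldsymbol{c}(x)=\sqrt{-1}R^L_x/\omega_\Sigma(x)\geq0$, a bounded smooth function on $\Sigma$ which equals $1$ near the punctures (so $C_0\ge\frac1{2\pi}$ when there are punctures). $\Sigma_{p,t,\gamma}=\Sigma\setminus\bigcup_{j=1}^N\mathbb{D}^*(a_j,te^{-p^\gamma})$, where $\mathbb{D}^*(a_j,r)$ is the punctured open disc of radius $r$ centered at $a_j$ in the coordinate $z_j$. *)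

theory Defs
  imports "HOL-Analysis.Analysis" "HOL-Library.Extended_Nat"
begin

definition pd_x :: "(complex \<Rightarrow> 'b::real_normed_vector) \<Rightarrow> complex \<Rightarrow> 'b" where
  "pd_x f z = vector_derivative (\<lambda>t. f (z + of_real t)) (at 0)"

definition pd_y :: "(complex \<Rightarrow> 'b::real_normed_vector) \<Rightarrow> complex \<Rightarrow> 'b" where
  "pd_y f z = vector_derivative (\<lambda>t. f (z + \<i> * of_real t)) (at 0)"

definition pd_z :: "(complex \<Rightarrow> complex) \<Rightarrow> complex \<Rightarrow> complex" where
  "pd_z f z = (pd_x f z - \<i> * pd_y f z) / 2"

definition pd_zbar :: "(complex \<Rightarrow> complex) \<Rightarrow> complex \<Rightarrow> complex" where
  "pd_zbar f z = (pd_x f z + \<i> * pd_y f z) / 2"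

text \<open>Continuous differentiability of order \<open>n\<close> in the real sense, on an open set \<open>S\<close>.\<close>

primrec C_diff :: "nat \<Rightarrow> complex set \<Rightarrow> (complex \<Rightarrow> 'b::real_normed_vector) \<Rightarrow> bool" where
  "C_diff 0 S f \<longleftrightarrow> continuous_on S f"
| "C_diff (Suc n) S f \<longleftrightarrow>
     (\<exists>f1 f2. (\<forall>z\<in>S. (f has_derivative (\<lambda>v. Re v *\<^sub>R f1 z + Im v *\<^sub>R f2 z)) (at z)) \<and>
              C_diff n S f1 \<and> C_diff n S f2)"

definition smooth :: "complex set \<Rightarrow> (complex \<Rightarrow> 'b::real_normed_vector) \<Rightarrow> bool" where
  "smooth S f \<longleftrightarrow> (\<forall>n. C_diff n S f)"

text \<open>The \<open>l\<close>-jet of \<open>f\<close> at \<open>z\<close>, as the family of all partial derivatives of order at most \<open>l\<close>.\<close>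

definition jet :: "nat \<Rightarrow> (complex \<Rightarrow> complex) \<Rightarrow> complex \<Rightarrow> nat \<times> nat \<Rightarrow> complex" where
  "jet l f z = (\<lambda>(a, b). if a + b \<le> l then (pd_x ^^ a) ((pd_y ^^ b) f) z else 0)"

definition vanishing_order :: "(complex \<Rightarrow> complex) \<Rightarrow> complex \<Rightarrow> enat" where
  "vanishing_order f z = Inf (enat ` {l. jet l f z \<noteq> (\<lambda>_. 0)})"

type_synonym 'a chart = "'a set \<times> ('a \<Rightarrow> complex)"

definition chart_on :: "'a topology \<Rightarrow> 'a chart \<Rightarrow> bool" where
  "chart_on X = (\<lambda>(U, \<phi>). openin X U \<and> open (\<phi> ` U) \<and>
     homeomorphic_map (subtopology X U) (top_of_set (\<phi> ` U)) \<phi>)"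

definition transition :: "'a chart \<Rightarrow> 'a chart \<Rightarrow> complex \<Rightarrow> complex" where
  "transition c c' = snd c' \<circ> inv_into (fst c) (snd c)"

definition compatible :: "'a chart \<Rightarrow> 'a chart \<Rightarrow> bool" where
  "compatible c c' \<longleftrightarrow>
     transition c c' holomorphic_on snd c ` (fst c \<inter> fst c') \<and>
     transition c' c holomorphic_on snd c' ` (fst c \<inter> fst c')"

text \<open>A complex structure is a maximal holomorphic atlas. Riemann surfaces are connected by
  convention; second countability is automatic in the compact case.\<close>

definition complex_structure :: "'a topology \<Rightarrow> 'a chart set \<Rightarrow> bool" where
  "complex_structure X \<A> \<longleftrightarrow>
     (\<forall>c\<in>\<A>. chart_on X c) \<and> (\<Union>c\<in>\<A>. fst c) = topspace X \<and>
     (\<forall>c\<in>\<A>. \<forall>c'\<in>\<A>. compatible c c') \<and>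
     (\<forall>c. chart_on X c \<and> (\<forall>c'\<in>\<A>. compatible c c') \<longrightarrow> c \<in> \<A>)"

definition compact_riemann_surface :: "'a topology \<Rightarrow> 'a chart set \<Rightarrow> bool" where
  "compact_riemann_surface X \<A> \<longleftrightarrow>
     topspace X \<noteq> {} \<and> Hausdorff_space X \<and> connected_space X \<and> compact_space X \<and>
     complex_structure X \<A>"

definition in_chart :: "'a chart \<Rightarrow> ('a \<Rightarrow> 'b) \<Rightarrow> complex \<Rightarrow> 'b" where
  "in_chart c f = f \<circ> inv_into (fst c) (snd c)"

definition hol_fun :: "'a chart set \<Rightarrow> 'a set \<Rightarrow> ('a \<Rightarrow> complex) \<Rightarrow> bool" where
  "hol_fun \<A> W f \<longleftrightarrow> (\<forall>c\<in>\<A>. in_chart c f holomorphic_on snd c ` (fst c \<inter> W))"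

definition smooth_fun :: "'a chart set \<Rightarrow> 'a set \<Rightarrow> ('a \<Rightarrow> 'b::real_normed_vector) \<Rightarrow> bool" where
  "smooth_fun \<A> W f \<longleftrightarrow> (\<forall>c\<in>\<A>. smooth (snd c ` (fst c \<inter> W)) (in_chart c f))"

text \<open>A (1,1)-form \<open>\<alpha>\<close> is given by its coefficients: in the chart \<open>c\<close> with coordinate \<open>z\<close>, it is
  \<open>\<alpha> c x dz \<and> d(cnj z)\<close> at the point \<open>x\<close>. In a chart, tangent vectors are complex numbers and \<open>J\<close>
  is multiplication by \<open>\<i>\<close>; \<open>form_val\<close> evaluates a form with given coefficient on two tangent
  vectors.\<close>

type_synonym 'a form11 = "'a chart \<Rightarrow> 'a \<Rightarrow> complex"

definition form_val :: "complex \<Rightarrow> complex \<Rightarrow> complex \<Rightarrow> complex" where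
  "form_val a u v = a * (u * cnj v - v * cnj u)"

definition smooth_form11 :: "'a chart set \<Rightarrow> 'a set \<Rightarrow> 'a form11 \<Rightarrow> bool" where
  "smooth_form11 \<A> W \<alpha> \<longleftrightarrow>
     (\<forall>c\<in>\<A>. smooth (snd c ` (fst c \<inter> W)) (in_chart c (\<alpha> c))) \<and>
     (\<forall>c\<in>\<A>. \<forall>c'\<in>\<A>. \<forall>x \<in> fst c \<inter> fst c' \<inter> W.
        \<alpha> c x = \<alpha> c' x * deriv (transition c c') (snd c x) * cnj (deriv (transition c c') (snd c x)))"

definition real_form11 :: "'a chart set \<Rightarrow> 'a set \<Rightarrow> 'a form11 \<Rightarrow> bool" where
  "real_form11 \<A> W \<alpha> \<longleftrightarrow> (\<forall>c\<in>\<A>. \<forall>x \<in> fst c \<inter> W. \<forall>u v. form_val (\<alpha> c x) u v \<in> \<real>)"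

definition semipositive_form11 :: "'a chart set \<Rightarrow> 'a set \<Rightarrow> 'a form11 \<Rightarrow> bool" where
  "semipositive_form11 \<A> W \<alpha> \<longleftrightarrow> real_form11 \<A> W \<alpha> \<and>
     (\<forall>c\<in>\<A>. \<forall>x \<in> fst c \<inter> W. \<forall>v. Re (form_val (\<alpha> c x) v (\<i> * v)) \<ge> 0)"

text \<open>The bilinear form that has to be a metric is \<open>g(u, v) = \<alpha>(u, J v)\<close>; for a real form it is
  real-valued.\<close>

definition riemannian_form11 :: "'a chart set \<Rightarrow> 'a set \<Rightarrow> 'a form11 \<Rightarrow> bool" where
  "riemannian_form11 \<A> W \<alpha> \<longleftrightarrow>
     (\<forall>c\<in>\<A>. \<forall>x \<in> fst c \<inter> W.
        (\<forall>u v. form_val (\<alpha> c x) u (\<i> * v) = form_val (\<alpha> c x) v (\<i> * u)) \<and>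
        (\<forall>v. v \<noteq> 0 \<longrightarrow> Re (form_val (\<alpha> c x) v (\<i> * v)) > 0))"

definition form_ratio :: "'a chart set \<Rightarrow> 'a form11 \<Rightarrow> 'a form11 \<Rightarrow> 'a \<Rightarrow> real" where
  "form_ratio \<A> \<alpha> \<beta> x = (let c = (SOME c. c \<in> \<A> \<and> x \<in> fst c) in Re (\<alpha> c x / \<beta> c x))"

text \<open>The measure \<open>B \<mapsto> \<integral>\<^sub>B \<alpha>\<close> on the Borel sets of \<open>W\<close>, for a form \<open>\<alpha> > 0\<close>. In a chart with
  \<open>z = x + \<i> y\<close>, \<open>\<alpha> = \<alpha>(1, \<i>) dx \<and> dy\<close>. The measures obtained from the single charts (extended by
  zero) agree on overlaps, so their supremum in the lattice of measures glues them.\<close>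

definition chart_volume :: "'a topology \<Rightarrow> 'a set \<Rightarrow> 'a form11 \<Rightarrow> 'a chart \<Rightarrow> 'a measure" where
  "chart_volume X W \<alpha> c =
     distr (density (restrict_space lborel (snd c ` (fst c \<inter> W)))
              (\<lambda>z. ennreal (Re (form_val (in_chart c (\<alpha> c) z) 1 \<i>))))
           (sigma W {B. openin X B \<and> B \<subseteq> W})
           (inv_into (fst c) (snd c))"

definition form_volume :: "'a topology \<Rightarrow> 'a chart set \<Rightarrow> 'a set \<Rightarrow> 'a form11 \<Rightarrow> 'a measure" where
  "form_volume X \<A> W \<alpha> = (SUP c\<in>\<A>. chart_volume X W \<alpha> c)"

text \<open>Line bundles are given by cocycles. With local frames \<open>e\<^sub>i\<close> over \<open>patch i\<close> related by
  \<open>e\<^sub>j = cocycle i j \<cdot> e\<^sub>i\<close>, a section \<open>s\<close> is given by its components \<open>s = s i \<cdot> e\<^sub>i\<close>, and a Hermitian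
  metric by \<open>h i = |e\<^sub>i|\<^sup>2\<close>.\<close>

record ('a, 'i) line_bundle =
  idx :: "'i set"
  patch :: "'i \<Rightarrow> 'a set"
  cocycle :: "'i \<Rightarrow> 'i \<Rightarrow> 'a \<Rightarrow> complex"

type_synonym ('a, 'i) bsection = "'i \<Rightarrow> 'a \<Rightarrow> complex"
type_synonym ('a, 'i) metric = "'i \<Rightarrow> 'a \<Rightarrow> real"

definition hol_line_bundle ::
  "'a topology \<Rightarrow> 'a chart set \<Rightarrow> 'a set \<Rightarrow> ('a, 'i) line_bundle \<Rightarrow> bool" where
  "hol_line_bundle X \<A> W L \<longleftrightarrow>
     (\<forall>i\<in>idx L. openin X (patch L i)) \<and> (\<Union>i\<in>idx L. patch L i) = W \<and>
     (\<forall>i\<in>idx L. \<forall>j\<in>idx L. hol_fun \<A> (patch L i \<inter> patch L j) (cocycle L i j)) \<and>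
     (\<forall>i\<in>idx L. \<forall>x\<in>patch L i. cocycle L i i x = 1) \<and>
     (\<forall>i\<in>idx L. \<forall>j\<in>idx L. \<forall>k\<in>idx L. \<forall>x \<in> patch L i \<inter> patch L j \<inter> patch L k.
        cocycle L i j x * cocycle L j k x = cocycle L i k x)"

definition hol_section ::
  "'a chart set \<Rightarrow> 'a set \<Rightarrow> ('a, 'i) line_bundle \<Rightarrow> ('a, 'i) bsection \<Rightarrow> bool" where
  "hol_section \<A> W L s \<longleftrightarrow>
     (\<forall>i\<in>idx L. hol_fun \<A> (patch L i \<inter> W) (s i)) \<and>
     (\<forall>i\<in>idx L. \<forall>j\<in>idx L. \<forall>x \<in> patch L i \<inter> patch L j \<inter> W. s i x = cocycle L i j x * s j x)"

text \<open>A holomorphic frame over \<open>W\<close>, which is the same as a holomorphic trivialization over \<open>W\<close>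
  (the frame corresponding to the constant section 1).\<close>

definition hol_frame ::
  "'a chart set \<Rightarrow> 'a set \<Rightarrow> ('a, 'i) line_bundle \<Rightarrow> ('a, 'i) bsection \<Rightarrow> bool" where
  "hol_frame \<A> W L e \<longleftrightarrow>
     hol_section \<A> W L e \<and> (\<forall>i\<in>idx L. \<forall>x \<in> patch L i \<inter> W. e i x \<noteq> 0)"

definition smooth_metric ::
  "'a chart set \<Rightarrow> 'a set \<Rightarrow> ('a, 'i) line_bundle \<Rightarrow> ('a, 'i) metric \<Rightarrow> bool" where
  "smooth_metric \<A> W L h \<longleftrightarrow>
     (\<forall>i\<in>idx L. smooth_fun \<A> (patch L i \<inter> W) (h i)) \<and>
     (\<forall>i\<in>idx L. \<forall>x \<in> patch L i \<inter> W. h i x > 0) \<and>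
     (\<forall>i\<in>idx L. \<forall>j\<in>idx L. \<forall>x \<in> patch L i \<inter> patch L j \<inter> W.
        h j x = (cmod (cocycle L i j x))\<^sup>2 * h i x)"

definition idx_at :: "('a, 'i) line_bundle \<Rightarrow> 'a \<Rightarrow> 'i" where
  "idx_at L x = (SOME i. i \<in> idx L \<and> x \<in> patch L i)"

definition herm ::
  "('a, 'i) line_bundle \<Rightarrow> ('a, 'i) metric \<Rightarrow> ('a, 'i) bsection \<Rightarrow> ('a, 'i) bsection \<Rightarrow> 'a \<Rightarrow> complex" where
  "herm L h s t x = (let i = idx_at L x in s i x * cnj (t i x) * of_real (h i x))"

definition norm2 ::
  "('a, 'i) line_bundle \<Rightarrow> ('a, 'i) metric \<Rightarrow> ('a, 'i) bsection \<Rightarrow> 'a \<Rightarrow> real" where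
  "norm2 L h s x = (let i = idx_at L x in (cmod (s i x))\<^sup>2 * h i x)"

text \<open>Chern curvature \<open>R = - \<partial> \<partial>bar log |e\<^sub>i|\<^sup>2\<close>; the result does not depend on the frame \<open>e\<^sub>i\<close>.\<close>

definition curvature :: "('a, 'i) line_bundle \<Rightarrow> ('a, 'i) metric \<Rightarrow> 'a form11" where
  "curvature L h c x = (let i = idx_at L x in
     - pd_z (pd_zbar (in_chart c (\<lambda>y. of_real (ln (h i y))))) (snd c x))"

definition i_times :: "'a form11 \<Rightarrow> 'a form11" where
  "i_times \<alpha> c x = \<i> * \<alpha> c x"

text \<open>\<open>L\<^sup>p \<otimes> E\<close> carries the metric \<open>h\<^sup>p \<otimes> h\<^sup>E\<close>, in the frames \<open>e\<^sub>i\<^sup>p \<otimes> f\<^sub>k\<close>.\<close>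

definition twisted_power ::
  "('a, 'i) line_bundle \<Rightarrow> nat \<Rightarrow> ('a, 'k) line_bundle \<Rightarrow> ('a, 'i \<times> 'k) line_bundle" where
  "twisted_power L p E =
     \<lparr> idx = idx L \<times> idx E,
       patch = (\<lambda>(i, k). patch L i \<inter> patch E k),
       cocycle = (\<lambda>(i, k) (j, l) x. cocycle L i j x ^ p * cocycle E k l x) \<rparr>"

definition twisted_metric ::
  "('a, 'i) metric \<Rightarrow> nat \<Rightarrow> ('a, 'k) metric \<Rightarrow> ('a, 'i \<times> 'k) metric" where
  "twisted_metric h p hE = (\<lambda>(i, k) x. h i x ^ p * hE k x)"

definition L2_hol_sections ::
  "'a chart set \<Rightarrow> 'a set \<Rightarrow> ('a, 'i) line_bundle \<Rightarrow> ('a, 'i) metric \<Rightarrow> 'a measure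
     \<Rightarrow> ('a, 'i) bsection set" where
  "L2_hol_sections \<A> W L h \<mu> =
     {s. hol_section \<A> W L s \<and> (\<integral>\<^sup>+ x. ennreal (norm2 L h s x) \<partial>\<mu>) < \<infinity>}"

definition orthonormal_basis ::
  "'a chart set \<Rightarrow> 'a set \<Rightarrow> ('a, 'i) line_bundle \<Rightarrow> ('a, 'i) metric \<Rightarrow> 'a measure
     \<Rightarrow> nat \<Rightarrow> (nat \<Rightarrow> ('a, 'i) bsection) \<Rightarrow> bool" where
  "orthonormal_basis \<A> W L h \<mu> d S \<longleftrightarrow>
     (\<forall>k<d. S k \<in> L2_hol_sections \<A> W L h \<mu>) \<and>
     (\<forall>k<d. \<forall>l<d. (LINT x|\<mu>. herm L h (S k) (S l) x) = (if k = l then 1 else 0)) \<and>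
     (\<forall>s \<in> L2_hol_sections \<A> W L h \<mu>. \<exists>a :: nat \<Rightarrow> complex.
        \<forall>i\<in>idx L. \<forall>x \<in> patch L i \<inter> W. s i x = (\<Sum>k<d. a k * S k i x))"

definition bergman_density ::
  "('a, 'i) line_bundle \<Rightarrow> ('a, 'i) metric \<Rightarrow> nat \<Rightarrow> (nat \<Rightarrow> ('a, 'i) bsection) \<Rightarrow> 'a \<Rightarrow> real" where
  "bergman_density L h d S x = (\<Sum>k<d. norm2 L h (S k) x)"

definition punctured_disc :: "'a chart \<Rightarrow> 'a \<Rightarrow> real \<Rightarrow> 'a set" where
  "punctured_disc c a r = {x \<in> fst c - {a}. cmod (snd c x) < r}"

definition cut_surface ::
  "'a set \<Rightarrow> 'a set \<Rightarrow> ('a \<Rightarrow> 'a chart) \<Rightarrow> nat \<Rightarrow> real \<Rightarrow> real \<Rightarrow> 'a set" where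
  "cut_surface W D ch p t \<gamma> =
     W - (\<Union>a\<in>D. punctured_disc (ch a) a (t * exp (- (real p powr \<gamma>))))"

end

theory Submission
  imports Defs "HOL-Complex_Analysis.Complex_Analysis"
begin

text \<open>The Bergman density is an extremal quantity: \<open>B\<^sub>p(x)\<close> is the largest value of
\<open>|s(x)|\<^sup>2 / \<parallel>s\<parallel>\<^sup>2\<close> over the holomorphic \<open>L\<^sup>2\<close> sections \<open>s\<close>. An upper bound for it therefore needs no
construction of sections and no global analysis: it is enough to bound \<open>|s(x)|\<^sup>2\<close> by the integral of
\<open>|s|\<^sup>2\<close> over one small disc around \<open>x\<close>, with a constant that does not depend on \<open>s\<close>
(\<open>bergman_density_le\<close>, \<open>local_mean_value_bound\<close>).

In a coordinate disc a section is a holomorphic function \<open>F\<close> and \<open>|s|\<^sup>2 = |F|\<^sup>2 h\<^sup>p h\<^sup>E\<close>. The second order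
Taylor polynomial of \<open>ln h\<close> at \<open>z\<close> is the real part of a holomorphic polynomial minus \<open>\<kappa> |w|\<^sup>2\<close>, where
\<open>\<kappa> = - \<partial>\<partial>bar ln h\<close> is the coefficient of the curvature. The holomorphic polynomial can be absorbed into
\<open>F\<close>, and what is left is a mean value inequality for \<open>|F|\<^sup>2\<close> against the Gaussian \<open>exp (- p \<kappa> |w|\<^sup>2)\<close>
(\<open>gaussian_mean_square\<close>). The mass of this Gaussian is \<open>\<pi> / (p \<kappa>)\<close> up to a factor \<open>1 + o(1)\<close>, the volume
form is \<open>2 b\<close> times Lebesgue measure with \<open>b\<close> the coefficient of \<open>\<omega>\<close>, and so
\<open>B\<^sub>p(x) \<le> (1 + o(1)) p \<kappa> / (2 \<pi> b)\<close>; the quotient \<open>\<kappa> / b\<close> is the curvature ratio, at most \<open>2 \<pi> C\<^sub>0\<close>.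
Replacing \<open>\<kappa>\<close> by an upper bound slightly above \<open>2 \<pi> C\<^sub>0 b\<close> keeps the Gaussian nondegenerate where the
curvature vanishes, lets the disc have a radius independent of \<open>p\<close>, and makes the estimate uniform near each
point of the surface (\<open>bergman_local_bound\<close>).

Near a puncture such discs are not available uniformly, and the hyperbolic geometry of the cusp takes over.
In the coordinate \<open>w = log z\<close> the weight is \<open>h = - 2 Re w\<close> and \<open>\<omega>\<close> has the coefficient
\<open>1 / (4 (Re w)\<^sup>2)\<close>. With \<open>u = - Re w\<close>, the Euclidean disc of radius \<open>r u\<close> around \<open>w\<close> is a hyperbolic disc
of radius comparable to \<open>r\<close>, and the estimate above is explicit there (\<open>bergman_cusp_point\<close>). Its error is small as soon as
\<open>r \<longrightarrow> 0\<close> and \<open>p r\<^sup>2 \<longrightarrow> \<infinity>\<close>. The exponential is injective on the disc when \<open>r u < \<pi>\<close>; on the region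
\<open>|z| \<ge> t exp (- p\<^sup>\<gamma>)\<close> one has \<open>u \<le> p\<^sup>\<gamma> - ln t\<close>, so \<open>r = p powr (- \<gamma>')\<close> with \<open>\<gamma> < \<gamma>' < 1/2\<close>
satisfies all requirements. This is where \<open>\<gamma> < 1/2\<close> enters. The leading coefficient is \<open>1 / (2 \<pi>) \<le> C\<^sub>0\<close>, since
the curvature ratio is 1 in the cusps.

Compactness of the surface combines finitely many of these local estimates (\<open>eventually_uniform_on_surface\<close>).
Passing from \<open>(C\<^sub>0 + \<delta>) p\<close> to \<open>C\<^sub>0 (1 + o(1)) p\<close> requires \<open>C\<^sub>0 > 0\<close>: the curvature has finite vanishing
order, hence is not identically zero (\<open>curv_ratio_pos_somewhere\<close>). For \<open>C\<^sub>0\<close> to bound the curvature ratio, the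
ratio has to be bounded and to be a well-defined function, which rests on the transformation of the curvature
under changes of frames and charts (\<open>levi_transform\<close>).\<close>

section \<open>Sub-mean value inequalities for holomorphic functions with Gaussian weights\<close>

lemma nn_integral_lborel_translate:
  fixes f :: "'a::euclidean_space \<Rightarrow> ennreal"
  assumes [measurable]: "f \<in> borel_measurable borel"
  shows "(\<integral>\<^sup>+ x. f (a + x) \<partial>lborel) = (\<integral>\<^sup>+ x. f x \<partial>lborel)"
  by (subst (2) lborel_distr_plus[of a, symmetric]) (simp add: nn_integral_distr)

lemma nn_integral_lborel_reflect:
  fixes f :: "'a::euclidean_space \<Rightarrow> ennreal"
  assumes [measurable]: "f \<in> borel_measurable borel"
  shows "(\<integral>\<^sup>+ x. f (a - x) \<partial>lborel) = (\<integral>\<^sup>+ x. f x \<partial>lborel)"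
proof -
  have "lborel = distr lborel borel (\<lambda>x. a + (-1) *\<^sub>R x)"
    by (subst lborel_affine[of "-1" a]) (simp_all add: density_1)
  then have "(\<integral>\<^sup>+ x. f x \<partial>lborel) = (\<integral>\<^sup>+ x. f x \<partial>distr lborel borel (\<lambda>x. a + (-1) *\<^sub>R x))"
    by simp
  also have "\<dots> = (\<integral>\<^sup>+ x. f (a - x) \<partial>lborel)"
    by (subst nn_integral_distr) simp_all
  finally show ?thesis by simp
qed

text \<open>Both sides are translation invariant integrals that agree on the indicator \<open>g\<close> of the unit disc; this forces them
to agree, as in the uniqueness of Haar measure: compute \<open>\<integral>\<integral> g(x) f(c y - x)\<close> in both orders.\<close>

lemma nn_integral_rotate:
  fixes f :: "complex \<Rightarrow> ennreal" and c :: complex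
  assumes [measurable]: "f \<in> borel_measurable borel" and c: "cmod c = 1"
  shows "(\<integral>\<^sup>+ y. f (c * y) \<partial>lborel) = (\<integral>\<^sup>+ y. f y \<partial>lborel)"
proof -
  define g :: "complex \<Rightarrow> ennreal" where "g = indicator (ball 0 1)"
  have [measurable]: "g \<in> borel_measurable borel" unfolding g_def by (intro borel_measurable_indicator borel_open open_ball)
  have c0: "c \<noteq> 0" using c by auto
  have g_int: "(\<integral>\<^sup>+ y. g y \<partial>lborel) = ennreal pi"
    by (simp add: g_def emeasure_ball unit_ball_vol_2)
  have g_rot: "g (c * y) = g y" for y
    using c by (simp add: g_def indicator_def norm_mult)
  have "ennreal pi * (\<integral>\<^sup>+ y. f (c * y) \<partial>lborel) = (\<integral>\<^sup>+ x. g x * (\<integral>\<^sup>+ y. f (c * y) \<partial>lborel) \<partial>lborel)"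
    by (simp add: nn_integral_multc g_int)
  also have "\<dots> = (\<integral>\<^sup>+ x. g x * (\<integral>\<^sup>+ y. f (c * (- (x / c) + y)) \<partial>lborel) \<partial>lborel)"
    by (subst nn_integral_lborel_translate[of "\<lambda>y. f (c * y)"]) simp_all
  also have "\<dots> = (\<integral>\<^sup>+ x. (\<integral>\<^sup>+ y. g x * f (c * y - x) \<partial>lborel) \<partial>lborel)"
  proof -
    have "c * (- (x / c) + y) = c * y - x" for x y
      using c0 by (simp add: right_diff_distrib)
    then show ?thesis by (simp add: nn_integral_cmult)
  qed
  also have "\<dots> = (\<integral>\<^sup>+ y. (\<integral>\<^sup>+ x. g x * f (c * y - x) \<partial>lborel) \<partial>lborel)"
    by (rule lborel_pair.Fubini') measurable
  also have "\<dots> = (\<integral>\<^sup>+ y. (\<integral>\<^sup>+ x. g (c * y - x) * f x \<partial>lborel) \<partial>lborel)"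
  proof (rule nn_integral_cong)
    fix y
    show "(\<integral>\<^sup>+ x. g x * f (c * y - x) \<partial>lborel) = (\<integral>\<^sup>+ x. g (c * y - x) * f x \<partial>lborel)"
      using nn_integral_lborel_reflect[of "\<lambda>x. g (c * y - x) * f x" "c * y"] by simp
  qed
  also have "\<dots> = (\<integral>\<^sup>+ x. (\<integral>\<^sup>+ y. g (c * y - x) * f x \<partial>lborel) \<partial>lborel)"
    by (rule lborel_pair.Fubini') measurable
  also have "\<dots> = (\<integral>\<^sup>+ x. (\<integral>\<^sup>+ y. g (c * y) \<partial>lborel) * f x \<partial>lborel)"
  proof (rule nn_integral_cong)
    fix x
    have "(\<integral>\<^sup>+ y. g (c * y - x) * f x \<partial>lborel) = (\<integral>\<^sup>+ y. g (c * y - x) \<partial>lborel) * f x"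
      by (rule nn_integral_multc) measurable
    also have "(\<integral>\<^sup>+ y. g (c * y - x) \<partial>lborel) = (\<integral>\<^sup>+ y. g (c * y) \<partial>lborel)"
      using nn_integral_lborel_translate[of "\<lambda>y. g (c * y)" "- (x / c)"] c0 by (simp add: right_diff_distrib)
    finally show "(\<integral>\<^sup>+ y. g (c * y - x) * f x \<partial>lborel) = (\<integral>\<^sup>+ y. g (c * y) \<partial>lborel) * f x" .
  qed
  also have "\<dots> = ennreal pi * (\<integral>\<^sup>+ x. f x \<partial>lborel)"
    by (simp add: g_rot g_int nn_integral_cmult)
  finally show ?thesis
    by (simp add: ennreal_mult_cancel_left)
qed

text \<open>Cauchy's formula at the centre, applied to the square of \<open>F\<close>.\<close>

lemma circle_mean_square:
  fixes F :: "complex \<Rightarrow> complex"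
  assumes "F holomorphic_on ball z \<rho>" and w: "cmod w < \<rho>"
  shows "ennreal ((cmod (F z))\<^sup>2)
           \<le> (\<integral>\<^sup>+ t. ennreal ((cmod (F (z + exp (2 * pi * \<i> * of_real t) * w)))\<^sup>2) * indicator {0..1} t \<partial>lborel)"
proof -
  define g where "g = (\<lambda>\<zeta>. (F (z + \<zeta> * w))\<^sup>2)"
  have sub: "(\<lambda>\<zeta>. z + \<zeta> * w) ` cball 0 1 \<subseteq> ball z \<rho>"
  proof clarsimp
    fix \<zeta> :: complex assume "cmod \<zeta> \<le> 1"
    then have "cmod \<zeta> * cmod w \<le> 1 * cmod w" by (intro mult_right_mono) auto
    then show "dist z (z + \<zeta> * w) < \<rho>" using w by (simp add: dist_norm norm_mult)
  qed
  have Fc: "continuous_on (ball z \<rho>) F" using assms(1) by (rule holomorphic_on_imp_continuous_on)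
  have gc: "continuous_on (cball 0 1) g"
    unfolding g_def by (intro continuous_intros continuous_on_compose2[OF Fc] sub)
  have gh: "g holomorphic_on ball 0 1"
  proof -
    have "(F \<circ> (\<lambda>\<zeta>. z + \<zeta> * w)) holomorphic_on ball 0 1"
      by (rule holomorphic_on_compose_gen[OF _ assms(1)])
        (use sub in \<open>auto simp: image_subset_iff intro!: holomorphic_intros\<close>)
    then show ?thesis unfolding g_def o_def by (intro holomorphic_intros)
  qed
  have "((\<lambda>u. g u / (u - 0)) has_contour_integral 2 * pi * \<i> * g 0) (circlepath 0 1)"
    using Cauchy_integral_circlepath[OF gc gh, of 0] by simp
  then have "((\<lambda>t. g (circlepath 0 1 t) / circlepath 0 1 t * (2 * pi * \<i> * exp (2 * pi * \<i> * t)))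
      has_integral 2 * pi * \<i> * g 0) {0..1}"
    by (simp add: has_contour_integral vector_derivative_circlepath algebra_simps)
  then have I0: "((\<lambda>t. g (exp (2 * pi * \<i> * of_real t)) * (2 * pi * \<i>)) has_integral 2 * pi * \<i> * g 0) {0..1}"
    by (simp add: circlepath algebra_simps)
  from has_integral_mult_left[OF I0, of "1 / (2 * pi * \<i>)"]
  have I: "((\<lambda>t. g (exp (2 * pi * \<i> * of_real t))) has_integral g 0) {0..1}"
    by simp
  have gc': "continuous_on {0..1} (\<lambda>t. g (exp (2 * pi * \<i> * complex_of_real t)))"
    by (rule continuous_on_compose2[OF gc]) (auto intro!: continuous_intros)
  define n where "n = (\<lambda>t. cmod (g (exp (2 * pi * \<i> * complex_of_real t))))"
  have nc: "continuous_on {0..1} n" unfolding n_def by (intro continuous_intros gc')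
  have le: "cmod (g 0) \<le> integral {0..1} n"
    using integral_norm_bound_integral[of "\<lambda>t. g (exp (2 * pi * \<i> * complex_of_real t))" "{0..1}" n]
      integrable_continuous_interval[OF nc] I
    by (auto simp: n_def integral_unique has_integral_integrable)
  have "(\<integral>\<^sup>+ t. ennreal (n t) * indicator {0..1} t \<partial>lborel) = ennreal (integral {0..1} n)"
    using nn_integral_has_integral_lebesgue[of "{0..1}" n "integral {0..1} n"] integrable_integral[OF integrable_continuous_interval[OF nc]]
    by (simp add: n_def ennreal_mult ennreal_indicator mult.commute)
  with le show ?thesis
    by (simp add: n_def g_def norm_power ennreal_leI)
qed


text \<open>A radial weight does not see rotations, so the integral over the disc may be averaged over all rotations of \<open>F\<close>.
After exchanging the integrals the inner average is at least \<open>|F(z)|\<^sup>2\<close>. Rotation invariance of Lebesgue measure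
replaces polar coordinates here.\<close>

lemma weighted_area_mean_square:
  fixes F :: "complex \<Rightarrow> complex" and G :: "real \<Rightarrow> real"
  assumes F: "F holomorphic_on ball z \<rho>" and [measurable]: "G \<in> borel_measurable borel"
    and G0: "\<And>r. 0 \<le> G r"
  shows "ennreal ((cmod (F z))\<^sup>2) * (\<integral>\<^sup>+ w. ennreal (G (cmod w)) * indicator (ball 0 \<rho>) w \<partial>lborel)
     \<le> (\<integral>\<^sup>+ w. ennreal ((cmod (F (z + w)))\<^sup>2 * G (cmod w)) * indicator (ball 0 \<rho>) w \<partial>lborel)"
proof -
  have [measurable]: "ball (0::complex) \<rho> \<in> sets borel" by simp
  define \<Phi> where "\<Phi> = (\<lambda>w. ennreal (indicator (ball 0 \<rho>) w *\<^sub>R (cmod (F (z + w)))\<^sup>2))"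
  define e :: "real \<Rightarrow> complex" where "e = (\<lambda>t. exp (2 * pi * \<i> * of_real t))"
  have Fc: "continuous_on (ball z \<rho>) F" using F by (rule holomorphic_on_imp_continuous_on)
  have "continuous_on (ball 0 \<rho>) (\<lambda>w. (cmod (F (z + w)))\<^sup>2)"
    by (intro continuous_intros continuous_on_compose2[OF Fc]) (auto simp: dist_norm)
  then have [measurable]: "\<Phi> \<in> borel_measurable borel"
    unfolding \<Phi>_def
    by (intro measurable_compose[OF borel_measurable_continuous_on_indicator]) auto
  have [measurable]: "e \<in> borel_measurable borel"
    unfolding e_def by (intro borel_measurable_continuous_onI continuous_intros)
  have e1: "cmod (e t) = 1" for t
    by (simp add: e_def norm_exp_eq_Re)
  have mean: "ennreal ((cmod (F z))\<^sup>2) \<le> (\<integral>\<^sup>+ t. \<Phi> (e t * w) * indicator {0..1} t \<partial>lborel)"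
    if w: "w \<in> ball 0 \<rho>" for w
  proof -
    have "e t * w \<in> ball 0 \<rho>" for t
      using w by (simp add: norm_mult e1)
    then show ?thesis
      using circle_mean_square[OF F, of w] w by (simp add: \<Phi>_def e_def)
  qed
  have "ennreal ((cmod (F z))\<^sup>2) * (\<integral>\<^sup>+ w. ennreal (G (cmod w)) * indicator (ball 0 \<rho>) w \<partial>lborel)
     = (\<integral>\<^sup>+ w. ennreal ((cmod (F z))\<^sup>2) * (ennreal (G (cmod w)) * indicator (ball 0 \<rho>) w) \<partial>lborel)"
    by (simp add: nn_integral_cmult)
  also have "\<dots> \<le> (\<integral>\<^sup>+ w. (\<integral>\<^sup>+ t. \<Phi> (e t * w) * indicator {0..1} t \<partial>lborel) * ennreal (G (cmod w)) \<partial>lborel)"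
    using mean by (intro nn_integral_mono) (auto simp: indicator_def mult.commute intro!: mult_left_mono split: if_splits)
  also have "\<dots> = (\<integral>\<^sup>+ w. (\<integral>\<^sup>+ t. \<Phi> (e t * w) * indicator {0..1} t * ennreal (G (cmod w)) \<partial>lborel) \<partial>lborel)"
    by (simp add: nn_integral_multc)
  also have "\<dots> = (\<integral>\<^sup>+ t. (\<integral>\<^sup>+ w. \<Phi> (e t * w) * indicator {0..1} t * ennreal (G (cmod w)) \<partial>lborel) \<partial>lborel)"
    by (rule lborel_pair.Fubini') measurable
  also have "\<dots> = (\<integral>\<^sup>+ t. (\<integral>\<^sup>+ w. \<Phi> w * ennreal (G (cmod w)) \<partial>lborel) * indicator {0..1::real} t \<partial>lborel)"
  proof (rule nn_integral_cong)
    fix t :: real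
    have "(\<integral>\<^sup>+ w. \<Phi> (e t * w) * indicator {0..1} t * ennreal (G (cmod w)) \<partial>lborel)
       = (\<integral>\<^sup>+ w. (\<lambda>v. \<Phi> v * ennreal (G (cmod v)) * indicator {0..1} t) (e t * w) \<partial>lborel)"
      by (simp add: norm_mult e1 ac_simps)
    also have "\<dots> = (\<integral>\<^sup>+ w. \<Phi> w * ennreal (G (cmod w)) * indicator {0..1} t \<partial>lborel)"
      by (rule nn_integral_rotate) (simp_all add: e1)
    finally show "(\<integral>\<^sup>+ w. \<Phi> (e t * w) * indicator {0..1} t * ennreal (G (cmod w)) \<partial>lborel)
       = (\<integral>\<^sup>+ w. \<Phi> w * ennreal (G (cmod w)) \<partial>lborel) * indicator {0..1} t"
      by (simp add: nn_integral_multc)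
  qed
  also have "\<dots> = (\<integral>\<^sup>+ w. \<Phi> w * ennreal (G (cmod w)) \<partial>lborel)"
    by (simp add: nn_integral_cmult)
  also have "\<dots> = (\<integral>\<^sup>+ w. ennreal ((cmod (F (z + w)))\<^sup>2 * G (cmod w)) * indicator (ball 0 \<rho>) w \<partial>lborel)"
    by (intro nn_integral_cong) (auto simp: \<Phi>_def indicator_def ennreal_mult G0)
  finally show ?thesis .
qed

text \<open>A bound for the proportion of a Gaussian of width \<open>a\<close> lost outside the disc of radius \<open>\<rho>\<close>, as a function of \<open>v = a \<rho>\<^sup>2\<close>.\<close>

abbreviation gaussian_loss :: "real \<Rightarrow> real" where
  "gaussian_loss v \<equiv> (1 + v) * exp (- v)"

text \<open>Layer cake formula: \<open>exp (- a |w|\<^sup>2)\<close> is at least the integral of \<open>a exp (- a s)\<close> over \<open>|w|\<^sup>2 < s < \<rho>\<^sup>2\<close>, and the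
disc \<open>|w|\<^sup>2 < s\<close> has area \<open>\<pi> s\<close>. The exact mass of the Gaussian has \<open>exp (- a \<rho>\<^sup>2)\<close> in place of
\<open>(1 + a \<rho>\<^sup>2) exp (- a \<rho>\<^sup>2)\<close>; the tail of the layer cake beyond \<open>\<rho>\<^sup>2\<close> is dropped. Both tend to 0 as \<open>a \<rho>\<^sup>2 \<longrightarrow> \<infinity>\<close>, which is all that matters below.\<close>

lemma gaussian_disc_lower_bound:
  assumes a: "0 < a" and \<rho>: "0 < \<rho>"
  shows "ennreal (pi / a * (1 - gaussian_loss (a * \<rho>\<^sup>2)))
     \<le> (\<integral>\<^sup>+ w. ennreal (exp (- (a * (cmod w)\<^sup>2))) * indicator (ball 0 \<rho>) w \<partial>lborel)"
proof -
  define k where "k = (\<lambda>s. a * exp (- (a * s)))"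
  have k0: "0 \<le> k s" for s using a by (simp add: k_def)
  have [measurable]: "k \<in> borel_measurable borel" unfolding k_def by measurable
  let ?P = "\<lambda>s (w::complex). (cmod w)\<^sup>2 < s \<and> s < \<rho>\<^sup>2"
  have tail: "(\<integral>\<^sup>+ s. ennreal (k s) * indicator {s. ?P s w} s \<partial>lborel)
      \<le> ennreal (exp (- (a * (cmod w)\<^sup>2))) * indicator (ball 0 \<rho>) w" for w
  proof (cases "cmod w < \<rho>")
    case True
    have "((\<lambda>s. - exp (- (a * s))) has_real_derivative k s) (at s)" for s
      unfolding k_def by (auto intro!: derivative_eq_intros)
    moreover have "((\<lambda>s. - exp (- (a * s))) \<longlongrightarrow> 0) at_top"
      using a by real_asymp
    ultimately have "(\<integral>\<^sup>+ s. ennreal (k s) * indicator {(cmod w)\<^sup>2..} s \<partial>lborel) = ennreal (exp (- (a * (cmod w)\<^sup>2)))"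
      using nn_integral_FTC_atLeast[of k "(cmod w)\<^sup>2" "\<lambda>s. - exp (- (a * s))" 0] k0 by simp
    moreover have "(\<integral>\<^sup>+ s. ennreal (k s) * indicator {s. ?P s w} s \<partial>lborel)
       \<le> (\<integral>\<^sup>+ s. ennreal (k s) * indicator {(cmod w)\<^sup>2..} s \<partial>lborel)"
      by (intro nn_integral_mono) (auto simp: indicator_def)
    ultimately show ?thesis using True by simp
  next
    case False
    then have "\<rho>\<^sup>2 \<le> (cmod w)\<^sup>2" using \<rho> by (intro power_mono) auto
    then have "{s. ?P s w} = {}" by auto
    then show ?thesis by simp
  qed
  have disc: "(\<integral>\<^sup>+ w. indicator {s. ?P s w} s \<partial>lborel) = ennreal (pi * s) * indicator {0..<\<rho>\<^sup>2} s" for s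
  proof (cases "0 \<le> s \<and> s < \<rho>\<^sup>2")
    case True
    then have "(cmod w)\<^sup>2 < s \<longleftrightarrow> w \<in> ball 0 (sqrt s)" for w
      using real_sqrt_less_iff[of "(cmod w)\<^sup>2" s] by simp
    with True have "(\<integral>\<^sup>+ w. indicator {s. ?P s w} s \<partial>lborel) = (\<integral>\<^sup>+ w. indicator (ball 0 (sqrt s)) (w::complex) \<partial>lborel)"
      by (intro nn_integral_cong) (simp add: indicator_def)
    also have "\<dots> = ennreal (pi * s)"
      using True by (simp add: emeasure_ball unit_ball_vol_2)
    finally show ?thesis using True by simp
  next
    case False
    then have "\<not> ?P s w" for w :: complex using zero_le_power2[of "cmod w"] by linarith
    then have "(\<integral>\<^sup>+ w. indicator {s. ?P s w} s \<partial>lborel) = nn_integral lborel (\<lambda>w::complex. 0)"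
      by (intro nn_integral_cong) (simp only: indicator_def mem_Collect_eq, simp)
    moreover have "s \<notin> {0..<\<rho>\<^sup>2}" using False by simp
    ultimately show ?thesis by simp
  qed
  \<comment> \<open>An antiderivative of \<open>a exp (- a s) * \<pi> s\<close>, the weighted area of the disc at level \<open>s\<close>.\<close>
  have "((\<lambda>s. - (pi * (s + 1 / a)) * exp (- (a * s))) has_real_derivative k s * (pi * s)) (at s)" for s
    using a unfolding k_def by (auto intro!: derivative_eq_intros simp: field_simps)
  then have "(\<integral>\<^sup>+ s. ennreal (k s * (pi * s)) * indicator {0..\<rho>\<^sup>2} s \<partial>lborel)
     = ennreal (- (pi * (\<rho>\<^sup>2 + 1 / a)) * exp (- (a * \<rho>\<^sup>2)) - (- (pi * (0 + 1 / a)) * exp (- (a * 0))))"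
    using k0 by (intro nn_integral_FTC_Icc) auto
  also have "- (pi * (\<rho>\<^sup>2 + 1 / a)) * exp (- (a * \<rho>\<^sup>2)) - (- (pi * (0 + 1 / a)) * exp (- (a * 0)))
     = pi / a * (1 - gaussian_loss (a * \<rho>\<^sup>2))"
    using a by (simp add: field_simps)
  finally have "ennreal (pi / a * (1 - gaussian_loss (a * \<rho>\<^sup>2)))
     = (\<integral>\<^sup>+ s. ennreal (k s * (pi * s)) * indicator {0..\<rho>\<^sup>2} s \<partial>lborel)" by simp
  also have "\<dots> = (\<integral>\<^sup>+ s. ennreal (k s) * (ennreal (pi * s) * indicator {0..<\<rho>\<^sup>2} s) \<partial>lborel)"
  proof (rule nn_integral_cong_AE)
    have "AE s in lborel. s \<noteq> \<rho>\<^sup>2" by (rule AE_lborel_singleton)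
    then show "AE s in lborel. ennreal (k s * (pi * s)) * indicator {0..\<rho>\<^sup>2} s
        = ennreal (k s) * (ennreal (pi * s) * indicator {0..<\<rho>\<^sup>2} s)"
      by eventually_elim (auto simp: indicator_def ennreal_mult k0)
  qed
  also have "\<dots> = (\<integral>\<^sup>+ s. (\<integral>\<^sup>+ w. ennreal (k s) * indicator {s. ?P s w} s \<partial>lborel) \<partial>lborel)"
    unfolding disc[symmetric]
    by (intro nn_integral_cong nn_integral_cmult[symmetric]) (simp add: indicator_def, measurable)
  also have "\<dots> = (\<integral>\<^sup>+ w. (\<integral>\<^sup>+ s. ennreal (k s) * indicator {s. ?P s w} s \<partial>lborel) \<partial>lborel)"
    by (rule lborel_pair.Fubini') (simp add: indicator_def, measurable)
  also have "\<dots> \<le> (\<integral>\<^sup>+ w. ennreal (exp (- (a * (cmod w)\<^sup>2))) * indicator (ball 0 \<rho>) w \<partial>lborel)"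
    by (intro nn_integral_mono tail)
  finally show ?thesis .
qed

text \<open>The weight \<open>K\<close> needs a Gaussian lower bound only up to a factor \<open>|exp (A w + B w\<^sup>2)|\<^sup>2\<close>, since this factor can be moved
into the holomorphic function, without changing its value at the centre.\<close>

lemma gaussian_mean_square:
  assumes F: "F holomorphic_on ball z \<rho>" and a: "0 < a" and \<rho>: "0 < \<rho>" and m: "0 \<le> m"
    and K: "\<And>w. cmod w < \<rho> \<Longrightarrow>
      m * (cmod (exp (A * w + B * w\<^sup>2)))\<^sup>2 * exp (- (a * (cmod w)\<^sup>2)) \<le> K (z + w)"
    and Km: "K \<in> borel_measurable (restrict_space borel (ball z \<rho>))"
  shows "ennreal ((cmod (F z))\<^sup>2 * m * (pi / a * (1 - gaussian_loss (a * \<rho>\<^sup>2))))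
     \<le> (\<integral>\<^sup>+ \<zeta>. ennreal ((cmod (F \<zeta>))\<^sup>2 * K \<zeta>) * indicator (ball z \<rho>) \<zeta> \<partial>lborel)"
proof -
  let ?J = "pi / a * (1 - gaussian_loss (a * \<rho>\<^sup>2))"
  define f where "f = (\<lambda>\<zeta>. F \<zeta> * exp (A * (\<zeta> - z) + B * (\<zeta> - z)\<^sup>2))"
  have f: "f holomorphic_on ball z \<rho>" unfolding f_def by (intro holomorphic_intros F)
  have J0: "0 \<le> ?J"
  proof -
    have "1 + a * \<rho>\<^sup>2 \<le> exp (a * \<rho>\<^sup>2)" by (rule exp_ge_add_one_self)
    then have "gaussian_loss (a * \<rho>\<^sup>2) \<le> 1"
      by (simp add: exp_minus field_simps)
    then show ?thesis using a by simp
  qed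
  define g where "g = (\<lambda>\<zeta>. ennreal ((cmod (F \<zeta>))\<^sup>2 * K \<zeta>) * indicator (ball z \<rho>) \<zeta>)"
  have [measurable]: "g \<in> borel_measurable borel"
  proof -
    have "F \<in> borel_measurable (restrict_space borel (ball z \<rho>))"
      using F by (intro borel_measurable_continuous_on_restrict holomorphic_on_imp_continuous_on)
    then have "(\<lambda>\<zeta>. ennreal ((cmod (F \<zeta>))\<^sup>2 * K \<zeta>)) \<in> borel_measurable (restrict_space borel (ball z \<rho>))"
      using Km by measurable
    then show ?thesis
      unfolding g_def by (subst (asm) borel_measurable_restrict_space_iff_ennreal) auto
  qed
  have "ennreal ((cmod (F z))\<^sup>2 * m * ?J) = ennreal m * (ennreal ((cmod (f z))\<^sup>2) * ennreal ?J)"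
  proof -
    have "(cmod (F z))\<^sup>2 * m * ?J = m * ((cmod (f z))\<^sup>2 * ?J)" by (simp add: f_def)
    then show ?thesis using m J0 by (simp only: ennreal_mult[symmetric] zero_le_power2 mult_nonneg_nonneg)
  qed
  also have "\<dots> \<le> ennreal m * (ennreal ((cmod (f z))\<^sup>2) *
       (\<integral>\<^sup>+ w. ennreal (exp (- (a * (cmod w)\<^sup>2))) * indicator (ball 0 \<rho>) w \<partial>lborel))"
    by (intro mult_left_mono gaussian_disc_lower_bound a \<rho>) auto
  also have "\<dots> \<le> ennreal m * (\<integral>\<^sup>+ w. ennreal ((cmod (f (z + w)))\<^sup>2 * exp (- (a * (cmod w)\<^sup>2))) * indicator (ball 0 \<rho>) w \<partial>lborel)"
    by (intro mult_left_mono weighted_area_mean_square[OF f, of "\<lambda>r. exp (- (a * r\<^sup>2))"]) auto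
  also have "\<dots> = (\<integral>\<^sup>+ w. ennreal m * (ennreal ((cmod (f (z + w)))\<^sup>2 * exp (- (a * (cmod w)\<^sup>2))) * indicator (ball 0 \<rho>) w) \<partial>lborel)"
  proof (rule nn_integral_cmult[symmetric])
    have "continuous_on (ball 0 \<rho>) (\<lambda>w. (cmod (f (z + w)))\<^sup>2 * exp (- (a * (cmod w)\<^sup>2)))"
      by (intro continuous_intros continuous_on_compose2[OF holomorphic_on_imp_continuous_on[OF f]])
         (auto simp: dist_norm)
    then have "(\<lambda>w. ennreal (indicator (ball 0 \<rho>) w *\<^sub>R ((cmod (f (z + w)))\<^sup>2 * exp (- (a * (cmod w)\<^sup>2))))) \<in> borel_measurable borel"
      by (intro measurable_compose[OF borel_measurable_continuous_on_indicator]) auto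
    also have "(\<lambda>w. ennreal (indicator (ball 0 \<rho>) w *\<^sub>R ((cmod (f (z + w)))\<^sup>2 * exp (- (a * (cmod w)\<^sup>2)))))
      = (\<lambda>w. ennreal ((cmod (f (z + w)))\<^sup>2 * exp (- (a * (cmod w)\<^sup>2))) * indicator (ball 0 \<rho>) w)"
      by (auto simp: indicator_def)
    finally show "(\<lambda>w. ennreal ((cmod (f (z + w)))\<^sup>2 * exp (- (a * (cmod w)\<^sup>2))) * indicator (ball 0 \<rho>) w) \<in> borel_measurable lborel"
      by simp
  qed
  also have "\<dots> \<le> (\<integral>\<^sup>+ w. g (z + w) \<partial>lborel)"
  proof (rule nn_integral_mono)
    fix w
    show "ennreal m * (ennreal ((cmod (f (z + w)))\<^sup>2 * exp (- (a * (cmod w)\<^sup>2))) * indicator (ball 0 \<rho>) w) \<le> g (z + w)"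
    proof (cases "cmod w < \<rho>")
      case True
      have "m * ((cmod (f (z + w)))\<^sup>2 * exp (- (a * (cmod w)\<^sup>2)))
        = (cmod (F (z + w)))\<^sup>2 * (m * (cmod (exp (A * w + B * w\<^sup>2)))\<^sup>2 * exp (- (a * (cmod w)\<^sup>2)))"
        by (simp add: f_def norm_mult power_mult_distrib algebra_simps)
      also have "\<dots> \<le> (cmod (F (z + w)))\<^sup>2 * K (z + w)"
        by (intro mult_left_mono K True) auto
      finally show ?thesis
        using True m by (simp add: g_def dist_norm ennreal_mult[symmetric] ennreal_leI)
    qed simp
  qed
  also have "\<dots> = (\<integral>\<^sup>+ \<zeta>. g \<zeta> \<partial>lborel)"
    by (rule nn_integral_lborel_translate) measurable
  finally show ?thesis by (simp add: g_def)
qed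

lemma gaussian_tail_tendsto_0:
  fixes \<kappa> :: real
  assumes "0 < \<kappa>"
  shows "(\<lambda>p. gaussian_loss (real p * \<kappa>)) \<longlonglongrightarrow> 0"
  using assms by real_asymp

section \<open>Wirtinger calculus and second order expansions\<close>

text \<open>\<open>F\<close> is real differentiable at \<open>z\<close> with \<open>\<partial>F = a\<close> and \<open>\<partial>bar F = b\<close>. In this form the chain rule for a holomorphic inner
function is immediate.\<close>

definition wirtinger_at :: "(complex \<Rightarrow> complex) \<Rightarrow> complex \<Rightarrow> complex \<Rightarrow> complex \<Rightarrow> bool" where
  "wirtinger_at F z a b \<longleftrightarrow> (F has_derivative (\<lambda>v. a * v + b * cnj v)) (at z)"

lemma wirtinger_pd:
  assumes "wirtinger_at F z a b"
  shows "pd_z F z = a" "pd_zbar F z = b"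
proof -
  have D: "(F has_derivative (\<lambda>v. a * v + b * cnj v)) (at (z + u * of_real 0))" for u
    using assms by (simp add: wirtinger_at_def)
  have E: "((\<lambda>t::real. F (z + u * of_real t)) has_vector_derivative (a * u + b * cnj u)) (at 0)" for u
  proof -
    have "((\<lambda>t::real. z + u * of_real t) has_derivative (\<lambda>t. u * of_real t)) (at 0)"
      by (auto intro!: derivative_eq_intros)
    from has_derivative_compose[OF this D[of u]]
    show ?thesis
      by (simp add: has_vector_derivative_def scaleR_conv_of_real algebra_simps)
  qed
  have *: "pd_x F z = a + b" "pd_y F z = a * \<i> - b * \<i>"
    using vector_derivative_at[OF E[of 1]] vector_derivative_at[OF E[of \<i>]]
    by (simp_all add: pd_x_def pd_y_def)
  then show "pd_z F z = a" "pd_zbar F z = b"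
    unfolding pd_z_def pd_zbar_def * by (simp_all add: algebra_simps)
qed

lemma wirtinger_transform:
  assumes "wirtinger_at F z a b" "open S" "z \<in> S" "\<And>w. w \<in> S \<Longrightarrow> F w = G w"
  shows "wirtinger_at G z a b"
  using assms(1) unfolding wirtinger_at_def
  by (rule has_derivative_transform_within_open[OF _ assms(2-4)])

lemma wirtinger_holomorphic:
  assumes "(F has_field_derivative D) (at z)"
  shows "wirtinger_at F z D 0" "wirtinger_at (\<lambda>w. cnj (F w)) z 0 (cnj D)"
proof -
  have D: "(F has_derivative (\<lambda>v. D * v)) (at z)"
    using assms by (simp add: has_field_derivative_def)
  then show "wirtinger_at F z D 0" by (simp add: wirtinger_at_def)
  show "wirtinger_at (\<lambda>w. cnj (F w)) z 0 (cnj D)"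
    using bounded_linear.has_derivative[OF bounded_linear_cnj D] by (simp add: wirtinger_at_def)
qed

lemma wirtinger_add:
  assumes "wirtinger_at F z a b" "wirtinger_at G z a' b'"
  shows "wirtinger_at (\<lambda>w. F w + G w) z (a + a') (b + b')"
  using has_derivative_add[OF assms[unfolded wirtinger_at_def]]
  by (simp add: wirtinger_at_def algebra_simps)

lemma wirtinger_mult:
  assumes "wirtinger_at F z a b" "wirtinger_at G z a' b'"
  shows "wirtinger_at (\<lambda>w. F w * G w) z (F z * a' + a * G z) (F z * b' + b * G z)"
  using has_derivative_mult[OF assms[unfolded wirtinger_at_def]]
  by (simp add: wirtinger_at_def algebra_simps)

lemma wirtinger_compose:
  assumes T: "(T has_field_derivative T') (at z)" and F: "wirtinger_at F (T z) a b"
  shows "wirtinger_at (\<lambda>w. F (T w)) z (a * T') (b * cnj T')"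
  using has_derivative_compose[OF T[unfolded has_field_derivative_def] F[unfolded wirtinger_at_def]]
  by (simp add: wirtinger_at_def mult_ac)

lemma wirtinger_of_real:
  assumes "(f has_derivative (\<lambda>v. Re v *\<^sub>R f1 + Im v *\<^sub>R f2)) (at z)"
  shows "wirtinger_at (\<lambda>w. complex_of_real (f w)) z ((of_real f1 - \<i> * of_real f2) / 2) ((of_real f1 + \<i> * of_real f2) / 2)"
proof -
  have "(\<lambda>v. complex_of_real (Re v *\<^sub>R f1 + Im v *\<^sub>R f2)) =
     (\<lambda>v. (of_real f1 - \<i> * of_real f2) / 2 * v + (of_real f1 + \<i> * of_real f2) / 2 * cnj v)"
    by (auto simp: fun_eq_iff complex_eq_iff field_simps)
  moreover have "((\<lambda>w. complex_of_real (f w)) has_derivative (\<lambda>v. complex_of_real (Re v *\<^sub>R f1 + Im v *\<^sub>R f2))) (at z)"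
    using has_derivative_of_real[OF assms] .
  ultimately show ?thesis
    unfolding wirtinger_at_def by (simp only:)
qed

text \<open>Since \<open>\<partial>bar\<close> of \<open>ln |g|\<^sup>2\<close> is antiholomorphic, \<open>ln |g|\<^sup>2\<close> is harmonic; this is used in \<open>levi_transform\<close>.\<close>

lemma wirtinger_ln_norm:
  assumes g: "(g has_field_derivative g') (at z)" "g z \<noteq> 0"
  shows "wirtinger_at (\<lambda>w. complex_of_real (ln ((cmod (g w))\<^sup>2))) z (g' / g z) (cnj (g' / g z))"
proof -
  have D: "(g has_derivative (\<lambda>v. g' * v)) (at z)"
    using g(1) by (simp add: has_field_derivative_def)
  have "((\<lambda>w. (cmod (g w))\<^sup>2) has_derivative (\<lambda>v. 2 * (g z \<bullet> (g' * v)))) (at z)"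
    unfolding power2_norm_eq_inner
    using has_derivative_inner[OF D D] by (simp add: inner_commute)
  then have "((\<lambda>w. ln ((cmod (g w))\<^sup>2)) has_derivative (\<lambda>v. 2 * (g z \<bullet> (g' * v)) * inverse ((cmod (g z))\<^sup>2))) (at z)"
    using g(2) by (intro DERIV_compose_FDERIV[OF DERIV_ln]) simp_all
  from has_derivative_of_real[OF this]
  have H: "((\<lambda>w. complex_of_real (ln ((cmod (g w))\<^sup>2))) has_derivative
     (\<lambda>v. complex_of_real (2 * (g z \<bullet> (g' * v)) * inverse ((cmod (g z))\<^sup>2)))) (at z)" .
  have "complex_of_real (2 * (g z \<bullet> (g' * v)) * inverse ((cmod (g z))\<^sup>2)) = g' / g z * v + cnj (g' / g z) * cnj v" for v
  proof -
    have "complex_of_real (2 * (g z \<bullet> (g' * v))) = g' * v * cnj (g z) + cnj (g' * v * cnj (g z))"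
      unfolding complex_add_cnj by (simp add: inner_complex_def algebra_simps)
    moreover have "complex_of_real ((cmod (g z))\<^sup>2) = g z * cnj (g z)"
      by (simp only: complex_norm_square[symmetric])
    ultimately show ?thesis using g(2)
      by (simp add: field_simps of_real_mult)
  qed
  with H show ?thesis unfolding wirtinger_at_def by (simp only:)
qed

lemma C_diff_subset:
  assumes "T \<subseteq> S" "C_diff n S f"
  shows "C_diff n T f"
  using assms(2)
proof (induction n arbitrary: f)
  case 0
  then show ?case using assms(1) by (auto intro: continuous_on_subset)
next
  case (Suc n)
  then obtain f1 f2 where "\<forall>z\<in>S. (f has_derivative (\<lambda>v. Re v *\<^sub>R f1 z + Im v *\<^sub>R f2 z)) (at z)"
    "C_diff n S f1" "C_diff n S f2" unfolding C_diff.simps by blast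
  with Suc.IH[of f1] Suc.IH[of f2] assms(1) show ?case
    unfolding C_diff.simps by (intro exI[of _ f1] exI[of _ f2]) blast
qed

lemma C_diff_ln:
  assumes "C_diff 2 S f" and pos: "\<And>z. z \<in> S \<Longrightarrow> 0 < f z"
  shows "C_diff 2 S (\<lambda>z. ln (f z :: real))"
proof -
  obtain f1 f2 where f: "\<And>z. z \<in> S \<Longrightarrow> (f has_derivative (\<lambda>v. Re v *\<^sub>R f1 z + Im v *\<^sub>R f2 z)) (at z)"
    and c1: "C_diff 1 S f1" and c2: "C_diff 1 S f2"
    using assms(1) by (auto simp: numeral_2_eq_2)
  have fc: "continuous_on S f"
    by (intro continuous_at_imp_continuous_on ballI has_derivative_continuous[OF f])
  have *: "C_diff 1 S (\<lambda>z. g z / f z)" if g1: "C_diff 1 S g" for g :: "complex \<Rightarrow> real"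
  proof -
    obtain g1 g2 where g: "\<And>z. z \<in> S \<Longrightarrow> (g has_derivative (\<lambda>v. Re v *\<^sub>R g1 z + Im v *\<^sub>R g2 z)) (at z)"
      and gc: "continuous_on S g1" "continuous_on S g2"
      using g1 by auto
    have gcc: "continuous_on S g"
      by (intro continuous_at_imp_continuous_on ballI has_derivative_continuous[OF g])
    have fcc: "continuous_on S f1" "continuous_on S f2"
      using c1 c2 by (auto intro!: continuous_at_imp_continuous_on dest: has_derivative_continuous)
    have nz: "f z \<noteq> 0" if "z \<in> S" for z using pos[OF that] by simp
    let ?h1 = "\<lambda>z. (g1 z * f z - g z * f1 z) / (f z * f z)"
    let ?h2 = "\<lambda>z. (g2 z * f z - g z * f2 z) / (f z * f z)"
    have "((\<lambda>z. g z / f z) has_derivative (\<lambda>v. Re v *\<^sub>R ?h1 z + Im v *\<^sub>R ?h2 z)) (at z)" if z: "z \<in> S" for z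
      using has_derivative_divide'[OF g[OF z] f[OF z] nz[OF z]]
      by (rule has_derivative_eq_rhs) (use nz[OF z] in \<open>auto simp: fun_eq_iff field_simps\<close>)
    moreover have "continuous_on S ?h1" "continuous_on S ?h2"
      by (intro continuous_intros gc gcc fc fcc; use nz in force)+
    ultimately show ?thesis
      unfolding One_nat_def C_diff.simps by (intro exI conjI ballI)
  qed
  have "((\<lambda>z. ln (f z)) has_derivative (\<lambda>v. Re v *\<^sub>R (f1 z / f z) + Im v *\<^sub>R (f2 z / f z))) (at z)" if z: "z \<in> S" for z
    by (rule has_derivative_eq_rhs[OF has_derivative_ln[OF pos[OF z] f[OF z]]])
      (use pos[OF z] in \<open>auto simp: fun_eq_iff field_simps\<close>)
  then show ?thesis
    unfolding numeral_2_eq_2 C_diff.simps(2)[of "Suc 0"]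
    using *[OF c1, unfolded One_nat_def] *[OF c2, unfolded One_nat_def] by (intro exI conjI ballI)
qed

lemma C_diff_2E:
  fixes \<phi> :: "complex \<Rightarrow> real"
  assumes "C_diff 2 S \<phi>"
  obtains f1 f2 f11 f12 f21 f22 where
    "\<And>z. z \<in> S \<Longrightarrow> (\<phi> has_derivative (\<lambda>v. Re v *\<^sub>R f1 z + Im v *\<^sub>R f2 z)) (at z)"
    "\<And>z. z \<in> S \<Longrightarrow> (f1 has_derivative (\<lambda>v. Re v *\<^sub>R f11 z + Im v *\<^sub>R f12 z)) (at z)"
    "\<And>z. z \<in> S \<Longrightarrow> (f2 has_derivative (\<lambda>v. Re v *\<^sub>R f21 z + Im v *\<^sub>R f22 z)) (at z)"
    "continuous_on S f11" "continuous_on S f12" "continuous_on S f21" "continuous_on S f22"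
proof -
  obtain f1 f2 where f: "\<forall>z\<in>S. (\<phi> has_derivative (\<lambda>v. Re v *\<^sub>R f1 z + Im v *\<^sub>R f2 z)) (at z)"
    and c: "C_diff (Suc 0) S f1" "C_diff (Suc 0) S f2"
    using assms unfolding numeral_2_eq_2 C_diff.simps(2)[of "Suc 0"] by blast
  from c(1) obtain f11 f12 where f1: "\<forall>z\<in>S. (f1 has_derivative (\<lambda>v. Re v *\<^sub>R f11 z + Im v *\<^sub>R f12 z)) (at z)"
    "continuous_on S f11" "continuous_on S f12"
    unfolding C_diff.simps by blast
  from c(2) obtain f21 f22 where f2: "\<forall>z\<in>S. (f2 has_derivative (\<lambda>v. Re v *\<^sub>R f21 z + Im v *\<^sub>R f22 z)) (at z)"
    "continuous_on S f21" "continuous_on S f22"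
    unfolding C_diff.simps by blast
  show thesis
    by (rule that[OF bspec[OF f] bspec[OF f1(1)] bspec[OF f2(1)] f1(2,3) f2(2,3)])
qed

text \<open>The coefficient of \<open>\<partial>\<partial>bar \<phi>\<close>; for a weight \<open>\<phi> = ln |e|\<^sup>2\<close> it is minus the curvature coefficient.\<close>

definition levi :: "(complex \<Rightarrow> real) \<Rightarrow> complex \<Rightarrow> complex" where
  "levi \<phi> z = pd_z (pd_zbar (\<lambda>w. complex_of_real (\<phi> w))) z"

lemma levi_eq_laplacian:
  assumes S: "open S" "z \<in> S"
    and f: "\<And>z. z \<in> S \<Longrightarrow> (\<phi> has_derivative (\<lambda>v. Re v *\<^sub>R f1 z + Im v *\<^sub>R f2 z)) (at z)"
    and f1: "(f1 has_derivative (\<lambda>v. Re v *\<^sub>R f11 + Im v *\<^sub>R f12)) (at z)"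
    and f2: "(f2 has_derivative (\<lambda>v. Re v *\<^sub>R f21 + Im v *\<^sub>R f22)) (at z)"
  shows "\<exists>b. wirtinger_at (pd_zbar (\<lambda>w. complex_of_real (\<phi> w))) z (levi \<phi> z) b"
    and "Re (levi \<phi> z) = (f11 + f22) / 4"
proof -
  have zb: "pd_zbar (\<lambda>w. complex_of_real (\<phi> w)) w = of_real (f1 w) * (1/2) + of_real (f2 w) * (\<i> / 2)" if "w \<in> S" for w
    using wirtinger_pd(2)[OF wirtinger_of_real[OF f[OF that]]] by (simp add: field_simps)
  have const: "wirtinger_at (\<lambda>_. c) z 0 0" for c by (simp add: wirtinger_at_def)
  let ?a = "of_real (f1 z) * 0 + (of_real f11 - \<i> * of_real f12) / 2 * (1/2) + (of_real (f2 z) * 0 + (of_real f21 - \<i> * of_real f22) / 2 * (\<i>/2))"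
  let ?b = "of_real (f1 z) * 0 + (of_real f11 + \<i> * of_real f12) / 2 * (1/2) + (of_real (f2 z) * 0 + (of_real f21 + \<i> * of_real f22) / 2 * (\<i>/2))"
  have W: "wirtinger_at (\<lambda>w. of_real (f1 w) * (1/2) + of_real (f2 w) * (\<i> / 2)) z ?a ?b"
    by (intro wirtinger_add wirtinger_mult wirtinger_of_real f1 f2 const)
  have W': "wirtinger_at (pd_zbar (\<lambda>w. complex_of_real (\<phi> w))) z ?a ?b"
    using wirtinger_transform[OF W S] zb by force
  show "\<exists>b. wirtinger_at (pd_zbar (\<lambda>w. complex_of_real (\<phi> w))) z (levi \<phi> z) b"
    using W' wirtinger_pd(1)[OF W'] by (auto simp: levi_def)
  show "Re (levi \<phi> z) = (f11 + f22) / 4"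
    unfolding levi_def wirtinger_pd(1)[OF W'] by simp
qed

text \<open>One computation covers all changes of description of a metric weight: \<open>T\<close> is a change of coordinates and \<open>g\<close> a
change of holomorphic frame. The term \<open>ln |g|\<^sup>2\<close> is harmonic, and \<open>\<partial>bar (\<phi> \<circ> T)\<close> is the product of
\<open>(\<partial>bar \<phi>) \<circ> T\<close> with the antiholomorphic function \<open>cnj T'\<close>, which \<open>\<partial>\<close> does not see.\<close>

lemma levi_transform:
  assumes S: "open S" "z \<in> S" and S': "open S'" and T: "T holomorphic_on S" "T ` S \<subseteq> S'"
    and \<phi>: "C_diff 2 S' \<phi>" and g: "g holomorphic_on S" "\<And>w. w \<in> S \<Longrightarrow> g w \<noteq> 0"
    and eq: "\<And>w. w \<in> S \<Longrightarrow> \<psi> w = \<phi> (T w) + ln ((cmod (g w))\<^sup>2)"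
  shows "levi \<psi> z = levi \<phi> (T z) * deriv T z * cnj (deriv T z)"
proof -
  obtain f1 f2 f11 f12 f21 f22 where f: "\<And>z. z \<in> S' \<Longrightarrow> (\<phi> has_derivative (\<lambda>v. Re v *\<^sub>R f1 z + Im v *\<^sub>R f2 z)) (at z)"
    and f1: "\<And>z. z \<in> S' \<Longrightarrow> (f1 has_derivative (\<lambda>v. Re v *\<^sub>R f11 z + Im v *\<^sub>R f12 z)) (at z)"
    and f2: "\<And>z. z \<in> S' \<Longrightarrow> (f2 has_derivative (\<lambda>v. Re v *\<^sub>R f21 z + Im v *\<^sub>R f22 z)) (at z)"
    and cont: "continuous_on S' f11" "continuous_on S' f12" "continuous_on S' f21" "continuous_on S' f22"
    by (rule C_diff_2E[OF \<phi>]) (rule that; assumption)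
  let ?b = "pd_zbar (\<lambda>w. complex_of_real (\<phi> w))"
  have TS: "T w \<in> S'" if "w \<in> S" for w using T that by auto
  have dT: "(T has_field_derivative deriv T w) (at w)" if "w \<in> S" for w
    using T(1) S(1) that by (rule holomorphic_derivI)
  have dg: "(g has_field_derivative deriv g w) (at w)" if "w \<in> S" for w
    using g(1) S(1) that by (rule holomorphic_derivI)
  have zb: "pd_zbar (\<lambda>w. complex_of_real (\<psi> w)) w = ?b (T w) * cnj (deriv T w) + cnj (deriv g w / g w)" if w: "w \<in> S" for w
  proof -
    have "wirtinger_at (\<lambda>w. complex_of_real (\<phi> w)) (T w) ((of_real (f1 (T w)) - \<i> * of_real (f2 (T w))) / 2) ((of_real (f1 (T w)) + \<i> * of_real (f2 (T w))) / 2)"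
      using wirtinger_of_real f TS w by blast
    then have A: "wirtinger_at (\<lambda>w. complex_of_real (\<phi> w)) (T w) ((of_real (f1 (T w)) - \<i> * of_real (f2 (T w))) / 2) (?b (T w))"
      using wirtinger_pd(2) by metis
    have "wirtinger_at (\<lambda>w. complex_of_real (\<phi> (T w)) + complex_of_real (ln ((cmod (g w))\<^sup>2))) w
        ((of_real (f1 (T w)) - \<i> * of_real (f2 (T w))) / 2 * deriv T w + deriv g w / g w)
        (?b (T w) * cnj (deriv T w) + cnj (deriv g w / g w))"
      using wirtinger_add[OF wirtinger_compose[OF dT[OF w] A] wirtinger_ln_norm[OF dg[OF w] g(2)[OF w]]] .
    from wirtinger_transform[OF this S(1) w, of "\<lambda>w. complex_of_real (\<psi> w)"] eq
    show ?thesis by (auto dest: wirtinger_pd)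
  qed
  obtain b where b: "wirtinger_at ?b (T z) (levi \<phi> (T z)) b"
    using levi_eq_laplacian(1)[OF S'(1) TS[OF S(2)] f f1[OF TS[OF S(2)]] f2[OF TS[OF S(2)]]] by blast
  have ddT: "(deriv T has_field_derivative deriv (deriv T) z) (at z)"
    using holomorphic_deriv[OF T(1) S(1)] S by (rule holomorphic_derivI)
  have dg2: "((\<lambda>w. deriv g w / g w) has_field_derivative deriv (\<lambda>w. deriv g w / g w) z) (at z)"
    by (rule holomorphic_derivI[OF _ S]) (intro holomorphic_intros g holomorphic_deriv S(1); use g(2) in auto)
  have "wirtinger_at (\<lambda>w. ?b (T w) * cnj (deriv T w) + cnj (deriv g w / g w)) z
      ((?b (T z) * 0 + levi \<phi> (T z) * deriv T z * cnj (deriv T z)) + 0)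
      ((?b (T z) * cnj (deriv (deriv T) z) + b * cnj (deriv T z) * cnj (deriv T z)) + cnj (deriv (\<lambda>w. deriv g w / g w) z))"
    by (intro wirtinger_add wirtinger_mult wirtinger_compose[OF dT[OF S(2)] b]
        wirtinger_holomorphic(2)[OF ddT] wirtinger_holomorphic(2)[OF dg2])
  from wirtinger_transform[OF this S, of "pd_zbar (\<lambda>w. complex_of_real (\<psi> w))"] zb
  show ?thesis by (auto simp: levi_def dest: wirtinger_pd)
qed

lemma levi_continuous:
  assumes S: "open S" and \<phi>: "C_diff 2 S \<phi>"
  shows "continuous_on S (\<lambda>z. Re (levi \<phi> z))"
proof -
  obtain f1 f2 f11 f12 f21 f22 where f: "\<And>z. z \<in> S \<Longrightarrow> (\<phi> has_derivative (\<lambda>v. Re v *\<^sub>R f1 z + Im v *\<^sub>R f2 z)) (at z)"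
    and f1: "\<And>z. z \<in> S \<Longrightarrow> (f1 has_derivative (\<lambda>v. Re v *\<^sub>R f11 z + Im v *\<^sub>R f12 z)) (at z)"
    and f2: "\<And>z. z \<in> S \<Longrightarrow> (f2 has_derivative (\<lambda>v. Re v *\<^sub>R f21 z + Im v *\<^sub>R f22 z)) (at z)"
    and cont: "continuous_on S f11" "continuous_on S f12" "continuous_on S f21" "continuous_on S f22"
    by (rule C_diff_2E[OF \<phi>]) (rule that; assumption)
  have "continuous_on S (\<lambda>z. (f11 z + f22 z) / 4)" by (intro continuous_intros cont) auto
  moreover have "Re (levi \<phi> z) = (f11 z + f22 z) / 4" if "z \<in> S" for z
    using levi_eq_laplacian(2)[OF S that f f1[OF that] f2[OF that]] .
  ultimately show ?thesis by (subst continuous_on_cong[OF refl]) auto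
qed

text \<open>The quadratic part of the Taylor expansion splits as
\<open>(f11 x\<^sup>2 + (f12 + f21) x y + f22 y\<^sup>2) / 2 = Re (B w\<^sup>2) + (f11 + f22) / 4 * |w|\<^sup>2\<close>, and the last coefficient is that of
\<open>\<partial>\<partial>bar \<phi>\<close>. Uniform continuity of the second derivatives makes the radius independent of the base point \<open>z\<close>.\<close>

lemma second_order_lower_bound:
  assumes S: "open S" and \<phi>: "C_diff 2 S \<phi>" and z0: "z0 \<in> S" and \<epsilon>: "0 < \<epsilon>"
  shows "\<exists>r>0. ball z0 (2 * r) \<subseteq> S \<and> (\<forall>z\<in>ball z0 r. \<exists>A B. \<forall>w. cmod w < r \<longrightarrow>
     \<phi> z + Re (A * w + B * w\<^sup>2) + (Re (levi \<phi> z) - \<epsilon>) * (cmod w)\<^sup>2 \<le> \<phi> (z + w))"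
proof -
  obtain f1 f2 f11 f12 f21 f22 where f: "\<And>z. z \<in> S \<Longrightarrow> (\<phi> has_derivative (\<lambda>v. Re v *\<^sub>R f1 z + Im v *\<^sub>R f2 z)) (at z)"
    and f1: "\<And>z. z \<in> S \<Longrightarrow> (f1 has_derivative (\<lambda>v. Re v *\<^sub>R f11 z + Im v *\<^sub>R f12 z)) (at z)"
    and f2: "\<And>z. z \<in> S \<Longrightarrow> (f2 has_derivative (\<lambda>v. Re v *\<^sub>R f21 z + Im v *\<^sub>R f22 z)) (at z)"
    and cont: "continuous_on S f11" "continuous_on S f12" "continuous_on S f21" "continuous_on S f22"
    by (rule C_diff_2E[OF \<phi>]) (rule that; assumption)
  obtain R where R: "R > 0" "cball z0 R \<subseteq> S" using S z0 open_contains_cball by blast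
  have uc: "\<exists>d>0. \<forall>x\<in>cball z0 R. \<forall>x'\<in>cball z0 R. dist x' x < d \<longrightarrow> \<bar>g x' - g x\<bar> \<le> \<epsilon> / 4"
    if "continuous_on S g" for g :: "complex \<Rightarrow> real"
  proof -
    have "uniformly_continuous_on (cball z0 R) g"
      using that R(2) by (intro compact_uniformly_continuous compact_cball) (rule continuous_on_subset)
    then obtain d where "d > 0" "\<And>x x'. x \<in> cball z0 R \<Longrightarrow> x' \<in> cball z0 R \<Longrightarrow> dist x' x < d \<Longrightarrow> dist (g x') (g x) < \<epsilon> / 4"
      using \<epsilon> by (elim uniformly_continuous_onE[of _ _ "\<epsilon> / 4"]) auto
    then show ?thesis by (intro exI[of _ d]) (auto simp: dist_real_def intro: less_imp_le)
  qed
  from uc[OF cont(1)] obtain d1 where d1: "d1 > 0"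
    "\<forall>x\<in>cball z0 R. \<forall>x'\<in>cball z0 R. dist x' x < d1 \<longrightarrow> \<bar>f11 x' - f11 x\<bar> \<le> \<epsilon> / 4" by (elim exE conjE)
  from uc[OF cont(2)] obtain d2 where d2: "d2 > 0"
    "\<forall>x\<in>cball z0 R. \<forall>x'\<in>cball z0 R. dist x' x < d2 \<longrightarrow> \<bar>f12 x' - f12 x\<bar> \<le> \<epsilon> / 4" by (elim exE conjE)
  from uc[OF cont(3)] obtain d3 where d3: "d3 > 0"
    "\<forall>x\<in>cball z0 R. \<forall>x'\<in>cball z0 R. dist x' x < d3 \<longrightarrow> \<bar>f21 x' - f21 x\<bar> \<le> \<epsilon> / 4" by (elim exE conjE)
  from uc[OF cont(4)] obtain d4 where d4: "d4 > 0"
    "\<forall>x\<in>cball z0 R. \<forall>x'\<in>cball z0 R. dist x' x < d4 \<longrightarrow> \<bar>f22 x' - f22 x\<bar> \<le> \<epsilon> / 4" by (elim exE conjE)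
  define r where "r = min (R/2) (min (min d1 d2) (min d3 d4))"
  have r: "0 < r" "2 * r \<le> R" "r \<le> d1" "r \<le> d2" "r \<le> d3" "r \<le> d4"
    using R d1 d2 d3 d4 by (auto simp: r_def)
  have "\<exists>A B. \<forall>w. cmod w < r \<longrightarrow> \<phi> z + Re (A * w + B * w\<^sup>2) + (Re (levi \<phi> z) - \<epsilon>) * (cmod w)\<^sup>2 \<le> \<phi> (z + w)"
    if z: "z \<in> ball z0 r" for z
  proof -
    \<comment> \<open>Chosen so that \<open>Re (A w + B w\<^sup>2)\<close> is the pluriharmonic part of the Taylor polynomial.\<close>
    define A where "A = Complex (f1 z) (- f2 z)"
    define B where "B = Complex ((f11 z - f22 z) / 4) (- (f12 z + f21 z) / 4)"
    have "\<phi> z + Re (A * w + B * w\<^sup>2) + (Re (levi \<phi> z) - \<epsilon>) * (cmod w)\<^sup>2 \<le> \<phi> (z + w)" if w: "cmod w < r" for w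
    proof -
      define x y where "x = Re w" and "y = Im w"
      have zS: "z \<in> S" using z r R by (auto simp: subset_iff)
      have inR: "z + of_real t * w \<in> cball z0 R" and near: "dist (z + of_real t * w) z < r" if t: "0 \<le> t" "t \<le> 1" for t
      proof -
        have "cmod (of_real t * w) \<le> cmod w" using t by (simp add: norm_mult mult_left_le_one_le)
        then have le: "cmod (of_real t * w) < r" using w by linarith
        then show "dist (z + of_real t * w) z < r" by (simp add: dist_norm)
        have "dist z0 (z + of_real t * w) \<le> dist z0 z + dist z (z + of_real t * w)" by (rule dist_triangle)
        also have "\<dots> \<le> r + r" using z le by (intro add_mono) (auto simp: dist_norm norm_mult)
        finally show "z + of_real t * w \<in> cball z0 R" using r by simp
      qed
      have zR: "z \<in> cball z0 R" using inR[of 0] by simp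
      define p where "p = (\<lambda>t::real. z + of_real t * w)"
      define g0 where "g0 = (\<lambda>t. \<phi> (p t))"
      define g1 where "g1 = (\<lambda>t. x * f1 (p t) + y * f2 (p t))"
      define g2 where "g2 = (\<lambda>t. x * (x * f11 (p t) + y * f12 (p t)) + y * (x * f21 (p t) + y * f22 (p t)))"
      have pS: "p t \<in> S" if "0 \<le> t" "t \<le> 1" for t using inR[OF that] R by (auto simp: p_def)
      have pd: "(p has_derivative (\<lambda>h. of_real h * w)) (at t)" for t
        unfolding p_def by (auto intro!: derivative_eq_intros)
      have chain: "((\<lambda>t. q (p t)) has_real_derivative (x * q1 + y * q2)) (at t)"
        if "(q has_derivative (\<lambda>v. Re v *\<^sub>R q1 + Im v *\<^sub>R q2)) (at (p t))" for q :: "complex \<Rightarrow> real" and q1 q2 t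
        unfolding has_field_derivative_def
        by (rule has_derivative_eq_rhs[OF has_derivative_compose[OF pd that]])
           (simp add: x_def y_def fun_eq_iff algebra_simps)
      have g0': "(g0 has_real_derivative g1 t) (at t)" if "0 \<le> t" "t \<le> 1" for t
        unfolding g0_def g1_def by (rule chain f pS that)+
      have g1': "(g1 has_real_derivative g2 t) (at t)" if "0 \<le> t" "t \<le> 1" for t
        unfolding g1_def g2_def
        by (intro DERIV_add DERIV_cmult chain f1 f2 pS that)
      define dif where "dif = (\<lambda>m (t::real). if m = 0 then g0 t else if m = (1::nat) then g1 t else g2 t)"
      have "\<exists>t. 0 < t \<and> t < 1 \<and> g0 1 = (\<Sum>m<2. dif m 0 / fact m * 1 ^ m) + dif 2 t / fact 2 * 1 ^ 2"
      proof (rule Maclaurin)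
        show "\<forall>m t. m < 2 \<and> 0 \<le> t \<and> t \<le> 1 \<longrightarrow> (dif m has_real_derivative dif (Suc m) t) (at t)"
        proof (intro allI impI)
          fix m :: nat and t :: real assume "m < 2 \<and> 0 \<le> t \<and> t \<le> 1"
          then consider "m = 0" "0 \<le> t" "t \<le> 1" | "m = 1" "0 \<le> t" "t \<le> 1" by linarith
          then show "(dif m has_real_derivative dif (Suc m) t) (at t)"
            by cases (use g0'[of t] g1'[of t] in \<open>simp_all add: dif_def\<close>)
        qed
      qed (auto simp: dif_def)
      then obtain t where t: "0 < t" "t < 1" and eq: "g0 1 = g0 0 + g1 0 + g2 t / 2"
        by (auto simp: dif_def numeral_2_eq_2)
      have pt: "p t \<in> cball z0 R" "dist (p t) z < r" using inR[of t] near[of t] t by (auto simp: p_def)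
      have e: "\<bar>f11 (p t) - f11 z\<bar> \<le> \<epsilon>/4" "\<bar>f12 (p t) - f12 z\<bar> \<le> \<epsilon>/4" "\<bar>f21 (p t) - f21 z\<bar> \<le> \<epsilon>/4" "\<bar>f22 (p t) - f22 z\<bar> \<le> \<epsilon>/4"
        using d1(2)[rule_format, OF zR pt(1)] d2(2)[rule_format, OF zR pt(1)] d3(2)[rule_format, OF zR pt(1)]
          d4(2)[rule_format, OF zR pt(1)] pt(2) r by auto
      have bnd: "- (\<bar>u\<bar> * (\<epsilon>/4)) \<le> u * q" if "\<bar>q\<bar> \<le> \<epsilon>/4" for u q :: real
      proof -
        have "\<bar>u * q\<bar> \<le> \<bar>u\<bar> * (\<epsilon>/4)" unfolding abs_mult using that by (rule mult_left_mono) simp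
        then show ?thesis by linarith
      qed
      have "- ((\<bar>x\<bar> + \<bar>y\<bar>)\<^sup>2 * (\<epsilon>/4)) = - (\<bar>x*x\<bar> * (\<epsilon>/4)) + - (\<bar>x*y\<bar> * (\<epsilon>/4)) + - (\<bar>x*y\<bar> * (\<epsilon>/4)) + - (\<bar>y*y\<bar> * (\<epsilon>/4))"
        by (simp add: power2_eq_square abs_mult algebra_simps)
      also have "\<dots> \<le> (x*x) * (f11 (p t) - f11 z) + (x*y) * (f12 (p t) - f12 z) + (x*y) * (f21 (p t) - f21 z) + (y*y) * (f22 (p t) - f22 z)"
        by (intro add_mono bnd e)
      also have "\<dots> = g2 t - g2 0"
        by (simp add: g2_def p_def algebra_simps)
      finally have "- ((\<bar>x\<bar> + \<bar>y\<bar>)\<^sup>2 * (\<epsilon>/4)) \<le> g2 t - g2 0" .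
      moreover have "(\<bar>x\<bar> + \<bar>y\<bar>)\<^sup>2 * (\<epsilon>/4) \<le> (2 * (x\<^sup>2 + y\<^sup>2)) * (\<epsilon>/4)"
      proof (intro mult_right_mono)
        have "0 \<le> (\<bar>x\<bar> - \<bar>y\<bar>)\<^sup>2" by simp
        then show "(\<bar>x\<bar> + \<bar>y\<bar>)\<^sup>2 \<le> 2 * (x\<^sup>2 + y\<^sup>2)" by (simp add: power2_eq_square algebra_simps)
      qed (use \<epsilon> in auto)
      ultimately have "g2 0 / 2 - \<epsilon> / 4 * (x\<^sup>2 + y\<^sup>2) \<le> g2 t / 2" by (simp add: field_simps)
      moreover have "\<epsilon> / 4 * (x\<^sup>2 + y\<^sup>2) \<le> \<epsilon> * (x\<^sup>2 + y\<^sup>2)" using \<epsilon> by (intro mult_right_mono) auto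
      ultimately have "g0 0 + g1 0 + g2 0 / 2 - \<epsilon> * (x\<^sup>2 + y\<^sup>2) \<le> g0 1" using eq by linarith
      moreover have "g0 1 = \<phi> (z + w)" "g0 0 = \<phi> z" "(cmod w)\<^sup>2 = x\<^sup>2 + y\<^sup>2"
        by (simp_all add: g0_def p_def cmod_power2 x_def y_def)
      moreover have "g1 0 + g2 0 / 2 = Re (A * w + B * w\<^sup>2) + Re (levi \<phi> z) * (x\<^sup>2 + y\<^sup>2)"
      proof -
        have "f11 z = 4 * Re (levi \<phi> z) - f22 z"
          using levi_eq_laplacian(2)[OF S zS f f1[OF zS] f2[OF zS]] by simp
        then show ?thesis
        by (simp add: A_def B_def g1_def g2_def p_def x_def y_def power2_eq_square) (simp add: field_simps)
      qed
      ultimately show ?thesis by (simp add: algebra_simps)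
    qed
    then show ?thesis by blast
  qed
  moreover have "ball z0 (2 * r) \<subseteq> S" using r R by (auto simp: subset_iff)
  ultimately show ?thesis using r(1) by blast
qed

text \<open>The leading constant \<open>1/2\<close> of the quadratic term is essential: it determines the constant \<open>1 / (2 \<pi>)\<close> in the cusps.
The difference of the two sides has the derivative \<open>y * (1 / (1 - r) - 1 / (1 - y))\<close>, whose sign is that of \<open>y\<close>.\<close>

lemma ln_one_minus_quadratic_bound:
  fixes s r :: real
  assumes "\<bar>s\<bar> \<le> r" "r < 1"
  shows "- s - s\<^sup>2 / (2 * (1 - r)) \<le> ln (1 - s)"
proof -
  define G where "G = (\<lambda>y. ln (1 - y) + y + y\<^sup>2 / (2 * (1 - r)))"
  have D: "(G has_real_derivative y * (1 / (1 - r) - 1 / (1 - y))) (at y)" if "y < 1" for y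
  proof -
    have "(G has_real_derivative (- 1 / (1 - y) + 1 + 2 * y / (2 * (1 - r)))) (at y)"
      unfolding G_def using that assms(2) by (auto intro!: derivative_eq_intros)
    moreover have "- 1 / (1 - y) + 1 + 2 * y / (2 * (1 - r)) = y * (1 / (1 - r) - 1 / (1 - y))"
    proof -
      have "- 1 / (1 - y) + 1 = y * (- 1 / (1 - y))" using that by (simp add: field_simps)
      moreover have "2 * y / (2 * (1 - r)) = y * (1 / (1 - r))"
        by (subst mult_divide_mult_cancel_left) simp_all
      ultimately have "- 1 / (1 - y) + 1 + 2 * y / (2 * (1 - r)) = y * (- 1 / (1 - y)) + y * (1 / (1 - r))"
        by (simp only:)
      also have "\<dots> = y * (1 / (1 - r) - 1 / (1 - y))" by (simp add: right_diff_distrib)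
      finally show ?thesis .
    qed
    ultimately show ?thesis by (rule DERIV_cong)
  qed
  have "G 0 \<le> G s"
  proof (cases "0 \<le> s")
    case True
    show ?thesis
    proof (rule DERIV_nonneg_imp_nondecreasing[OF True])
      fix y assume y: "0 \<le> y" "y \<le> s"
      then have "1 / (1 - y) \<le> 1 / (1 - r)" using assms by (intro divide_left_mono) auto
      then have "0 \<le> y * (1 / (1 - r) - 1 / (1 - y))" using y by simp
      with D[of y] y assms show "\<exists>d. (G has_real_derivative d) (at y) \<and> 0 \<le> d" by auto
    qed
  next
    case False
    show ?thesis
    proof (rule DERIV_nonpos_imp_nonincreasing[of s 0 G])
      show "s \<le> 0" using False by simp
      fix y assume y: "s \<le> y" "y \<le> 0"
      then have "1 / (1 - y) \<le> 1 / (1 - r)" using assms by (intro divide_left_mono) auto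
      then have "y * (1 / (1 - r) - 1 / (1 - y)) \<le> 0" using y by (simp add: mult_nonpos_nonneg)
      with D[of y] y assms show "\<exists>d. (G has_real_derivative d) (at y) \<and> d \<le> 0" by auto
    qed
  qed
  then show ?thesis by (simp add: G_def)
qed

text \<open>\<open>- 2 Re w\<close> is \<open>|log |z|\<^sup>2|\<close> in the coordinate \<open>w = log z\<close>, so this is the curvature of the metric in a cusp.\<close>

lemma levi_log_Re:
  assumes "Re w < 0"
  shows "C_diff 2 {w. Re w < 0} (\<lambda>w. ln (- 2 * Re w))"
    and "Re (levi (\<lambda>w. ln (- 2 * Re w)) w) = - 1 / (4 * (Re w)\<^sup>2)"
proof -
  let ?S = "{w. Re w < 0}"
  have S: "open ?S" by (rule open_halfspace_Re_lt)
  have lin: "((\<lambda>w. - 2 * Re w) has_derivative (\<lambda>v. Re v *\<^sub>R (- 2) + Im v *\<^sub>R 0)) (at z)" for z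
    by (auto intro!: derivative_eq_intros)
  have "C_diff 1 ?S (\<lambda>w. c :: real)" for c
    unfolding One_nat_def C_diff.simps
    by (intro exI[of _ "\<lambda>_. 0"]) (auto intro!: derivative_eq_intros)
  then have "C_diff 2 ?S (\<lambda>w. - 2 * Re w)"
    unfolding numeral_2_eq_2 C_diff.simps(2)[of "Suc 0"] One_nat_def
    by (intro exI[of _ "\<lambda>_. - 2"] exI[of _ "\<lambda>_. 0"] conjI ballI lin)
  then show "C_diff 2 ?S (\<lambda>w. ln (- 2 * Re w))" by (rule C_diff_ln) simp
  have d1: "((\<lambda>w. ln (- 2 * Re w)) has_derivative (\<lambda>v. Re v *\<^sub>R (1 / Re z) + Im v *\<^sub>R 0)) (at z)" if "z \<in> ?S" for z
    by (rule has_derivative_eq_rhs[OF DERIV_compose_FDERIV[OF DERIV_ln lin]])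
       (use that in \<open>auto simp: fun_eq_iff field_simps\<close>)
  have d2: "((\<lambda>w. 1 / Re w) has_derivative (\<lambda>v. Re v *\<^sub>R (- 1 / (Re w)\<^sup>2) + Im v *\<^sub>R 0)) (at w)"
    using assms by (auto intro!: derivative_eq_intros simp: field_simps power2_eq_square)
  have d3: "((\<lambda>w. 0 :: real) has_derivative (\<lambda>v. Re v *\<^sub>R 0 + Im v *\<^sub>R 0)) (at w)" by simp
  have "w \<in> ?S" using assms by simp
  from levi_eq_laplacian(2)[OF S this d1 d2 d3]
  show "Re (levi (\<lambda>w. ln (- 2 * Re w)) w) = - 1 / (4 * (Re w)\<^sup>2)" by simp
qed

lemma directional_derivative_zero:
  fixes f :: "complex \<Rightarrow> complex"
  assumes U: "open U" "z \<in> U" and f: "\<And>w. w \<in> U \<Longrightarrow> f w = 0"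
  shows "vector_derivative (\<lambda>t. f (z + u * of_real t)) (at (0::real)) = 0"
proof (rule vector_derivative_at)
  have "open ((\<lambda>t::real. z + u * of_real t) -` U)"
    by (rule open_vimage[OF U(1)]) (intro continuous_intros)
  then show "((\<lambda>t. f (z + u * of_real t)) has_vector_derivative 0) (at (0::real))"
    by (rule has_vector_derivative_transform_within_open[OF has_vector_derivative_const[of 0]]) (use U f in auto)
qed

lemma jet_zero:
  assumes U: "open U" and f: "\<And>w. w \<in> U \<Longrightarrow> f w = 0" and z: "z \<in> U"
  shows "jet l f z = (\<lambda>_. 0)"
proof -
  have x: "pd_x g w = 0" and y: "pd_y g w = 0" if "\<And>w. w \<in> U \<Longrightarrow> g w = 0" "w \<in> U" for g :: "complex \<Rightarrow> complex" and w
    using directional_derivative_zero[OF U that(2,1), where u = 1] directional_derivative_zero[OF U that(2,1), where u = \<i>]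
    by (simp_all add: pd_x_def pd_y_def)
  have Y: "(pd_y ^^ b) f w = 0" if "w \<in> U" for b w
    using that by (induction b arbitrary: w) (simp_all add: f y)
  have XY: "(pd_x ^^ a) ((pd_y ^^ b) f) w = 0" if "w \<in> U" for a b w
    using that by (induction a arbitrary: w) (simp_all add: Y x)
  show ?thesis by (auto simp: jet_def fun_eq_iff XY[OF z])
qed

lemma continuous_near:
  fixes f :: "complex \<Rightarrow> real"
  assumes "continuous_on U f" "open U" "z0 \<in> U" "0 < e"
  shows "\<exists>r>0. ball z0 r \<subseteq> U \<and> (\<forall>z\<in>ball z0 r. \<bar>f z - f z0\<bar> < e)"
proof -
  have "continuous (at z0) f" using assms continuous_on_eq_continuous_at by blast
  then obtain r1 where r1: "r1 > 0" "\<forall>z. dist z z0 < r1 \<longrightarrow> dist (f z) (f z0) < e"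
    using assms(4) unfolding continuous_at_eps_delta by blast
  obtain r2 where r2: "r2 > 0" "ball z0 r2 \<subseteq> U" using assms open_contains_ball by blast
  show ?thesis
    by (rule exI[of _ "min r1 r2"])
       (use r1 r2 in \<open>auto simp: dist_real_def dist_commute subset_iff\<close>)
qed

section \<open>Charts and the volume measure of a (1,1)-form\<close>

locale surface =
  fixes X :: "'a topology" and \<A> :: "'a chart set" and W :: "'a set"
  assumes atlas: "complex_structure X \<A>" and W_open: "openin X W"
begin

lemma chart_homeo:
  assumes "c \<in> \<A>"
  shows "openin X (fst c)" "open (snd c ` fst c)"
    "homeomorphic_map (subtopology X (fst c)) (top_of_set (snd c ` fst c)) (snd c)"
proof -
  have "\<forall>c\<in>\<A>. chart_on X c" using atlas unfolding complex_structure_def by (elim conjE)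
  then have "chart_on X c" using assms by (rule bspec)
  then show "openin X (fst c)" "open (snd c ` fst c)"
    "homeomorphic_map (subtopology X (fst c)) (top_of_set (snd c ` fst c)) (snd c)"
    by (cases c; simp add: chart_on_def)+
qed

lemma chart_subset: "c \<in> \<A> \<Longrightarrow> fst c \<subseteq> topspace X"
  using chart_homeo(1) openin_subset by blast

lemma chart_inj: "c \<in> \<A> \<Longrightarrow> inj_on (snd c) (fst c)"
  using homeomorphic_imp_injective_map[OF chart_homeo(3)] chart_subset
  by (auto simp: topspace_subtopology Int_absorb1)

lemma chart_inv: "c \<in> \<A> \<Longrightarrow> x \<in> fst c \<Longrightarrow> inv_into (fst c) (snd c) (snd c x) = x"
  using chart_inj by (rule inv_into_f_f)

lemma in_chart_at: "c \<in> \<A> \<Longrightarrow> x \<in> fst c \<Longrightarrow> in_chart c f (snd c x) = f x"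
  by (simp add: in_chart_def chart_inv)

lemma chart_image_open:
  assumes c: "c \<in> \<A>" and V: "openin X V" "V \<subseteq> fst c"
  shows "open (snd c ` V)"
proof -
  have "openin (subtopology X (fst c)) V"
    using V by (auto simp: openin_subtopology)
  then have "openin (top_of_set (snd c ` fst c)) (snd c ` V)"
    using homeomorphic_imp_open_map[OF chart_homeo(3)[OF c]] by (auto simp: open_map_def)
  then show ?thesis
    using chart_homeo(2)[OF c] openin_open_trans by blast
qed

lemma chart_preimage_open:
  assumes c: "c \<in> \<A>" and V: "open V"
  shows "openin X {x \<in> fst c. snd c x \<in> V}"
proof -
  have "openin (top_of_set (snd c ` fst c)) (snd c ` fst c \<inter> V)"
    using V by (auto simp: openin_open)
  then have "openin (subtopology X (fst c)) {x \<in> topspace (subtopology X (fst c)). snd c x \<in> snd c ` fst c \<inter> V}"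
    using homeomorphic_imp_continuous_map[OF chart_homeo(3)[OF c]] by (auto simp: continuous_map_def)
  also have "{x \<in> topspace (subtopology X (fst c)). snd c x \<in> snd c ` fst c \<inter> V} = {x \<in> fst c. snd c x \<in> V}"
    using chart_subset[OF c] by auto
  finally show ?thesis
    using chart_homeo(1)[OF c] openin_trans_full by blast
qed

lemma charts_cover: "x \<in> W \<Longrightarrow> \<exists>c\<in>\<A>. x \<in> fst c"
proof -
  assume "x \<in> W"
  then have "x \<in> topspace X" using openin_subset[OF W_open] by blast
  also have "topspace X = (\<Union>c\<in>\<A>. fst c)"
    using atlas unfolding complex_structure_def by (elim conjE) (rule sym)
  finally show ?thesis by simp
qed

lemma charts_compatible: "c \<in> \<A> \<Longrightarrow> c' \<in> \<A> \<Longrightarrow> compatible c c'"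
proof -
  have "\<forall>c\<in>\<A>. \<forall>c'\<in>\<A>. compatible c c'" using atlas unfolding complex_structure_def by (elim conjE)
  then show "c \<in> \<A> \<Longrightarrow> c' \<in> \<A> \<Longrightarrow> compatible c c'" by simp
qed

text \<open>A complex structure is a maximal atlas, so holomorphic reparametrizations of parts of a chart are charts. This
provides the logarithmic coordinates at the punctures.\<close>

lemma compose_chart:
  assumes c: "c \<in> \<A>" and G: "open G" "G \<subseteq> snd c ` fst c"
    and g: "g holomorphic_on G" "inj_on g G"
  shows "({y \<in> fst c. snd c y \<in> G}, g \<circ> snd c) \<in> \<A>"
proof -
  define U where "U = {y \<in> fst c. snd c y \<in> G}"
  define f where "f = g \<circ> snd c"
  have Uc: "U \<subseteq> fst c" by (auto simp: U_def)
  have U_open: "openin X U" unfolding U_def by (rule chart_preimage_open[OF c G(1)])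
  have cU: "snd c ` U = G" using G(2) by (auto simp: U_def)
  have fU: "f ` U = g ` G" unfolding f_def image_comp[symmetric] cU ..
  have inj: "inj_on f U"
    unfolding f_def by (rule comp_inj_on) (use inj_on_subset[OF chart_inj[OF c] Uc] g(2) in \<open>simp_all add: cU\<close>)
  have gG: "open (g ` G)" by (rule open_mapping_thm3[OF g(1) G(1) g(2)])
  have tU: "topspace (subtopology X U) = U" using openin_subset[OF U_open] by auto
  have "homeomorphic_map (subtopology X U) (top_of_set (f ` U)) f"
  proof (rule bijective_open_imp_homeomorphic_map)
    show "continuous_map (subtopology X U) (top_of_set (f ` U)) f"
      unfolding continuous_map_def tU
    proof (intro conjI allI impI)
      fix V assume "openin (top_of_set (f ` U)) V"
      then obtain T where T: "open T" "V = f ` U \<inter> T" by (auto simp: openin_open)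
      have "open (g -` T \<inter> G)"
        using continuous_on_open_vimage[OF G(1)] holomorphic_on_imp_continuous_on[OF g(1)] T(1) by blast
      from chart_preimage_open[OF c this]
      have "openin X {y \<in> fst c. snd c y \<in> g -` T \<inter> G}" .
      also have "{y \<in> fst c. snd c y \<in> g -` T \<inter> G} = {y \<in> U. f y \<in> V}"
        by (auto simp: U_def f_def T(2))
      finally show "openin (subtopology X U) {y \<in> U. f y \<in> V}"
        by (auto simp: openin_subtopology)
    qed auto
    show "open_map (subtopology X U) (top_of_set (f ` U)) f"
      unfolding open_map_def
    proof (intro allI impI)
      fix T assume "openin (subtopology X U) T"
      then have T: "openin X T" "T \<subseteq> U"
        using openin_trans_full[OF _ U_open] openin_subset[of "subtopology X U" T] tU by auto
      have cT: "snd c ` T \<subseteq> G" using T(2) cU by auto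
      have "open (g ` (snd c ` T))"
        by (rule open_mapping_thm3[OF holomorphic_on_subset[OF g(1) cT] _ inj_on_subset[OF g(2) cT]])
           (rule chart_image_open[OF c T(1)], use T(2) Uc in auto)
      then have "open (f ` T)" by (simp add: f_def image_comp)
      moreover have "f ` T \<subseteq> f ` U" using T(2) by auto
      ultimately show "openin (top_of_set (f ` U)) (f ` T)"
        by (simp add: open_subset)
    qed
  qed (use tU inj in simp_all)
  then have chart: "chart_on X (U, f)"
    using U_open gG by (simp add: chart_on_def fU)
  \<comment> \<open>The inverse of \<open>g\<close> is holomorphic, which gives compatibility in both directions.\<close>
  obtain k where k: "k holomorphic_on g ` G" "\<And>z. z \<in> G \<Longrightarrow> k (g z) = z"
    using holomorphic_has_inverse[OF g(1) G(1) g(2)] by metis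
  have "compatible (U, f) c'" if c': "c' \<in> \<A>" for c'
    unfolding compatible_def fst_conv snd_conv
  proof
    have tr: "transition c c' holomorphic_on snd c ` (fst c \<inter> fst c')" "transition c' c holomorphic_on snd c' ` (fst c' \<inter> fst c)"
      using charts_compatible[OF c c'] charts_compatible[OF c' c] by (simp_all add: compatible_def)
    have kf: "k (f y) = snd c y" if "y \<in> U" for y using k(2)[of "snd c y"] that by (simp add: f_def U_def)
    have "(transition c c' \<circ> k) holomorphic_on f ` (U \<inter> fst c')"
    proof (rule holomorphic_on_compose_gen[OF _ tr(1)])
      show "k holomorphic_on f ` (U \<inter> fst c')"
        by (rule holomorphic_on_subset[OF k(1)]) (use fU in auto)
      show "k ` f ` (U \<inter> fst c') \<subseteq> snd c ` (fst c \<inter> fst c')" using kf Uc by auto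
    qed
    then show "transition (U, f) c' holomorphic_on f ` (U \<inter> fst c')"
    proof (rule holomorphic_transform)
      fix w assume "w \<in> f ` (U \<inter> fst c')"
      then obtain y where y: "y \<in> U" "w = f y" by auto
      then show "(transition c c' \<circ> k) w = transition (U, f) c' w"
        using kf[OF y(1)] Uc by (auto simp: transition_def chart_inv[OF c] inv_into_f_f[OF inj])
    qed
    have "(g \<circ> transition c' c) holomorphic_on snd c' ` (U \<inter> fst c')"
    proof (rule holomorphic_on_compose_gen[OF _ g(1)])
      show "transition c' c holomorphic_on snd c' ` (U \<inter> fst c')"
        by (rule holomorphic_on_subset[OF tr(2)]) (use Uc in auto)
      show "transition c' c ` snd c' ` (U \<inter> fst c') \<subseteq> G"
        by (auto simp: transition_def chart_inv[OF c'] U_def)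
    qed
    then show "transition c' (U, f) holomorphic_on snd c' ` (U \<inter> fst c')"
      by (rule holomorphic_transform) (auto simp: transition_def f_def)
  qed
  moreover have "\<forall>c. chart_on X c \<and> (\<forall>c'\<in>\<A>. compatible c c') \<longrightarrow> c \<in> \<A>"
    using atlas unfolding complex_structure_def by (elim conjE)
  ultimately show ?thesis using chart unfolding U_def f_def by blast
qed

text \<open>The sigma-algebra on which the chart volumes live; only its sets matter, not the measure.\<close>

definition borel_sigma :: "'a measure" where
  "borel_sigma = sigma W {B. openin X B \<and> B \<subseteq> W}"

lemma space_borel_sigma [simp]: "space borel_sigma = W"
  unfolding borel_sigma_def by (rule space_measure_of) auto

lemma open_in_borel_sigma: "openin X B \<Longrightarrow> B \<subseteq> W \<Longrightarrow> B \<in> sets borel_sigma"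
  unfolding borel_sigma_def by (subst sets_measure_of) auto

lemma measurable_chartwise:
  fixes f :: "'a \<Rightarrow> 'b::topological_space"
  assumes f: "\<And>x. x \<in> W \<Longrightarrow> \<exists>c\<in>\<A>. \<exists>N. openin X N \<and> x \<in> N \<and> N \<subseteq> fst c \<inter> W \<and>
    continuous_on (snd c ` N) (in_chart c f)"
  shows "f \<in> borel_measurable borel_sigma"
proof (rule borel_measurableI)
  fix V :: "'b set" assume V: "open V"
  have "openin X (f -` V \<inter> W)"
  proof (subst openin_subopen, intro ballI)
    fix x assume x: "x \<in> f -` V \<inter> W"
    then obtain c N where c: "c \<in> \<A>" and N: "openin X N" "x \<in> N" "N \<subseteq> fst c \<inter> W"
      and cont: "continuous_on (snd c ` N) (in_chart c f)" using f by blast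
    have N': "N \<subseteq> fst c" using N by auto
    have "open (in_chart c f -` V \<inter> snd c ` N)"
      using cont continuous_on_open_vimage[OF chart_image_open[OF c N(1) N']] V by blast
    from chart_preimage_open[OF c this]
    have "openin X {y \<in> fst c. snd c y \<in> in_chart c f -` V \<inter> snd c ` N}" .
    moreover have "x \<in> {y \<in> fst c. snd c y \<in> in_chart c f -` V \<inter> snd c ` N}"
      using x N N' by (auto simp: in_chart_at[OF c])
    moreover have "{y \<in> fst c. snd c y \<in> in_chart c f -` V \<inter> snd c ` N} \<subseteq> f -` V \<inter> W"
      using N inj_onD[OF chart_inj[OF c]] by (fastforce simp: in_chart_at[OF c])
    ultimately show "\<exists>T. openin X T \<and> x \<in> T \<and> T \<subseteq> f -` V \<inter> W" by blast
  qed
  then show "f -` V \<inter> space borel_sigma \<in> sets borel_sigma"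
    by (simp add: open_in_borel_sigma)
qed

lemma sets_chart_volume: "sets (chart_volume X W \<omega> c) = sets borel_sigma"
  by (simp add: chart_volume_def borel_sigma_def)

lemma sets_form_volume:
  assumes "c \<in> \<A>"
  shows "sets (form_volume X \<A> W \<omega>) = sets borel_sigma"
  unfolding form_volume_def by (rule sets_SUP) (use assms sets_chart_volume in auto)

text \<open>The volume is the supremum of the chart volumes, so norms of sections are bounded below by integrals in a single
chart. This is the direction that bounds the Bergman density from above.\<close>

lemma form_volume_ge_chart:
  assumes "c \<in> \<A>"
  shows "nn_integral (chart_volume X W \<omega> c) f \<le> nn_integral (form_volume X \<A> W \<omega>) f"
proof (rule nn_integral_mono_measure)
  show "sets (chart_volume X W \<omega> c) = sets (form_volume X \<A> W \<omega>)"
    using sets_form_volume[OF assms] sets_chart_volume by simp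
  show "chart_volume X W \<omega> c \<le> form_volume X \<A> W \<omega>"
    unfolding form_volume_def by (rule SUP_upper[OF assms])
qed

lemma nn_integral_chart_volume:
  assumes c: "c \<in> \<A>" and f: "f \<in> borel_measurable borel_sigma"
    and dens: "continuous_on (snd c ` (fst c \<inter> W)) (in_chart c (\<omega> c))"
  shows "nn_integral (chart_volume X W \<omega> c) f =
    (\<integral>\<^sup>+ z. ennreal (Re (form_val (in_chart c (\<omega> c) z) 1 \<i>)) * in_chart c f z
       * indicator (snd c ` (fst c \<inter> W)) z \<partial>lborel)"
proof -
  let ?R = "snd c ` (fst c \<inter> W)"
  let ?M = "restrict_space lborel ?R :: complex measure"
  let ?dd = "\<lambda>z. ennreal (Re (form_val (in_chart c (\<omega> c) z) 1 \<i>))"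
  let ?g = "inv_into (fst c) (snd c)"
  have R: "open ?R" using chart_image_open[OF c] W_open chart_homeo(1)[OF c] by (simp add: openin_Int)
  then have Rb: "?R \<in> sets lborel" by simp
  have setsM: "sets ?M = sets (restrict_space borel ?R)"
    by (simp add: sets_restrict_space)
  have g: "?g \<in> ?M \<rightarrow>\<^sub>M borel_sigma"
    unfolding borel_sigma_def
  proof (rule measurable_measure_of)
    show "?g \<in> space ?M \<rightarrow> W" by (auto simp: space_restrict_space chart_inv[OF c])
    fix B assume B: "B \<in> {B. openin X B \<and> B \<subseteq> W}"
    have "?g -` B \<inter> space ?M = snd c ` (fst c \<inter> B)"
      using B by (auto simp: space_restrict_space chart_inv[OF c])
    moreover have "open (snd c ` (fst c \<inter> B))"
      using chart_image_open[OF c, of "fst c \<inter> B"] B chart_homeo(1)[OF c] by (simp add: openin_Int)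
    moreover have "snd c ` (fst c \<inter> B) \<subseteq> ?R" using B by auto
    ultimately show "?g -` B \<inter> space ?M \<in> sets ?M"
      using Rb by (simp add: sets_restrict_space_iff)
  qed auto
  have ddm: "?dd \<in> borel_measurable ?M"
  proof -
    have "continuous_on ?R (\<lambda>z. Re (form_val (in_chart c (\<omega> c) z) 1 \<i>))"
      unfolding form_val_def by (intro continuous_intros dens)
    then have "(\<lambda>z. Re (form_val (in_chart c (\<omega> c) z) 1 \<i>)) \<in> borel_measurable (restrict_space borel ?R)"
      by (rule borel_measurable_continuous_on_restrict)
    then have "(\<lambda>z. Re (form_val (in_chart c (\<omega> c) z) 1 \<i>)) \<in> borel_measurable ?M"
      by (simp add: measurable_cong_sets[OF setsM refl])
    then show ?thesis by simp
  qed
  have "nn_integral (chart_volume X W \<omega> c) f = (\<integral>\<^sup>+ z. f (?g z) \<partial>density ?M ?dd)"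
    unfolding chart_volume_def borel_sigma_def[symmetric]
    by (rule nn_integral_distr) (use g f in auto)
  also have "\<dots> = (\<integral>\<^sup>+ z. ?dd z * f (?g z) \<partial>?M)"
    by (rule nn_integral_density[OF ddm]) (rule measurable_compose[OF g f])
  also have "\<dots> = (\<integral>\<^sup>+ z. ?dd z * f (?g z) * indicator ?R z \<partial>lborel)"
    using Rb by (subst nn_integral_restrict_space) auto
  finally show ?thesis by (simp add: in_chart_def)
qed

end

section \<open>Hermitian bundles and the extremal property of the Bergman density\<close>

text \<open>Only what the extremal property and the local estimate ask of a bundle and its metric: a continuous metric is enough.
It is instantiated with \<open>L\<close>, with \<open>E\<close>, and with the twisted powers of \<open>L\<close>.\<close>

locale hermitian_bundle = surface X \<A> W
  for X :: "'a topology" and \<A> W +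
  fixes M :: "('a, 'j) line_bundle" and H :: "('a, 'j) metric"
  assumes patch_open: "i \<in> idx M \<Longrightarrow> openin X (patch M i)"
    and patch_cover: "W \<subseteq> (\<Union>i\<in>idx M. patch M i)"
    and metric_pos: "i \<in> idx M \<Longrightarrow> x \<in> patch M i \<inter> W \<Longrightarrow> 0 < H i x"
    and metric_cocycle: "i \<in> idx M \<Longrightarrow> j \<in> idx M \<Longrightarrow> x \<in> patch M i \<inter> patch M j \<inter> W \<Longrightarrow>
        H j x = (cmod (cocycle M i j x))\<^sup>2 * H i x"
    and metric_continuous: "i \<in> idx M \<Longrightarrow> c \<in> \<A> \<Longrightarrow>
        continuous_on (snd c ` (fst c \<inter> (patch M i \<inter> W))) (in_chart c (H i))"
begin

lemma idx_at: "x \<in> W \<Longrightarrow> idx_at M x \<in> idx M \<and> x \<in> patch M (idx_at M x)"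
  unfolding idx_at_def by (rule someI_ex) (use patch_cover in auto)

text \<open>The pairing is defined through an arbitrarily chosen frame at each point; the transformation rules make it
independent of the choice, so that it is continuous along a fixed frame.\<close>

lemma herm_eq:
  assumes s: "hol_section \<A> V M s" and t: "hol_section \<A> V M t"
    and i: "i \<in> idx M" "x \<in> patch M i" and V: "x \<in> V" and x: "x \<in> W"
  shows "herm M H s t x = s i x * cnj (t i x) * of_real (H i x)"
proof -
  define j where "j = idx_at M x"
  have j: "j \<in> idx M" "x \<in> patch M j" using idx_at[OF x] by (auto simp: j_def)
  have "s i x = cocycle M i j x * s j x" if "hol_section \<A> V M s" for s
    using that i j V unfolding hol_section_def by blast
  note tr = this[OF s] this[OF t]
  have "H j x = (cmod (cocycle M i j x))\<^sup>2 * H i x"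
    by (rule metric_cocycle) (use i j x in auto)
  then have "complex_of_real (H j x) = cocycle M i j x * cnj (cocycle M i j x) * of_real (H i x)"
    by (simp only: of_real_mult complex_norm_square)
  then show ?thesis
    using tr by (simp add: herm_def Let_def j_def[symmetric])
qed

lemma norm2_herm: "of_real (norm2 M H s x) = herm M H s s x"
  by (simp only: norm2_def herm_def Let_def of_real_mult complex_norm_square)

lemma norm2_eq:
  assumes s: "hol_section \<A> V M s" and i: "i \<in> idx M" "x \<in> patch M i" and V: "x \<in> V" and x: "x \<in> W"
  shows "norm2 M H s x = (cmod (s i x))\<^sup>2 * H i x"
proof -
  have "complex_of_real (norm2 M H s x) = of_real ((cmod (s i x))\<^sup>2 * H i x)"
    unfolding norm2_herm herm_eq[OF s s i V x] by (simp only: of_real_mult complex_norm_square)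
  then show ?thesis by (simp only: of_real_eq_iff)
qed

lemma norm2_nonneg: "x \<in> W \<Longrightarrow> 0 \<le> norm2 M H s x"
  using idx_at[of x] metric_pos[of "idx_at M x" x] by (simp add: norm2_def Let_def)

lemma herm_measurable:
  assumes s: "hol_section \<A> W M s" and t: "hol_section \<A> W M t"
  shows "herm M H s t \<in> borel_measurable borel_sigma"
proof (rule measurable_chartwise)
  fix x assume x: "x \<in> W"
  obtain c where c: "c \<in> \<A>" "x \<in> fst c" using charts_cover[OF x] by blast
  define i where "i = idx_at M x"
  have i: "i \<in> idx M" "x \<in> patch M i" using idx_at[OF x] by (auto simp: i_def)
  let ?N = "fst c \<inter> (patch M i \<inter> W)"
  have hol: "continuous_on (snd c ` ?N) (in_chart c (s i))" "continuous_on (snd c ` ?N) (in_chart c (t i))"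
    using s t i c by (auto simp: hol_section_def hol_fun_def intro!: holomorphic_on_imp_continuous_on)
  have "continuous_on (snd c ` ?N)
      (\<lambda>z. in_chart c (s i) z * cnj (in_chart c (t i) z) * of_real (in_chart c (H i) z))"
    by (intro continuous_intros hol metric_continuous i c)
  moreover have "in_chart c (herm M H s t) z =
      in_chart c (s i) z * cnj (in_chart c (t i) z) * of_real (in_chart c (H i) z)" if "z \<in> snd c ` ?N" for z
    using that herm_eq[OF s t i(1)] by (auto simp: in_chart_at[OF c(1)])
  ultimately have "continuous_on (snd c ` ?N) (in_chart c (herm M H s t))"
    by (subst continuous_on_cong[OF refl])
  moreover have "openin X ?N" using chart_homeo(1)[OF c(1)] patch_open[OF i(1)] W_open by (simp add: openin_Int)
  ultimately show "\<exists>c\<in>\<A>. \<exists>N. openin X N \<and> x \<in> N \<and> N \<subseteq> fst c \<inter> W \<and> continuous_on (snd c ` N) (in_chart c (herm M H s t))"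
    using c i x by (intro bexI[of _ c] exI[of _ ?N]) auto
qed

lemma norm2_measurable:
  assumes s: "hol_section \<A> W M s"
  shows "norm2 M H s \<in> borel_measurable borel_sigma"
proof -
  have "norm2 M H s = (\<lambda>x. Re (herm M H s s x))"
    by (rule ext) (metis Re_complex_of_real norm2_herm)
  then show ?thesis using herm_measurable[OF s s] by simp
qed

lemma hol_section_sum:
  assumes "\<And>k. k < d \<Longrightarrow> hol_section \<A> W M (S k)"
  shows "hol_section \<A> W M (\<lambda>i x. \<Sum>k<d. a k * S k i x)"
proof -
  have "in_chart c (\<lambda>x. \<Sum>k<d. a k * S k i x) holomorphic_on snd c ` (fst c \<inter> (patch M i \<inter> W))"
    if "c \<in> \<A>" "i \<in> idx M" for c i
  proof -
    have "in_chart c (\<lambda>x. \<Sum>k<d. a k * S k i x) = (\<lambda>z. \<Sum>k<d. a k * in_chart c (S k i) z)"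
      by (simp add: in_chart_def fun_eq_iff)
    moreover have "in_chart c (S k i) holomorphic_on snd c ` (fst c \<inter> (patch M i \<inter> W))" if "k < d" for k
      using assms[OF that] \<open>c \<in> \<A>\<close> \<open>i \<in> idx M\<close> by (auto simp: hol_section_def hol_fun_def)
    ultimately show ?thesis by (auto intro!: holomorphic_intros)
  qed
  moreover have "(\<Sum>k<d. a k * S k i x) = cocycle M i j x * (\<Sum>k<d. a k * S k j x)"
    if "i \<in> idx M" "j \<in> idx M" "x \<in> patch M i \<inter> patch M j \<inter> W" for i j x
    unfolding sum_distrib_left
  proof (rule sum.cong[OF refl])
    fix k assume "k \<in> {..<d}"
    then have "S k i x = cocycle M i j x * S k j x"
      using assms[of k] that unfolding hol_section_def by blast
    then show "a k * S k i x = cocycle M i j x * (a k * S k j x)" by simp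
  qed
  ultimately show ?thesis unfolding hol_section_def hol_fun_def by (intro conjI ballI)
qed

text \<open>Test the inequality on the peak section \<open>s = \<Sum>\<^sub>k cnj (S\<^sub>k(x)) S\<^sub>k\<close>: its norm squared is \<open>V = \<Sum>\<^sub>k |S\<^sub>k(x)|\<^sup>2\<close>, and
\<open>|s(x)|\<^sup>2 = V * B(x)\<close>.\<close>

lemma bergman_density_le:
  assumes basis: "orthonormal_basis \<A> W M H \<mu> d S" and \<mu>: "sets \<mu> = sets borel_sigma"
    and x: "x \<in> W" and q: "0 < q"
    and bound: "\<And>s. hol_section \<A> W M s \<Longrightarrow>
        ennreal (norm2 M H s x * q) \<le> (\<integral>\<^sup>+ y. ennreal (norm2 M H s y) \<partial>\<mu>)"
  shows "bergman_density M H d S x \<le> 1 / q"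
proof -
  have space: "space \<mu> = W" using sets_eq_imp_space_eq[OF \<mu>] by simp
  have meas: "f \<in> borel_measurable \<mu>" if "f \<in> borel_measurable borel_sigma" for f :: "'a \<Rightarrow> 'b::topological_space"
    using that by (simp add: measurable_cong_sets[OF \<mu> refl])
  have hol: "hol_section \<A> W M (S k)" and fin: "(\<integral>\<^sup>+ x. ennreal (norm2 M H (S k) x) \<partial>\<mu>) < \<infinity>" if "k < d" for k
    using basis that by (auto simp: orthonormal_basis_def L2_hol_sections_def)
  have int_norm2: "integrable \<mu> (norm2 M H (S k))" if "k < d" for k
    using fin[OF that] norm2_nonneg
    by (intro integrableI_nonneg meas norm2_measurable hol that AE_I2) (auto simp: space)
  have int_herm: "integrable \<mu> (herm M H (S k) (S l))" if k: "k < d" and l: "l < d" for k l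
  proof (rule Bochner_Integration.integrable_bound)
    show "integrable \<mu> (\<lambda>y. norm2 M H (S k) y + norm2 M H (S l) y)"
      using int_norm2 k l by auto
    show "herm M H (S k) (S l) \<in> borel_measurable \<mu>"
      by (intro meas herm_measurable hol k l)
    show "AE y in \<mu>. norm (herm M H (S k) (S l) y) \<le> norm (norm2 M H (S k) y + norm2 M H (S l) y)"
    proof (rule AE_I2)
      fix y assume "y \<in> space \<mu>"
      then have y: "y \<in> W" by (simp add: space)
      define i where "i = idx_at M y"
      have H: "0 < H i y" using metric_pos[of i y] idx_at[OF y] y by (simp add: i_def)
      let ?a = "cmod (S k i y)" and ?b = "cmod (S l i y)"
      have "?a * ?b \<le> ?a\<^sup>2 + ?b\<^sup>2"
        using mult_nonneg_nonneg[of ?a ?b, OF norm_ge_zero norm_ge_zero] sum_squares_bound[of ?a ?b] by linarith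
      then have "?a * ?b * H i y \<le> (?a\<^sup>2 + ?b\<^sup>2) * H i y"
        using H by (intro mult_right_mono) auto
      then have "norm (herm M H (S k) (S l) y) \<le> norm2 M H (S k) y + norm2 M H (S l) y"
        using H by (simp add: herm_def norm2_def Let_def i_def[symmetric] norm_mult distrib_right)
      then show "norm (herm M H (S k) (S l) y) \<le> norm (norm2 M H (S k) y + norm2 M H (S l) y)" by simp
    qed
  qed
  define j where "j = idx_at M x"
  define a where "a = (\<lambda>k. cnj (S k j x))"
  define s where "s = (\<lambda>i y. \<Sum>k<d. a k * S k i y)"
  define V where "V = (\<Sum>k<d. (cmod (S k j x))\<^sup>2)"
  have Hj: "0 < H j x" using metric_pos[of j x] idx_at[OF x] x by (simp add: j_def)
  have V0: "0 \<le> V" by (auto simp: V_def intro: sum_nonneg)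
  have s: "hol_section \<A> W M s" unfolding s_def by (rule hol_section_sum) (rule hol)
  have herm_s: "herm M H s s = (\<lambda>y. \<Sum>k<d. \<Sum>l<d. a k * cnj (a l) * herm M H (S k) (S l) y)"
  proof
    fix y
    define i where "i = idx_at M y"
    have "herm M H s s y = (\<Sum>k<d. a k * S k i y) * (\<Sum>l<d. cnj (a l * S l i y)) * of_real (H i y)"
      by (simp only: herm_def s_def Let_def i_def cnj_sum)
    also have "\<dots> = (\<Sum>k<d. \<Sum>l<d. a k * S k i y * cnj (a l * S l i y) * of_real (H i y))"
      by (simp only: sum_product sum_distrib_right[where r = "of_real (H i y)"])
    also have "\<dots> = (\<Sum>k<d. \<Sum>l<d. a k * cnj (a l) * herm M H (S k) (S l) y)"
      by (intro sum.cong refl) (simp add: herm_def Let_def i_def)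
    finally show "herm M H s s y = (\<Sum>k<d. \<Sum>l<d. a k * cnj (a l) * herm M H (S k) (S l) y)" .
  qed
  have int_kl: "integrable \<mu> (\<lambda>y. a k * cnj (a l) * herm M H (S k) (S l) y)" if "k < d" "l < d" for k l
    by (intro Bochner_Integration.integrable_mult_right int_herm that)
  have int_k: "integrable \<mu> (\<lambda>y. \<Sum>l<d. a k * cnj (a l) * herm M H (S k) (S l) y)" if "k < d" for k
    by (intro Bochner_Integration.integrable_sum int_kl that) simp
  have int_s: "integrable \<mu> (herm M H s s)"
    unfolding herm_s by (intro Bochner_Integration.integrable_sum int_k) simp
  have "(LINT y|\<mu>. herm M H s s y) = (\<Sum>k<d. (LINT y|\<mu>. (\<Sum>l<d. a k * cnj (a l) * herm M H (S k) (S l) y)))"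
    unfolding herm_s by (intro Bochner_Integration.integral_sum int_k) simp
  also have "\<dots> = (\<Sum>k<d. \<Sum>l<d. (LINT y|\<mu>. a k * cnj (a l) * herm M H (S k) (S l) y))"
    by (intro sum.cong refl Bochner_Integration.integral_sum int_kl) simp_all
  also have "\<dots> = (\<Sum>k<d. \<Sum>l<d. a k * cnj (a l) * (LINT y|\<mu>. herm M H (S k) (S l) y))"
    by (intro sum.cong refl integral_mult_right_zero)
  also have "\<dots> = (\<Sum>k<d. \<Sum>l<d. a k * cnj (a l) * (if k = l then 1 else 0))"
    using basis by (intro sum.cong refl) (simp add: orthonormal_basis_def)
  also have "\<dots> = (\<Sum>k<d. a k * cnj (a k))" by (simp add: if_distrib cong: if_cong)
  also have "\<dots> = of_real V"
    unfolding V_def of_real_sum a_def complex_norm_square by (simp add: mult.commute)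
  finally have "complex_of_real (LINT y|\<mu>. norm2 M H s y) = of_real V"
    by (simp add: norm2_herm[symmetric] del: of_real_power)
  then have int_V: "(LINT y|\<mu>. norm2 M H s y) = V" by (simp only: of_real_eq_iff)
  have int_n: "integrable \<mu> (norm2 M H s)"
  proof -
    have "norm2 M H s = (\<lambda>x. Re (herm M H s s x))"
      by (rule ext) (metis Re_complex_of_real norm2_herm)
    then show ?thesis using integrable_Re[OF int_s] by simp
  qed
  have "(\<integral>\<^sup>+ y. ennreal (norm2 M H s y) \<partial>\<mu>) = ennreal V"
    unfolding int_V[symmetric] using norm2_nonneg
    by (intro nn_integral_eq_integral int_n AE_I2) (auto simp: space)
  with bound[OF s] have le: "norm2 M H s x * q \<le> V"
    using V0 by (simp add: ennreal_le_iff)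
  have "s j x = of_real V"
    unfolding V_def of_real_sum s_def a_def complex_norm_square by (simp add: mult.commute)
  then have "norm2 M H s x = V\<^sup>2 * H j x"
    by (simp add: norm2_def Let_def j_def[symmetric])
  moreover have "bergman_density M H d S x = V * H j x"
    by (simp add: bergman_density_def norm2_def Let_def j_def[symmetric] V_def sum_distrib_right)
  ultimately have "V * (bergman_density M H d S x * q) \<le> V * 1"
    using le by (simp add: power2_eq_square mult_ac)
  then show ?thesis
  proof (cases "V = 0")
    case True
    then show ?thesis using q \<open>bergman_density M H d S x = V * H j x\<close> by simp
  next
    case False
    then have "bergman_density M H d S x * q \<le> 1"
      using V0 \<open>V * (bergman_density M H d S x * q) \<le> V * 1\<close> by (simp add: mult_le_cancel_left_pos)
    then show ?thesis using q by (simp add: field_simps)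
  qed
qed

text \<open>The Gaussian mean value inequality, transported to the surface: \<open>K\<close> is the weight of the metric in a frame over
the disc, and the density of the volume supplies the second factor of the lower bound.\<close>

lemma local_mean_value_bound:
  assumes c: "c \<in> \<A>" and ball: "ball z \<rho> \<subseteq> snd c ` (fst c \<inter> W)"
    and a: "0 < a" and \<rho>: "0 < \<rho>" and m: "0 \<le> m"
    and dens: "continuous_on (snd c ` (fst c \<inter> W)) (in_chart c (\<omega> c))"
    and dens0: "\<And>\<zeta>. \<zeta> \<in> ball z \<rho> \<Longrightarrow> 0 \<le> Re (form_val (in_chart c (\<omega> c) \<zeta>) 1 \<i>)"
    and s: "hol_section \<A> W M s" and F: "F holomorphic_on ball z \<rho>"
    and K: "continuous_on (ball z \<rho>) K" "\<And>\<zeta>. \<zeta> \<in> ball z \<rho> \<Longrightarrow> 0 \<le> K \<zeta>"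
    and norm: "\<And>\<zeta>. \<zeta> \<in> ball z \<rho> \<Longrightarrow> in_chart c (norm2 M H s) \<zeta> = (cmod (F \<zeta>))\<^sup>2 * K \<zeta>"
    and lower: "\<And>w. cmod w < \<rho> \<Longrightarrow> m * (cmod (exp (A * w + B * w\<^sup>2)))\<^sup>2 * exp (- (a * (cmod w)\<^sup>2))
        \<le> K (z + w) * Re (form_val (in_chart c (\<omega> c) (z + w)) 1 \<i>)"
  shows "ennreal ((cmod (F z))\<^sup>2 * m * (pi / a * (1 - gaussian_loss (a * \<rho>\<^sup>2))))
     \<le> (\<integral>\<^sup>+ y. ennreal (norm2 M H s y) \<partial>form_volume X \<A> W \<omega>)"
proof -
  let ?dd = "\<lambda>z. Re (form_val (in_chart c (\<omega> c) z) 1 \<i>)"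
  have "continuous_on (ball z \<rho>) (\<lambda>\<zeta>. K \<zeta> * ?dd \<zeta>)"
    unfolding form_val_def by (intro continuous_intros K continuous_on_subset[OF dens ball])
  then have Km: "(\<lambda>\<zeta>. K \<zeta> * ?dd \<zeta>) \<in> borel_measurable (restrict_space borel (ball z \<rho>))"
    by (rule borel_measurable_continuous_on_restrict)
  have "ennreal ((cmod (F z))\<^sup>2 * m * (pi / a * (1 - gaussian_loss (a * \<rho>\<^sup>2))))
     \<le> (\<integral>\<^sup>+ \<zeta>. ennreal ((cmod (F \<zeta>))\<^sup>2 * (K \<zeta> * ?dd \<zeta>)) * indicator (ball z \<rho>) \<zeta> \<partial>lborel)"
    by (rule gaussian_mean_square[OF F a \<rho> m lower Km])
  also have "\<dots> \<le> (\<integral>\<^sup>+ \<zeta>. ennreal (?dd \<zeta>) * in_chart c (\<lambda>y. ennreal (norm2 M H s y)) \<zeta>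
       * indicator (snd c ` (fst c \<inter> W)) \<zeta> \<partial>lborel)"
  proof (intro nn_integral_mono)
    fix \<zeta>
    show "ennreal ((cmod (F \<zeta>))\<^sup>2 * (K \<zeta> * ?dd \<zeta>)) * indicator (ball z \<rho>) \<zeta>
      \<le> ennreal (?dd \<zeta>) * in_chart c (\<lambda>y. ennreal (norm2 M H s y)) \<zeta> * indicator (snd c ` (fst c \<inter> W)) \<zeta>"
    proof (cases "\<zeta> \<in> ball z \<rho>")
      case True
      then have "in_chart c (\<lambda>y. ennreal (norm2 M H s y)) \<zeta> = ennreal ((cmod (F \<zeta>))\<^sup>2 * K \<zeta>)"
        using norm[OF True] by (simp add: in_chart_def)
      moreover have "\<zeta> \<in> snd c ` (fst c \<inter> W)" using True ball by blast
      ultimately show ?thesis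
        using True K(2)[OF True] dens0[OF True] by (simp add: ennreal_mult[symmetric] mult_ac del: mem_ball)
    qed (simp del: mem_ball)
  qed
  also have "\<dots> = nn_integral (chart_volume X W \<omega> c) (\<lambda>y. ennreal (norm2 M H s y))"
    using norm2_measurable[OF s] by (intro nn_integral_chart_volume[where \<omega> = \<omega>, OF c _ dens, symmetric]) simp
  also have "\<dots> \<le> (\<integral>\<^sup>+ y. ennreal (norm2 M H s y) \<partial>form_volume X \<A> W \<omega>)"
    by (rule form_volume_ge_chart[OF c])
  finally show ?thesis .
qed

end

section \<open>Curvature on the punctured surface\<close>

locale punctured_surface =
  fixes X :: "'a topology" and \<A> :: "'a chart set" and D W :: "'a set"
    and \<omega> :: "'a form11"
    and L :: "('a, 'i) line_bundle" and h :: "('a, 'i) metric"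
    and E :: "('a, 'k) line_bundle" and hE :: "('a, 'k) metric"
    and ch :: "'a \<Rightarrow> 'a chart"
    and eL :: "'a \<Rightarrow> ('a, 'i) bsection" and eE :: "'a \<Rightarrow> ('a, 'k) bsection"
  assumes riemann: "compact_riemann_surface X \<A>"
    and punctures: "finite D" "D \<subseteq> topspace X" "W = topspace X - D"
    and omega: "smooth_form11 \<A> W \<omega>" "real_form11 \<A> W \<omega>" "riemannian_form11 \<A> W \<omega>"
    and L: "hol_line_bundle X \<A> (topspace X) L" "smooth_metric \<A> W L h"
    and coords: "\<And>a. a \<in> D \<Longrightarrow>
          ch a \<in> \<A> \<and> a \<in> fst (ch a) \<and> snd (ch a) a = 0 \<and> fst (ch a) - {a} \<subseteq> W"
    and alpha: "\<And>a. a \<in> D \<Longrightarrow> hol_frame \<A> (fst (ch a)) L (eL a) \<and>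
          (\<forall>x \<in> fst (ch a) - {a}. norm2 L h (eL a) x = \<bar>ln ((cmod (snd (ch a) x))\<^sup>2)\<bar>)"
    and curv_nonneg: "semipositive_form11 \<A> W (i_times (curvature L h))"
    and curv_cusp: "\<And>a x c. a \<in> D \<Longrightarrow> x \<in> fst (ch a) - {a} \<Longrightarrow> c \<in> \<A> \<Longrightarrow> x \<in> fst c \<Longrightarrow>
          i_times (curvature L h) c x = \<omega> c x"
    and E: "hol_line_bundle X \<A> W E" "smooth_metric \<A> W E hE"
    and E_trivial: "\<And>a. a \<in> D \<Longrightarrow> hol_frame \<A> (fst (ch a) - {a}) E (eE a) \<and>
          (\<forall>x \<in> fst (ch a) - {a}. norm2 E hE (eE a) x = 1)"
begin

lemma Hausdorff: "Hausdorff_space X" and compact: "compact_space X"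
  and atlas: "complex_structure X \<A>" and nonempty: "topspace X \<noteq> {}"
  using riemann by (simp_all add: compact_riemann_surface_def)

lemma W_open: "openin X W"
  unfolding punctures(3)
  using closedin_Hausdorff_finite[OF Hausdorff punctures(2,1)] by (rule openin_diff[OF openin_topspace])

sublocale surface X \<A> W
  by unfold_locales (rule atlas W_open)+

lemma L_patch: "i \<in> idx L \<Longrightarrow> openin X (patch L i)" "(\<Union>i\<in>idx L. patch L i) = topspace X"
  using L(1) by (simp_all add: hol_line_bundle_def)

lemma E_patch: "k \<in> idx E \<Longrightarrow> openin X (patch E k)" "(\<Union>k\<in>idx E. patch E k) = W"
  using E(1) by (simp_all add: hol_line_bundle_def)

lemma smooth_metric_D:
  assumes "smooth_metric \<A> W M m"
  shows "i \<in> idx M \<Longrightarrow> smooth_fun \<A> (patch M i \<inter> W) (m i)"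
    "i \<in> idx M \<Longrightarrow> x \<in> patch M i \<inter> W \<Longrightarrow> 0 < m i x"
    "i \<in> idx M \<Longrightarrow> j \<in> idx M \<Longrightarrow> x \<in> patch M i \<inter> patch M j \<inter> W \<Longrightarrow>
        m j x = (cmod (cocycle M i j x))\<^sup>2 * m i x"
  using assms unfolding smooth_metric_def by blast+

lemma smooth_metric_continuous:
  assumes "smooth_metric \<A> W M m" "i \<in> idx M" "c \<in> \<A>"
  shows "continuous_on (snd c ` (fst c \<inter> (patch M i \<inter> W))) (in_chart c (m i))"
  using smooth_metric_D(1)[OF assms(1,2)] assms(3) unfolding smooth_fun_def smooth_def
  by (metis C_diff.simps(1))

lemma L_cover: "W \<subseteq> (\<Union>i\<in>idx L. patch L i)"
  using L_patch(2) openin_subset[OF W_open] by simp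

sublocale LB: hermitian_bundle X \<A> W L h
  by unfold_locales
    (rule L_patch(1) L_cover smooth_metric_D[OF L(2)] smooth_metric_continuous[OF L(2)]; assumption)+

sublocale EB: hermitian_bundle X \<A> W E hE
  by unfold_locales
    (rule E_patch(1) E_patch(2)[THEN equalityD2] smooth_metric_D[OF E(2)] smooth_metric_continuous[OF E(2)]; assumption)+

lemma twisted_idx: "(i, k) \<in> idx (twisted_power L p E) \<longleftrightarrow> i \<in> idx L \<and> k \<in> idx E"
  and twisted_patch: "patch (twisted_power L p E) (i, k) = patch L i \<inter> patch E k"
  and twisted_cocycle: "cocycle (twisted_power L p E) (i, k) (j, l) x = cocycle L i j x ^ p * cocycle E k l x"
  by (simp_all add: twisted_power_def)

lemma twisted_bundle: "hermitian_bundle X \<A> W (twisted_power L p E) (twisted_metric h p hE)"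
proof unfold_locales
  fix ik assume "ik \<in> idx (twisted_power L p E)"
  then obtain i k where ik: "ik = (i, k)" "i \<in> idx L" "k \<in> idx E" by (cases ik) (simp add: twisted_idx)
  show "openin X (patch (twisted_power L p E) ik)"
    unfolding ik(1) twisted_patch using ik L_patch(1) E_patch(1) by (intro openin_Int)
  show "0 < twisted_metric h p hE ik x" if "x \<in> patch (twisted_power L p E) ik \<inter> W" for x
    using that ik LB.metric_pos[of i x] EB.metric_pos[of k x] by (simp add: twisted_metric_def twisted_patch)
  show "twisted_metric h p hE jl x = (cmod (cocycle (twisted_power L p E) ik jl x))\<^sup>2 * twisted_metric h p hE ik x"
    if jl: "jl \<in> idx (twisted_power L p E)"
      and x: "x \<in> patch (twisted_power L p E) ik \<inter> patch (twisted_power L p E) jl \<inter> W" for jl x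
  proof -
    obtain j l where jl': "jl = (j, l)" "j \<in> idx L" "l \<in> idx E"
      using jl by (cases jl) (simp add: twisted_idx)
    have "h j x = (cmod (cocycle L i j x))\<^sup>2 * h i x"
      by (rule LB.metric_cocycle) (use ik jl' x in \<open>auto simp: twisted_patch\<close>)
    moreover have "hE l x = (cmod (cocycle E k l x))\<^sup>2 * hE k x"
      by (rule EB.metric_cocycle) (use ik jl' x in \<open>auto simp: twisted_patch\<close>)
    ultimately show ?thesis
      by (simp add: ik(1) jl'(1) twisted_metric_def twisted_cocycle norm_mult norm_power power_mult_distrib
          power_mult[symmetric] mult.commute)
  qed
  show "continuous_on (snd c ` (fst c \<inter> (patch (twisted_power L p E) ik \<inter> W))) (in_chart c (twisted_metric h p hE ik))"
    if c: "c \<in> \<A>" for c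
  proof -
    let ?S = "snd c ` (fst c \<inter> (patch (twisted_power L p E) ik \<inter> W))"
    have "continuous_on ?S (in_chart c (h i))" "continuous_on ?S (in_chart c (hE k))"
      by (rule continuous_on_subset[OF LB.metric_continuous[OF ik(2) c]]
          continuous_on_subset[OF EB.metric_continuous[OF ik(3) c]];
          auto simp: ik(1) twisted_patch)+
    then have "continuous_on ?S (\<lambda>z. in_chart c (h i) z ^ p * in_chart c (hE k) z)"
      by (intro continuous_intros)
    then show ?thesis by (simp add: ik(1) twisted_metric_def in_chart_def o_def)
  qed
next
  show "W \<subseteq> (\<Union>i\<in>idx (twisted_power L p E). patch (twisted_power L p E) i)"
  proof
    fix x assume x: "x \<in> W"
    obtain i where i: "i \<in> idx L" "x \<in> patch L i" using L_cover x by auto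
    obtain k where k: "k \<in> idx E" "x \<in> patch E k" using E_patch(2) x by auto
    show "x \<in> (\<Union>i\<in>idx (twisted_power L p E). patch (twisted_power L p E) i)"
      by (rule UN_I[of "(i, k)"]) (use i k in \<open>auto simp: twisted_idx twisted_patch\<close>)
  qed
qed

sublocale TB: hermitian_bundle X \<A> W "twisted_power L p E" "twisted_metric h p hE" for p
  by (rule twisted_bundle)

abbreviation LpE :: "nat \<Rightarrow> ('a, 'i \<times> 'k) line_bundle" where
  "LpE p \<equiv> twisted_power L p E"

abbreviation hp :: "nat \<Rightarrow> ('a, 'i \<times> 'k) metric" where
  "hp p \<equiv> twisted_metric h p hE"

text \<open>A real form has an imaginary coefficient \<open>\<i> b\<close>, and positivity of the metric is \<open>b > 0\<close>. The volume density is
\<open>2 b\<close>, by \<open>form_density\<close>.\<close>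

lemma omega_at:
  assumes c: "c \<in> \<A>" and x: "x \<in> fst c" "x \<in> W"
  shows "Re (\<omega> c x) = 0" "0 < Im (\<omega> c x)"
proof -
  have "\<forall>u v. form_val (\<omega> c x) u v \<in> \<real>"
    using omega(2) c x unfolding real_form11_def by blast
  then have "form_val (\<omega> c x) 1 \<i> \<in> \<real>" by blast
  then show "Re (\<omega> c x) = 0" by (simp add: form_val_def complex_is_Real_iff)
  have "\<forall>v. v \<noteq> 0 \<longrightarrow> Re (form_val (\<omega> c x) v (\<i> * v)) > 0"
    using omega(3) c x unfolding riemannian_form11_def by blast
  from this[rule_format, of 1] show "0 < Im (\<omega> c x)" by (simp add: form_val_def)
qed

lemma form_density: "Re (form_val a 1 \<i>) = 2 * Im a"
  by (simp add: form_val_def)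

lemma omega_continuous:
  assumes "c \<in> \<A>"
  shows "continuous_on (snd c ` (fst c \<inter> W)) (in_chart c (\<omega> c))"
  using omega(1) assms unfolding smooth_form11_def smooth_def by (metis C_diff.simps(1))

lemma curvature_at:
  assumes c: "c \<in> \<A>" and x: "x \<in> fst c" "x \<in> W"
  shows "Im (curvature L h c x) = 0" "0 \<le> Re (curvature L h c x)"
proof -
  have r: "real_form11 \<A> W (i_times (curvature L h))"
    and s: "\<forall>c\<in>\<A>. \<forall>x \<in> fst c \<inter> W. \<forall>v. Re (form_val (i_times (curvature L h) c x) v (\<i> * v)) \<ge> 0"
    using curv_nonneg[unfolded semipositive_form11_def, THEN conjunct1]
      curv_nonneg[unfolded semipositive_form11_def, THEN conjunct2] .
  have "\<forall>u v. form_val (i_times (curvature L h) c x) u v \<in> \<real>"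
    using r c x unfolding real_form11_def by blast
  then have "form_val (i_times (curvature L h) c x) 1 \<i> \<in> \<real>" by blast
  then show "Im (curvature L h c x) = 0" by (simp add: form_val_def i_times_def complex_is_Real_iff)
  have "\<forall>v. Re (form_val (i_times (curvature L h) c x) v (\<i> * v)) \<ge> 0"
    using s c x by blast
  from this[rule_format, of 1] show "0 \<le> Re (curvature L h c x)" by (simp add: form_val_def i_times_def)
qed

abbreviation log_weight :: "'a chart \<Rightarrow> 'i \<Rightarrow> complex \<Rightarrow> real" where
  "log_weight c i \<equiv> \<lambda>z. ln (in_chart c (h i) z)"

lemma weight_domain_open:
  assumes "c \<in> \<A>" "i \<in> idx L"
  shows "open (snd c ` (fst c \<inter> (patch L i \<inter> W)))"
  using chart_image_open[OF assms(1)] chart_homeo(1)[OF assms(1)] L_patch(1)[OF assms(2)] W_open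
  by (simp add: openin_Int)

lemma log_weight_C2:
  assumes c: "c \<in> \<A>" and i: "i \<in> idx L"
  shows "C_diff 2 (snd c ` (fst c \<inter> (patch L i \<inter> W))) (log_weight c i)"
proof (rule C_diff_ln)
  show "C_diff 2 (snd c ` (fst c \<inter> (patch L i \<inter> W))) (in_chart c (h i))"
    using smooth_metric_D(1)[OF L(2) i] c unfolding smooth_fun_def smooth_def by blast
  show "0 < in_chart c (h i) z" if z: "z \<in> snd c ` (fst c \<inter> (patch L i \<inter> W))" for z
  proof -
    obtain y where "y \<in> fst c" "y \<in> patch L i \<inter> W" "z = snd c y" using z by auto
    then show ?thesis using LB.metric_pos[OF i, of y] by (simp add: in_chart_at[OF c])
  qed
qed

lemma curvature_levi:
  assumes c: "c \<in> \<A>" and x: "x \<in> fst c" "x \<in> W" and i: "i \<in> idx L" "x \<in> patch L i"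
  shows "curvature L h c x = - levi (log_weight c i) (snd c x)"
proof -
  define j where "j = idx_at L x"
  have j: "j \<in> idx L" "x \<in> patch L j" using LB.idx_at[OF x(2)] by (auto simp: j_def)
  let ?V = "patch L i \<inter> patch L j \<inter> W"
  let ?S = "snd c ` (fst c \<inter> ?V)" and ?S' = "snd c ` (fst c \<inter> (patch L i \<inter> W))"
  have "levi (log_weight c j) (snd c x) = levi (log_weight c i) (snd c x) * deriv (\<lambda>z. z) (snd c x) * cnj (deriv (\<lambda>z. z) (snd c x))"
  proof (rule levi_transform[where S = ?S and S' = ?S' and g = "in_chart c (cocycle L i j)"])
    show "open ?S"
      by (rule chart_image_open[OF c]) (use chart_homeo(1)[OF c] L_patch(1) i j W_open in \<open>auto intro!: openin_Int\<close>)
    show "open ?S'" by (rule weight_domain_open[OF c i(1)])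
    show "snd c x \<in> ?S" using x i j by auto
    show "(\<lambda>z. z) holomorphic_on ?S" by (rule holomorphic_on_ident)
    show "(\<lambda>z. z) ` ?S \<subseteq> ?S'" by auto
    show "C_diff 2 ?S' (log_weight c i)" by (rule log_weight_C2[OF c i(1)])
    have "hol_fun \<A> (patch L i \<inter> patch L j) (cocycle L i j)"
      using L(1) i j unfolding hol_line_bundle_def by blast
    then have "in_chart c (cocycle L i j) holomorphic_on snd c ` (fst c \<inter> (patch L i \<inter> patch L j))"
      using c unfolding hol_fun_def by blast
    then show "in_chart c (cocycle L i j) holomorphic_on ?S"
      by (rule holomorphic_on_subset) auto
    have *: "h j y = (cmod (cocycle L i j y))\<^sup>2 * h i y" "0 < h j y" "0 < h i y" if "y \<in> ?V" for y
      using LB.metric_cocycle[OF i(1) j(1) that] LB.metric_pos[OF i(1), of y] LB.metric_pos[OF j(1), of y] that by auto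
    then have nz: "cocycle L i j y \<noteq> 0" if "y \<in> ?V" for y using that by fastforce
    then show "in_chart c (cocycle L i j) w \<noteq> 0" if "w \<in> ?S" for w
      using that by (auto simp: in_chart_at[OF c] nz)
    show "log_weight c j w = log_weight c i w + ln ((cmod (in_chart c (cocycle L i j) w))\<^sup>2)" if w: "w \<in> ?S" for w
    proof -
      obtain y where y: "y \<in> fst c" "y \<in> ?V" "w = snd c y" using w by auto
      have "ln (h j y) = ln (h i y) + ln ((cmod (cocycle L i j y))\<^sup>2)"
        unfolding *(1)[OF y(2)] using *(3)[OF y(2)] nz[OF y(2)] by (subst ln_mult) auto
      then show ?thesis using y by (simp add: in_chart_at[OF c])
    qed
  qed
  moreover have "curvature L h c x = - levi (log_weight c j) (snd c x)"
    by (simp add: curvature_def levi_def Let_def j_def[symmetric] in_chart_def o_def)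
  ultimately show ?thesis by simp
qed

lemma transition_at: "c \<in> \<A> \<Longrightarrow> y \<in> fst c \<Longrightarrow> transition c c' (snd c y) = snd c' y"
  by (simp add: transition_def chart_inv)

lemma curvature_transform:
  assumes c: "c \<in> \<A>" and c': "c' \<in> \<A>" and x: "x \<in> fst c" "x \<in> fst c'" "x \<in> W"
  shows "curvature L h c x = curvature L h c' x *
     deriv (transition c c') (snd c x) * cnj (deriv (transition c c') (snd c x))"
proof -
  define i where "i = idx_at L x"
  have i: "i \<in> idx L" "x \<in> patch L i" using LB.idx_at[OF x(3)] by (auto simp: i_def)
  let ?V = "fst c' \<inter> (patch L i \<inter> W)"
  let ?S = "snd c ` (fst c \<inter> ?V)" and ?S' = "snd c' ` ?V" and ?T = "transition c c'"
  have "levi (log_weight c i) (snd c x) = levi (log_weight c' i) (?T (snd c x)) * deriv ?T (snd c x) * cnj (deriv ?T (snd c x))"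
  proof (rule levi_transform[where S = ?S and S' = ?S' and g = "\<lambda>_. 1"])
    show "open ?S"
      by (rule chart_image_open[OF c]) (use chart_homeo(1)[OF c] chart_homeo(1)[OF c'] L_patch(1) i W_open in \<open>auto intro!: openin_Int\<close>)
    show "open ?S'" by (rule weight_domain_open[OF c' i(1)])
    show "snd c x \<in> ?S" using x i by auto
    have "?T holomorphic_on snd c ` (fst c \<inter> fst c')"
      using charts_compatible[OF c c'] by (simp add: compatible_def)
    then show "?T holomorphic_on ?S" by (rule holomorphic_on_subset) auto
    show "?T ` ?S \<subseteq> ?S'" by (auto simp: transition_at[OF c])
    show "C_diff 2 ?S' (log_weight c' i)" by (rule log_weight_C2[OF c' i(1)])
    show "log_weight c i w = log_weight c' i (?T w) + ln ((cmod 1)\<^sup>2)" if w: "w \<in> ?S" for w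
    proof -
      obtain y where y: "y \<in> fst c" "y \<in> ?V" "w = snd c y" using w by auto
      then show ?thesis by (simp add: transition_at[OF c] in_chart_at[OF c] in_chart_at[OF c'])
    qed
  qed auto
  then show ?thesis
    using curvature_levi[OF c x(1,3) i] curvature_levi[OF c' x(2,3) i] transition_at[OF c x(1)] by simp
qed

text \<open>Both coefficients are multiplied by the same factor \<open>|T'|\<^sup>2\<close> under a change of chart \<open>T\<close>, so the chart chosen in the
definition of the ratio is irrelevant.\<close>

lemma form_ratio_eq:
  assumes c: "c \<in> \<A>" and x: "x \<in> fst c" "x \<in> W"
  shows "form_ratio \<A> (i_times (curvature L h)) \<omega> x = Re (curvature L h c x) / Im (\<omega> c x)"
proof -
  define c' where "c' = (SOME c. c \<in> \<A> \<and> x \<in> fst c)"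
  have "c' \<in> \<A> \<and> x \<in> fst c'"
    unfolding c'_def by (rule someI[of _ c]) (use c x in simp)
  then have c': "c' \<in> \<A>" "x \<in> fst c'" by auto
  let ?D = "deriv (transition c c') (snd c x)"
  have w: "\<omega> c x = \<omega> c' x * ?D * cnj ?D"
    using omega(1) c c' x unfolding smooth_form11_def by blast
  have w0: "\<omega> c x \<noteq> 0" using omega_at[OF c x] by auto
  have "i_times (curvature L h) c x / \<omega> c x = i_times (curvature L h) c' x / \<omega> c' x"
    using w w0 curvature_transform[OF c c'(1) x(1) c'(2) x(2)] by (simp add: i_times_def)
  then have "form_ratio \<A> (i_times (curvature L h)) \<omega> x = Re (i_times (curvature L h) c x / \<omega> c x)"
    by (simp add: form_ratio_def Let_def c'_def[symmetric])
  also have "i_times (curvature L h) c x = \<i> * of_real (Re (curvature L h c x))"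
    using curvature_at(1)[OF c x] by (simp add: i_times_def complex_eq_iff)
  also have "\<omega> c x = \<i> * of_real (Im (\<omega> c x))"
    using omega_at(1)[OF c x] by (simp add: complex_eq_iff)
  finally show ?thesis by simp
qed

abbreviation curv_ratio :: "'a \<Rightarrow> real" where
  "curv_ratio \<equiv> form_ratio \<A> (i_times (curvature L h)) \<omega>"

lemma curv_ratio_nonneg: "x \<in> W \<Longrightarrow> 0 \<le> curv_ratio x"
proof -
  assume x: "x \<in> W"
  then obtain c where c: "c \<in> \<A>" "x \<in> fst c" using charts_cover by blast
  show ?thesis
    unfolding form_ratio_eq[OF c x] using curvature_at[OF c x] omega_at[OF c x] by simp
qed

lemma curv_ratio_cusp:
  assumes a: "a \<in> D" and x: "x \<in> fst (ch a) - {a}"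
  shows "curv_ratio x = 1"
proof -
  have c: "ch a \<in> \<A>" "x \<in> fst (ch a)" "x \<in> W" using coords[OF a] x by auto
  have "Im (\<omega> (ch a) x) = Re (curvature L h (ch a) x)"
    using curv_cusp[OF a x c(1,2)] by (auto simp: i_times_def complex_eq_iff)
  then show ?thesis
    unfolding form_ratio_eq[OF c] using omega_at[OF c] by simp
qed

end

section \<open>Boundedness and positivity of the curvature ratio\<close>

context punctured_surface
begin

text \<open>Finitely many neighbourhoods cover the compact surface, and for each of them the property holds from some \<open>p\<close> on.
The sets \<open>Z p\<close> avoid the punctures, but may approach them as \<open>p\<close> grows.\<close>

lemma eventually_uniform_on_surface:
  assumes Z: "\<And>p. Z p \<subseteq> W"
    and inner: "\<And>x. x \<in> W \<Longrightarrow> \<exists>N. openin X N \<and> x \<in> N \<and> (\<forall>\<^sub>F p in sequentially. \<forall>y\<in>N. Q p y)"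
    and cusp: "\<And>a. a \<in> D \<Longrightarrow> \<exists>\<rho>>0. \<forall>\<^sub>F p in sequentially. \<forall>y\<in>fst (ch a) - {a}.
        cmod (snd (ch a) y) < \<rho> \<longrightarrow> y \<in> Z p \<longrightarrow> Q p y"
  shows "\<forall>\<^sub>F p in sequentially. \<forall>y\<in>Z p. Q p y"
proof -
  have "\<exists>N. openin X N \<and> x \<in> N \<and> (\<forall>\<^sub>F p in sequentially. \<forall>y\<in>N \<inter> Z p. Q p y)" if x: "x \<in> topspace X" for x
  proof (cases "x \<in> D")
    case True
    obtain \<rho> where \<rho>: "0 < \<rho>" "\<forall>\<^sub>F p in sequentially. \<forall>y\<in>fst (ch x) - {x}. cmod (snd (ch x) y) < \<rho> \<longrightarrow> y \<in> Z p \<longrightarrow> Q p y"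
      using cusp[OF True] by blast
    have c: "ch x \<in> \<A>" "x \<in> fst (ch x)" "snd (ch x) x = 0" using coords[OF True] by auto
    let ?N = "{y \<in> fst (ch x). snd (ch x) y \<in> ball 0 \<rho>}"
    have "\<forall>\<^sub>F p in sequentially. \<forall>y\<in>?N \<inter> Z p. Q p y"
      using \<rho>(2)
    proof eventually_elim
      case (elim p)
      have "x \<notin> Z p" using Z[of p] True punctures(3) by auto
      then show ?case using elim by auto
    qed
    then show ?thesis
      using chart_preimage_open[OF c(1) open_ball, of 0 \<rho>] c \<rho>(1) by (intro exI[of _ ?N]) auto
  next
    case False
    then obtain N where N: "openin X N" "x \<in> N" "\<forall>\<^sub>F p in sequentially. \<forall>y\<in>N. Q p y"
      using inner[of x] x punctures(3) by blast
    have "\<forall>\<^sub>F p in sequentially. \<forall>y\<in>N \<inter> Z p. Q p y"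
      using N(3) by eventually_elim auto
    then show ?thesis using N by blast
  qed
  then have "\<forall>x\<in>topspace X. \<exists>N. openin X N \<and> x \<in> N \<and> (\<forall>\<^sub>F p in sequentially. \<forall>y\<in>N \<inter> Z p. Q p y)"
    by (rule ballI)
  from bchoice[OF this] obtain N where
    N: "\<forall>x\<in>topspace X. openin X (N x) \<and> x \<in> N x \<and> (\<forall>\<^sub>F p in sequentially. \<forall>y\<in>N x \<inter> Z p. Q p y)"
    by (elim exE)
  have "compactin X (topspace X)" using compact by (simp add: compact_space_def)
  moreover have "topspace X \<subseteq> \<Union> (N ` topspace X)" using N by blast
  moreover have "\<forall>U\<in>N ` topspace X. openin X U" using N by blast
  ultimately obtain F where F: "finite F" "F \<subseteq> N ` topspace X" "topspace X \<subseteq> \<Union> F"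
    unfolding compactin_def by blast
  then obtain T where T: "T \<subseteq> topspace X" "finite T" "F = N ` T"
    using finite_subset_image[OF F(1,2)] by auto
  have "\<forall>\<^sub>F p in sequentially. \<forall>x\<in>T. \<forall>y\<in>N x \<inter> Z p. Q p y"
    using N T(1) by (intro eventually_ball_finite[OF T(2)]) blast
  then show ?thesis
  proof eventually_elim
    case (elim p)
    show ?case
    proof
      fix y assume y: "y \<in> Z p"
      then have "y \<in> topspace X" using Z[of p] openin_subset[OF W_open] by blast
      then obtain x where "x \<in> T" "y \<in> N x" using F(3) T(3) by blast
      then show "Q p y" using elim y by blast
    qed
  qed
qed

text \<open>Bounded near each interior point by continuity and equal to 1 in the cusps. Boundedness is phrased as an eventual
bound by \<open>p\<close>, so that the covering argument of \<open>eventually_uniform_on_surface\<close> applies.\<close>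

lemma curv_ratio_bounded: "bdd_above (curv_ratio ` W)"
proof -
  have "\<forall>\<^sub>F p in sequentially. \<forall>y\<in>W. curv_ratio y \<le> real p"
  proof (rule eventually_uniform_on_surface)
    fix x assume x: "x \<in> W"
    obtain c where c: "c \<in> \<A>" "x \<in> fst c" using charts_cover[OF x] by blast
    define i where "i = idx_at L x"
    have i: "i \<in> idx L" "x \<in> patch L i" using LB.idx_at[OF x] by (auto simp: i_def)
    let ?O = "snd c ` (fst c \<inter> (patch L i \<inter> W))"
    define f where "f = (\<lambda>\<zeta>. - Re (levi (log_weight c i) \<zeta>) / Im (in_chart c (\<omega> c) \<zeta>))"
    have op: "open ?O" by (rule weight_domain_open[OF c(1) i(1)])
    have f_eq: "f (snd c y) = curv_ratio y" if "y \<in> fst c" "y \<in> patch L i" "y \<in> W" for y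
      using form_ratio_eq[OF c(1) that(1,3)] curvature_levi[OF c(1) that(1,3) i(1) that(2)] that
      by (simp add: f_def in_chart_at[OF c(1)])
    have "Im (in_chart c (\<omega> c) \<zeta>) \<noteq> 0" if \<zeta>: "\<zeta> \<in> ?O" for \<zeta>
    proof -
      obtain y where "y \<in> fst c" "y \<in> W" "\<zeta> = snd c y" using \<zeta> by auto
      then show ?thesis using omega_at(2)[OF c(1), of y] by (simp add: in_chart_at[OF c(1)])
    qed
    moreover have "continuous_on ?O (in_chart c (\<omega> c))"
      by (rule continuous_on_subset[OF omega_continuous[OF c(1)]]) auto
    ultimately have "continuous_on ?O f"
      unfolding f_def
      by (intro continuous_intros levi_continuous[OF op log_weight_C2[OF c(1) i(1)]]) auto
    from continuous_near[OF this op, of "snd c x" 1] x c i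
    obtain r where r: "0 < r" "ball (snd c x) r \<subseteq> ?O" "\<And>z. z \<in> ball (snd c x) r \<Longrightarrow> \<bar>f z - f (snd c x)\<bar> < 1"
      by auto
    let ?N = "{y \<in> fst c. snd c y \<in> ball (snd c x) r}"
    have bd: "curv_ratio y \<le> f (snd c x) + 1" if y: "y \<in> ?N" for y
    proof -
      obtain v where v: "v \<in> fst c" "v \<in> patch L i" "v \<in> W" "snd c y = snd c v" using y r(2) by blast
      then have "v = y" using inj_onD[OF chart_inj[OF c(1)], of v y] y by auto
      then have "f (snd c y) = curv_ratio y" using f_eq v by blast
      moreover have "\<bar>f (snd c y) - f (snd c x)\<bar> < 1" by (rule r(3)) (use y in blast)
      ultimately show ?thesis by linarith
    qed
    obtain n where n: "f (snd c x) + 1 \<le> real n" using real_arch_simple by blast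
    have "\<forall>\<^sub>F p in sequentially. \<forall>y\<in>?N. curv_ratio y \<le> real p"
      using eventually_ge_at_top[of n]
    proof eventually_elim
      case (elim p)
      then have "real n \<le> real p" by simp
      then show ?case using bd n by (meson order_trans)
    qed
    moreover have "openin X ?N" by (rule chart_preimage_open[OF c(1) open_ball])
    moreover have "x \<in> ?N" using c r(1) by simp
    ultimately show "\<exists>N. openin X N \<and> x \<in> N \<and> (\<forall>\<^sub>F p in sequentially. \<forall>y\<in>N. curv_ratio y \<le> real p)" by blast
  next
    fix a assume a: "a \<in> D"
    have "\<forall>\<^sub>F p in sequentially. \<forall>y\<in>fst (ch a) - {a}. cmod (snd (ch a) y) < 1 \<longrightarrow> y \<in> W \<longrightarrow> curv_ratio y \<le> real p"
      using eventually_ge_at_top[of 1] by eventually_elim (simp add: curv_ratio_cusp[OF a])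
    then show "\<exists>\<rho>>0. \<forall>\<^sub>F p in sequentially. \<forall>y\<in>fst (ch a) - {a}. cmod (snd (ch a) y) < \<rho> \<longrightarrow>
        y \<in> W \<longrightarrow> curv_ratio y \<le> real p"
      using zero_less_one by blast
  qed auto
  then obtain p where "\<forall>y\<in>W. curv_ratio y \<le> real p"
    using eventually_happens'[OF sequentially_bot] by blast
  then show ?thesis by (intro bdd_aboveI2[of _ _ "real p"]) blast
qed

lemma cusp_punctured_nonempty:
  assumes "a \<in> D"
  shows "fst (ch a) - {a} \<noteq> {}"
proof -
  have c: "ch a \<in> \<A>" "a \<in> fst (ch a)" "snd (ch a) a = 0" using coords[OF assms] by auto
  have "0 \<in> snd (ch a) ` fst (ch a)" using c by force
  then obtain e where e: "e > 0" "ball 0 e \<subseteq> snd (ch a) ` fst (ch a)"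
    using chart_homeo(2)[OF c(1)] open_contains_ball by blast
  have "complex_of_real (e / 2) \<in> ball 0 e" using e by simp
  then obtain y where "y \<in> fst (ch a)" "snd (ch a) y = complex_of_real (e / 2)" using e(2) by (metis imageE subsetD)
  then show ?thesis using c(3) e(1) by force
qed

lemma W_nonempty: "W \<noteq> {}"
proof (cases "D = {}")
  case True
  then show ?thesis using nonempty punctures(3) by simp
next
  case False
  then obtain a where "a \<in> D" by blast
  then show ?thesis using cusp_punctured_nonempty[of a] coords[of a] by blast
qed

text \<open>Otherwise the curvature vanishes identically, all its jets are zero, and its vanishing order is infinite.\<close>

lemma curv_ratio_pos_somewhere:
  assumes finite_order: "\<And>x c. x \<in> W \<Longrightarrow> c \<in> \<A> \<Longrightarrow> x \<in> fst c \<Longrightarrow>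
          vanishing_order (in_chart c (curvature L h c)) (snd c x) < \<infinity>"
  shows "\<exists>x\<in>W. 0 < curv_ratio x"
proof (rule ccontr)
  assume "\<not> ?thesis"
  then have zero: "curv_ratio y = 0" if "y \<in> W" for y
    using curv_ratio_nonneg[OF that] that by force
  obtain x where x: "x \<in> W" using W_nonempty by blast
  obtain c where c: "c \<in> \<A>" "x \<in> fst c" using charts_cover[OF x] by blast
  let ?U = "snd c ` (fst c \<inter> W)"
  have "open ?U" using chart_image_open[OF c(1)] chart_homeo(1)[OF c(1)] W_open by (simp add: openin_Int)
  moreover have "in_chart c (curvature L h c) w = 0" if w: "w \<in> ?U" for w
  proof -
    obtain y where y: "y \<in> fst c" "y \<in> W" "w = snd c y" using w by auto
    have "Re (curvature L h c y) = 0"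
      using zero[OF y(2)] form_ratio_eq[OF c(1) y(1,2)] omega_at(2)[OF c(1) y(1,2)] by simp
    then have "curvature L h c y = 0" using curvature_at(1)[OF c(1) y(1,2)] by (simp add: complex_eq_iff)
    then show ?thesis using y by (simp add: in_chart_at[OF c(1)])
  qed
  ultimately have "jet l (in_chart c (curvature L h c)) (snd c x) = (\<lambda>_. 0)" for l
    using jet_zero[of ?U "in_chart c (curvature L h c)" "snd c x" l] c x by blast
  then have "vanishing_order (in_chart c (curvature L h c)) (snd c x) = \<infinity>"
    by (simp add: vanishing_order_def Inf_enat_def)
  then show False using finite_order[OF x c] by simp
qed

lemma cut_surface_cusp:
  assumes "a \<in> D" "y \<in> fst (ch a) - {a}" "y \<in> cut_surface W D ch p t \<gamma>"
  shows "t * exp (- (real p powr \<gamma>)) \<le> cmod (snd (ch a) y)"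
  using assms by (force simp: cut_surface_def punctured_disc_def)

lemma cut_surface_nonempty:
  assumes \<gamma>: "0 < \<gamma>"
  shows "\<forall>\<^sub>F p in sequentially. cut_surface W D ch p t \<gamma> \<noteq> {}"
proof -
  obtain x where x: "x \<in> W" using W_nonempty by blast
  have "\<forall>\<^sub>F p in sequentially. \<forall>a\<in>D. x \<notin> punctured_disc (ch a) a (t * exp (- (real p powr \<gamma>)))"
  proof (rule eventually_ball_finite[OF punctures(1)], intro ballI)
    fix a assume a: "a \<in> D"
    show "\<forall>\<^sub>F p in sequentially. x \<notin> punctured_disc (ch a) a (t * exp (- (real p powr \<gamma>)))"
    proof (cases "x \<in> fst (ch a)")
      case True
      have c: "ch a \<in> \<A>" "a \<in> fst (ch a)" "snd (ch a) a = 0" using coords[OF a] by auto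
      have "x \<noteq> a" using x a punctures(3) by auto
      then have "snd (ch a) x \<noteq> 0" using inj_onD[OF chart_inj[OF c(1)], of x a] c True by auto
      moreover have "(\<lambda>p. t * exp (- (real p powr \<gamma>))) \<longlonglongrightarrow> 0" using \<gamma> by real_asymp
      ultimately have "\<forall>\<^sub>F p in sequentially. t * exp (- (real p powr \<gamma>)) < cmod (snd (ch a) x)"
        by (intro order_tendstoD(2)) auto
      then show ?thesis by eventually_elim (simp add: punctured_disc_def)
    qed (simp add: punctured_disc_def)
  qed
  then show ?thesis
    by eventually_elim (use x in \<open>auto simp: cut_surface_def\<close>)
qed

end

section \<open>Bergman density near interior points\<close>

locale bergman_setting = punctured_surface X \<A> D W \<omega> L h E hE ch eL eE
  for X :: "'a topology" and \<A> D W \<omega> and L :: "('a, 'i) line_bundle" and h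
    and E :: "('a, 'k) line_bundle" and hE ch eL eE +
  fixes d :: "nat \<Rightarrow> nat" and S :: "nat \<Rightarrow> nat \<Rightarrow> ('a, 'i \<times> 'k) bsection"
  assumes basis: "\<And>p. orthonormal_basis \<A> W (twisted_power L p E) (twisted_metric h p hE)
          (form_volume X \<A> W \<omega>) (d p) (S p)"
begin

abbreviation B :: "nat \<Rightarrow> 'a \<Rightarrow> real" where
  "B p \<equiv> bergman_density (LpE p) (hp p) (d p) (S p)"

text \<open>The two local estimates below differ only in the chart, the weight \<open>K\<close> and the width \<open>a\<close> of the Gaussian. The
bound \<open>a / (m \<pi>)\<close> is the reciprocal of the mass of the Gaussian times the volume density, and the remaining factor
accounts for the part of the Gaussian outside the disc.\<close>

lemma bergman_peak_bound:
  assumes c: "c \<in> \<A>" and x: "x \<in> fst c" "x \<in> W" and z: "snd c x = z"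
    and ball: "ball z \<rho> \<subseteq> snd c ` (fst c \<inter> W)"
    and a: "0 < a" and \<rho>: "0 < \<rho>" and m: "0 < m"
    and \<theta>: "gaussian_loss (a * \<rho>\<^sup>2) < 1"
    and K: "continuous_on (ball z \<rho>) K" "\<And>\<zeta>. \<zeta> \<in> ball z \<rho> \<Longrightarrow> 0 \<le> K \<zeta>"
    and F: "\<And>s. hol_section \<A> W (LpE p) s \<Longrightarrow> \<exists>F. F holomorphic_on ball z \<rho> \<and>
       (\<forall>\<zeta>\<in>ball z \<rho>. in_chart c (norm2 (LpE p) (hp p) s) \<zeta> = (cmod (F \<zeta>))\<^sup>2 * K \<zeta>)"
    and lower: "\<And>w. cmod w < \<rho> \<Longrightarrow> K z * m * (cmod (exp (A' * w + B' * w\<^sup>2)))\<^sup>2 * exp (- (a * (cmod w)\<^sup>2))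
        \<le> K (z + w) * (2 * Im (in_chart c (\<omega> c) (z + w)))"
  shows "B p x \<le> a / (m * pi * (1 - gaussian_loss (a * \<rho>\<^sup>2)))"
proof -
  define q where "q = m * (pi / a * (1 - gaussian_loss (a * \<rho>\<^sup>2)))"
  have "B p x \<le> 1 / q"
  proof (rule TB.bergman_density_le[OF basis sets_form_volume[OF c] x(2)])
    show "0 < q" using m a \<theta> by (simp add: q_def)
    fix s assume s: "hol_section \<A> W (LpE p) s"
    let ?N = "norm2 (LpE p) (hp p) s"
    obtain F where F: "F holomorphic_on ball z \<rho>" "\<forall>\<zeta>\<in>ball z \<rho>. in_chart c ?N \<zeta> = (cmod (F \<zeta>))\<^sup>2 * K \<zeta>"
      using F[OF s] by blast
    have zb: "z \<in> ball z \<rho>" using \<rho> by simp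
    have Kz: "0 \<le> K z" using K(2)[OF zb] .
    have pos: "0 \<le> Re (form_val (in_chart c (\<omega> c) \<zeta>) 1 \<i>)" if "\<zeta> \<in> ball z \<rho>" for \<zeta>
    proof -
      obtain y where "y \<in> fst c" "y \<in> W" "\<zeta> = snd c y" using ball \<open>\<zeta> \<in> ball z \<rho>\<close> by blast
      then show ?thesis using omega_at(2)[OF c, of y] unfolding form_density by (simp add: in_chart_at[OF c])
    qed
    have "ennreal ((cmod (F z))\<^sup>2 * (K z * m) * (pi / a * (1 - gaussian_loss (a * \<rho>\<^sup>2))))
       \<le> (\<integral>\<^sup>+ y. ennreal (?N y) \<partial>form_volume X \<A> W \<omega>)"
    proof (rule TB.local_mean_value_bound[where \<omega> = \<omega>, OF c ball a \<rho> _ omega_continuous[OF c] pos s F(1) K F(2)[rule_format]])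
      show "0 \<le> K z * m" using Kz m by simp
      show "K z * m * (cmod (exp (A' * w + B' * w\<^sup>2)))\<^sup>2 * exp (- (a * (cmod w)\<^sup>2))
        \<le> K (z + w) * Re (form_val (in_chart c (\<omega> c) (z + w)) 1 \<i>)" if "cmod w < \<rho>" for w
        unfolding form_density by (rule lower[OF that])
    qed
    also have "(cmod (F z))\<^sup>2 * (K z * m) * (pi / a * (1 - gaussian_loss (a * \<rho>\<^sup>2))) = ?N x * q"
      using F(2)[rule_format, OF zb] in_chart_at[OF c x(1), of ?N] z by (simp add: q_def)
    finally show "ennreal (?N x * q) \<le> (\<integral>\<^sup>+ y. ennreal (?N y) \<partial>form_volume X \<A> W \<omega>)" .
  qed
  also have "1 / q = a / (m * pi * (1 - gaussian_loss (a * \<rho>\<^sup>2)))"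
    using a by (simp add: q_def)
  finally show ?thesis .
qed

lemma local_frame_setup:
  assumes x0: "x0 \<in> W"
  obtains c i k where "c \<in> \<A>" "x0 \<in> fst c" "i \<in> idx L" "x0 \<in> patch L i" "k \<in> idx E" "x0 \<in> patch E k"
  using charts_cover[OF x0] LB.idx_at[OF x0] EB.idx_at[OF x0] by blast

text \<open>On a small disc the weights of \<open>E\<close> and the volume density are constant up to a factor \<open>1 \<plusminus> \<eta>\<close>, and the curvature
coefficient is at most \<open>\<beta> = b0 (2 \<pi> C (1 + \<eta>) + \<eta>)\<close>, even after adding the Taylor error \<open>\<eta> b0\<close>. The extra
\<open>\<eta> b0\<close> also keeps \<open>\<beta>\<close> positive at points where the curvature vanishes. The disc does not depend on \<open>p\<close>, so the
Gaussian of width \<open>p \<beta>\<close> concentrates inside it.\<close>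

lemma bergman_local_bound:
  assumes x0: "x0 \<in> W" and \<delta>: "0 < \<delta>" and C: "0 \<le> C"
    and ratio: "\<And>x. x \<in> W \<Longrightarrow> curv_ratio x \<le> 2 * pi * C"
  shows "\<exists>N. openin X N \<and> x0 \<in> N \<and> (\<forall>\<^sub>F p in sequentially. \<forall>x\<in>N. B p x \<le> (C + \<delta>) * real p)"
proof -
  obtain c i k where c: "c \<in> \<A>" "x0 \<in> fst c" and i: "i \<in> idx L" "x0 \<in> patch L i"
    and k: "k \<in> idx E" "x0 \<in> patch E k" by (rule local_frame_setup[OF x0])
  define V where "V = patch L i \<inter> patch E k \<inter> W"
  define O' where "O' = snd c ` (fst c \<inter> V)"
  define z0 where "z0 = snd c x0"
  have O_open: "open O'" unfolding O'_def V_def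
    by (rule chart_image_open[OF c(1)])
       (use chart_homeo(1)[OF c(1)] L_patch(1)[OF i(1)] E_patch(1)[OF k(1)] W_open in \<open>auto intro!: openin_Int\<close>)
  have z0: "z0 \<in> O'" using c i k x0 by (auto simp: z0_def O'_def V_def)
  have O_in: "\<exists>y. y \<in> fst c \<and> y \<in> patch L i \<and> y \<in> patch E k \<and> y \<in> W \<and> \<zeta> = snd c y" if "\<zeta> \<in> O'" for \<zeta>
    using that by (auto simp: O'_def V_def)
  have OW: "O' \<subseteq> snd c ` (fst c \<inter> W)" by (auto simp: O'_def V_def)
  define b where "b = (\<lambda>\<zeta>. Im (in_chart c (\<omega> c) \<zeta>))"
  define e where "e = in_chart c (hE k)"
  define hc where "hc = in_chart c (h i)"
  have b_cont: "continuous_on O' b"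
    unfolding b_def by (intro continuous_intros continuous_on_subset[OF omega_continuous[OF c(1)] OW])
  have e_cont: "continuous_on O' e"
    unfolding e_def by (rule continuous_on_subset[OF EB.metric_continuous[OF k(1) c(1)]]) (auto simp: O'_def V_def)
  have h_cont: "continuous_on O' hc"
    unfolding hc_def by (rule continuous_on_subset[OF LB.metric_continuous[OF i(1) c(1)]]) (auto simp: O'_def V_def)
  have b_pos: "0 < b \<zeta>" and e_pos: "0 < e \<zeta>" and h_pos: "0 < hc \<zeta>" if \<zeta>: "\<zeta> \<in> O'" for \<zeta>
  proof -
    obtain y where y: "y \<in> fst c" "y \<in> patch L i" "y \<in> patch E k" "y \<in> W" "\<zeta> = snd c y" using O_in[OF \<zeta>] by blast
    show "0 < b \<zeta>" "0 < e \<zeta>" "0 < hc \<zeta>"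
      using omega_at(2)[OF c(1) y(1,4)] EB.metric_pos[OF k(1), of y] LB.metric_pos[OF i(1), of y] y
      by (simp_all add: b_def e_def hc_def in_chart_at[OF c(1)])
  qed
  have levi_bound: "- Re (levi (log_weight c i) \<zeta>) \<le> 2 * pi * C * b \<zeta>" if \<zeta>: "\<zeta> \<in> O'" for \<zeta>
  proof -
    obtain y where y: "y \<in> fst c" "y \<in> patch L i" "y \<in> patch E k" "y \<in> W" "\<zeta> = snd c y" using O_in[OF \<zeta>] by blast
    have "Re (curvature L h c y) / Im (\<omega> c y) \<le> 2 * pi * C"
      using ratio[OF y(4)] form_ratio_eq[OF c(1) y(1,4)] by simp
    then have "Re (curvature L h c y) \<le> 2 * pi * C * Im (\<omega> c y)"
      using omega_at(2)[OF c(1) y(1,4)] by (simp add: field_simps)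
    then show ?thesis
      using curvature_levi[OF c(1) y(1,4) i(1) y(2)] y by (simp add: b_def in_chart_at[OF c(1)])
  qed
  define b0 e0 where "b0 = b z0" and "e0 = e z0"
  have b0: "0 < b0" and e0: "0 < e0" using b_pos e_pos z0 by (auto simp: b0_def e0_def)
  have "((\<lambda>\<eta>::real. (2 * pi * C * (1 + \<eta>) + \<eta>) / (2 * pi * (1 - \<eta>)\<^sup>2)) \<longlongrightarrow> (2 * pi * C * (1 + 0) + 0) / (2 * pi * (1 - 0)\<^sup>2)) (at_right 0)"
    by (intro tendsto_intros) auto
  then have "\<forall>\<^sub>F \<eta> in at_right 0. (2 * pi * C * (1 + \<eta>) + \<eta>) / (2 * pi * (1 - \<eta>)\<^sup>2) < C + \<delta> / 2"
    using \<delta> by (intro order_tendstoD(2)) auto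
  moreover have "\<forall>\<^sub>F \<eta>::real in at_right 0. 0 < \<eta> \<and> \<eta> < 1/2"
    unfolding eventually_at_right_field by (intro exI[of _ "1/2"]) auto
  \<comment> \<open>The quotient is the leading constant \<open>\<beta> / (m \<pi>)\<close> of the final bound, with \<open>m = 2 (1 - \<eta>)\<^sup>2 b0\<close>.\<close>
  ultimately obtain \<eta> where \<eta>: "0 < \<eta>" "\<eta> < 1/2" "(2 * pi * C * (1 + \<eta>) + \<eta>) / (2 * pi * (1 - \<eta>)\<^sup>2) < C + \<delta> / 2"
    using eventually_happens'[OF trivial_limit_at_right_real[of "0::real"] eventually_conj] by blast
  have "C_diff 2 O' (log_weight c i)"
  proof -
    have "snd c ` (fst c \<inter> V) \<subseteq> snd c ` (fst c \<inter> (patch L i \<inter> W))" by (auto simp: V_def)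
    then show ?thesis using log_weight_C2[OF c(1) i(1)] unfolding O'_def by (rule C_diff_subset)
  qed
  from second_order_lower_bound[OF O_open this z0, of "\<eta> * b0"] \<eta>(1) b0
  obtain r1 where r1: "r1 > 0" "ball z0 (2 * r1) \<subseteq> O'"
    and taylor: "\<forall>z\<in>ball z0 r1. \<exists>A B. \<forall>w. cmod w < r1 \<longrightarrow>
     log_weight c i z + Re (A * w + B * w\<^sup>2) + (Re (levi (log_weight c i) z) - \<eta> * b0) * (cmod w)\<^sup>2 \<le> log_weight c i (z + w)"
    by (auto simp del: mem_ball)
  obtain r2 where r2: "r2 > 0" "ball z0 r2 \<subseteq> O'" "\<And>z. z \<in> ball z0 r2 \<Longrightarrow> \<bar>b z - b0\<bar> < \<eta> * b0"
    using continuous_near[OF b_cont O_open z0, of "\<eta> * b0"] \<eta>(1) b0 by (auto simp: b0_def simp del: mem_ball)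
  obtain r3 where r3: "r3 > 0" "ball z0 r3 \<subseteq> O'" "\<And>z. z \<in> ball z0 r3 \<Longrightarrow> \<bar>e z - e0\<bar> < \<eta> / 4 * e0"
    using continuous_near[OF e_cont O_open z0, of "\<eta> / 4 * e0"] \<eta>(1) e0 by (auto simp: e0_def simp del: mem_ball)
  define r where "r = min r1 (min (r2 / 2) (r3 / 2))"
  have r: "0 < r" "r \<le> r1" "2 * r \<le> r2" "2 * r \<le> r3" using r1 r2 r3 by (auto simp: r_def)
  define \<beta> where "\<beta> = b0 * (2 * pi * C * (1 + \<eta>) + \<eta>)"
  have \<beta>: "0 < \<beta>" using b0 C \<eta> by (simp add: \<beta>_def add_nonneg_pos)
  define N where "N = {y \<in> fst c. snd c y \<in> ball z0 r}"
  have "openin X N" unfolding N_def by (rule chart_preimage_open[OF c(1) open_ball])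
  moreover have "x0 \<in> N" using c r by (simp add: N_def z0_def)
  moreover have "\<forall>\<^sub>F p in sequentially. \<forall>x\<in>N. B p x \<le> (C + \<delta>) * real p"
  proof -
    have "(C + \<delta> / 2) / (C + \<delta>) < 1" using C \<delta> by simp
    then have "\<forall>\<^sub>F p in sequentially. gaussian_loss (real p * (\<beta> * r\<^sup>2)) < 1 - (C + \<delta> / 2) / (C + \<delta>)"
      using \<beta> r by (intro order_tendstoD(2)[OF gaussian_tail_tendsto_0]) auto
    then show ?thesis
      using eventually_gt_at_top[of 0]
    proof eventually_elim
      case (elim p)
      define \<theta> where "\<theta> = gaussian_loss (real p * \<beta> * r\<^sup>2)"
      have \<theta>: "\<theta> < 1 - (C + \<delta> / 2) / (C + \<delta>)" using elim(1) by (simp add: \<theta>_def mult.assoc)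
      have \<theta>1: "\<theta> < 1" using \<theta> C \<delta> by (smt (verit) divide_nonneg_nonneg)
      show ?case
      proof
        fix x assume xN: "x \<in> N"
        define z where "z = snd c x"
        have z: "z \<in> ball z0 r" using xN by (simp add: N_def z_def)
        have near: "z + w \<in> ball z0 (2 * r)" if "cmod w < r" for w
        proof -
          have "dist z0 (z + w) \<le> dist z0 z + dist z (z + w)" by (rule dist_triangle)
          also have "\<dots> < r + r" using z that by (intro add_strict_mono) (auto simp: dist_norm)
          finally show ?thesis by simp
        qed
        have nearO: "z + w \<in> O'" and nearb: "\<bar>b (z + w) - b0\<bar> < \<eta> * b0" and neare: "\<bar>e (z + w) - e0\<bar> < \<eta> / 4 * e0"
          if "cmod w < r" for w
          using near[OF that] r r2 r3 by (auto simp: subset_iff)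
        have zO: "z \<in> O'" and zb: "\<bar>b z - b0\<bar> < \<eta> * b0" and ze: "\<bar>e z - e0\<bar> < \<eta> / 4 * e0"
          using nearO[of 0] nearb[of 0] neare[of 0] r by auto
        have ballO: "ball z r \<subseteq> O'"
        proof
          fix \<zeta> assume "\<zeta> \<in> ball z r"
          then show "\<zeta> \<in> O'" using nearO[of "\<zeta> - z"] by (simp add: dist_norm norm_minus_commute)
        qed
        obtain y where y: "y \<in> fst c" "y \<in> patch L i" "y \<in> patch E k" "y \<in> W" "z = snd c y" using O_in[OF zO] by blast
        have xy: "x = y" using inj_onD[OF chart_inj[OF c(1)], of x y] y xN by (simp add: N_def z_def)
        obtain A Q where AB: "\<And>w. cmod w < r1 \<Longrightarrow>
           log_weight c i z + Re (A * w + Q * w\<^sup>2) + (Re (levi (log_weight c i) z) - \<eta> * b0) * (cmod w)\<^sup>2 \<le> log_weight c i (z + w)"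
          using taylor z r by (meson mem_ball order_less_le_trans)
        define K where "K = (\<lambda>\<zeta>. hc \<zeta> ^ p * e \<zeta>)"
        define m where "m = 2 * (1 - \<eta>)\<^sup>2 * b0"
        have m: "0 < m" using \<eta> b0 by (simp add: m_def)
        have "B p x \<le> real p * \<beta> / (m * pi * (1 - gaussian_loss (real p * \<beta> * r\<^sup>2)))"
        proof (rule bergman_peak_bound[where z = z and K = K and A' = "of_real (real p / 2) * A" and B' = "of_real (real p / 2) * Q"])
          show "c \<in> \<A>" "x \<in> fst c" "x \<in> W" "snd c x = z" using c y xy by auto
          show "ball z r \<subseteq> snd c ` (fst c \<inter> W)" using ballO OW by auto
          show "0 < real p * \<beta>" "0 < r" "0 < m" using elim(2) \<beta> r m by auto
          show "gaussian_loss (real p * \<beta> * r\<^sup>2) < 1" using \<theta>1 by (simp add: \<theta>_def)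
          show "continuous_on (ball z r) K"
            unfolding K_def by (intro continuous_intros continuous_on_subset[OF h_cont ballO] continuous_on_subset[OF e_cont ballO])
          show "0 \<le> K \<zeta>" if "\<zeta> \<in> ball z r" for \<zeta>
            using h_pos[of \<zeta>] e_pos[of \<zeta>] ballO that by (auto simp: K_def intro!: mult_nonneg_nonneg)
          show "\<exists>F. F holomorphic_on ball z r \<and>
             (\<forall>\<zeta>\<in>ball z r. in_chart c (norm2 (LpE p) (hp p) s) \<zeta> = (cmod (F \<zeta>))\<^sup>2 * K \<zeta>)"
            if s: "hol_section \<A> W (LpE p) s" for s
          proof (intro exI conjI ballI)
            have ik: "(i, k) \<in> idx (LpE p)" using i k by (simp add: twisted_idx)
            then have "in_chart c (s (i, k)) holomorphic_on snd c ` (fst c \<inter> (patch (LpE p) (i, k) \<inter> W))"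
              using s c(1) unfolding hol_section_def hol_fun_def by blast
            then show "in_chart c (s (i, k)) holomorphic_on ball z r"
              by (rule holomorphic_on_subset) (use ballO in \<open>auto simp: O'_def V_def twisted_patch\<close>)
            fix \<zeta> assume "\<zeta> \<in> ball z r"
            then obtain y where y: "y \<in> fst c" "y \<in> patch L i" "y \<in> patch E k" "y \<in> W" "\<zeta> = snd c y"
              using O_in[of \<zeta>] ballO by blast
            have "norm2 (LpE p) (hp p) s y = (cmod (s (i, k) y))\<^sup>2 * twisted_metric h p hE (i, k) y"
              by (rule TB.norm2_eq[OF s ik]) (use y in \<open>auto simp: twisted_patch\<close>)
            then show "in_chart c (norm2 (LpE p) (hp p) s) \<zeta> = (cmod (in_chart c (s (i, k)) \<zeta>))\<^sup>2 * K \<zeta>"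
              using y by (simp add: in_chart_at[OF c(1)] K_def hc_def e_def twisted_metric_def)
          qed
          fix w assume w: "cmod w < r"
          let ?P = "A * w + Q * w\<^sup>2"
          have "ln (hc z) + Re ?P - \<beta> * (cmod w)\<^sup>2 \<le> ln (hc (z + w))"
          proof -
            have "- Re (levi (log_weight c i) z) + \<eta> * b0 \<le> \<beta>"
            proof -
              have "- Re (levi (log_weight c i) z) \<le> 2 * pi * C * b z" by (rule levi_bound[OF zO])
              also have "\<dots> \<le> 2 * pi * C * ((1 + \<eta>) * b0)"
                using C zb by (intro mult_left_mono) (auto simp: algebra_simps abs_if split: if_splits)
              finally show ?thesis by (simp add: \<beta>_def algebra_simps)
            qed
            then have "- \<beta> * (cmod w)\<^sup>2 \<le> (Re (levi (log_weight c i) z) - \<eta> * b0) * (cmod w)\<^sup>2"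
              by (intro mult_right_mono) auto
            with AB[of w] w r show ?thesis by (simp add: hc_def)
          qed
          then have "exp (ln (hc z) + Re ?P - \<beta> * (cmod w)\<^sup>2) \<le> exp (ln (hc (z + w)))" by simp
          then have "hc z * exp (Re ?P) * exp (- (\<beta> * (cmod w)\<^sup>2)) \<le> hc (z + w)"
            using h_pos[OF zO] h_pos[OF nearO[OF w]] by (simp add: exp_add exp_diff exp_minus divide_inverse)
          then have "(hc z * exp (Re ?P) * exp (- (\<beta> * (cmod w)\<^sup>2))) ^ p \<le> hc (z + w) ^ p"
            using h_pos[OF zO] by (intro power_mono) auto
          then have H: "hc z ^ p * exp (real p * Re ?P) * exp (- (real p * \<beta> * (cmod w)\<^sup>2)) \<le> hc (z + w) ^ p"
            by (simp add: power_mult_distrib exp_of_nat_mult[symmetric] mult.assoc)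
          have X: "(cmod (exp (of_real (real p / 2) * A * w + of_real (real p / 2) * Q * w\<^sup>2)))\<^sup>2 = exp (real p * Re ?P)"
          proof -
            define u where "u = ?P"
            have "of_real (real p / 2) * A * w + of_real (real p / 2) * Q * w\<^sup>2 = of_real (real p / 2) * u"
              by (simp add: algebra_simps u_def)
            moreover have "(cmod (exp (of_real (real p / 2) * u)))\<^sup>2 = exp (real p * Re u)"
              by (simp add: norm_exp_eq_Re power2_eq_square exp_add[symmetric])
            ultimately show ?thesis unfolding u_def by (simp only:)
          qed
          have E1: "(1 - \<eta>) * e z \<le> e (z + w)"
          proof -
            \<comment> \<open>\<open>(1 - \<eta>) (1 + \<eta>/4) \<le> 1 - \<eta>/4\<close>, which is why \<open>e\<close> was controlled up to \<open>\<eta>/4\<close>.\<close>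
            have "(1 - \<eta>) * e z \<le> (1 - \<eta>) * ((1 + \<eta> / 4) * e0)"
              using ze \<eta> by (intro mult_left_mono) (auto simp: algebra_simps abs_if split: if_splits)
            also have "\<dots> = (1 - \<eta> / 4) * e0 - (\<eta> / 2 + \<eta>\<^sup>2 / 4) * e0"
              by (simp add: field_simps power2_eq_square)
            also have "\<dots> \<le> (1 - \<eta> / 4) * e0" using \<eta> e0 by simp
            also have "\<dots> \<le> e (z + w)" using neare[OF w] by (auto simp: algebra_simps abs_if split: if_splits)
            finally show ?thesis .
          qed
          have B1: "2 * ((1 - \<eta>) * b0) \<le> 2 * b (z + w)"
            using nearb[OF w] by (auto simp: algebra_simps abs_if split: if_splits)
          have "(hc z ^ p * exp (real p * Re ?P) * exp (- (real p * \<beta> * (cmod w)\<^sup>2))) * ((1 - \<eta>) * e z) * (2 * ((1 - \<eta>) * b0))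
             \<le> hc (z + w) ^ p * e (z + w) * (2 * b (z + w))"
            using H E1 B1 h_pos[OF zO] h_pos[OF nearO[OF w]] e_pos[OF zO] e_pos[OF nearO[OF w]] \<eta> b0
            by (intro mult_mono) auto
          then show "K z * m * (cmod (exp (of_real (real p / 2) * A * w + of_real (real p / 2) * Q * w\<^sup>2)))\<^sup>2 * exp (- (real p * \<beta> * (cmod w)\<^sup>2))
             \<le> K (z + w) * (2 * Im (in_chart c (\<omega> c) (z + w)))"
            unfolding X by (simp add: K_def m_def b_def power2_eq_square mult_ac)
        qed
        also have "\<dots> = real p * ((2 * pi * C * (1 + \<eta>) + \<eta>) / (2 * pi * (1 - \<eta>)\<^sup>2)) / (1 - \<theta>)"
        proof -
          have "real p * (b0 * n) / (2 * q * b0 * pi * u) = real p * (n / (2 * pi * q)) / u" for n q u :: real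
            using b0 by (simp add: mult_ac)
          then show ?thesis unfolding \<theta>_def m_def by (subst (1) \<beta>_def) (simp only:)
        qed
        also have "\<dots> \<le> real p * (C + \<delta> / 2) / (1 - \<theta>)"
          using \<eta>(3) \<theta>1 by (intro divide_right_mono mult_left_mono) auto
        also have "\<dots> \<le> (C + \<delta>) * real p"
        proof -
          have "(C + \<delta> / 2) \<le> (C + \<delta>) * (1 - \<theta>)" using \<theta> C \<delta> by (simp add: field_simps)
          then have "real p * (C + \<delta> / 2) \<le> real p * ((C + \<delta>) * (1 - \<theta>))" by (intro mult_left_mono) auto
          then show ?thesis using \<theta>1 by (simp add: divide_le_eq mult_ac)
        qed
        finally show "bergman_density (LpE p) (hp p) (d p) (S p) x \<le> (C + \<delta>) * real p" .
      qed
    qed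
  qed
  ultimately show ?thesis by blast
qed

end

section \<open>Logarithmic charts at the punctures\<close>

context punctured_surface
begin

lemma hol_frame_D:
  assumes fr: "hol_frame \<A> V M e" and i: "i \<in> idx M"
  shows "hol_section \<A> V M e"
    "x \<in> patch M i \<Longrightarrow> x \<in> V \<Longrightarrow> e i x \<noteq> 0"
    "c \<in> \<A> \<Longrightarrow> in_chart c (e i) holomorphic_on snd c ` (fst c \<inter> (patch M i \<inter> V))"
proof -
  show hs: "hol_section \<A> V M e" using fr unfolding hol_frame_def by (rule conjunct1)
  show "x \<in> patch M i \<Longrightarrow> x \<in> V \<Longrightarrow> e i x \<noteq> 0"
    using fr i unfolding hol_frame_def by blast
  show "c \<in> \<A> \<Longrightarrow> in_chart c (e i) holomorphic_on snd c ` (fst c \<inter> (patch M i \<inter> V))"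
    using hs i unfolding hol_section_def hol_fun_def by blast
qed

lemmas cusp_frame_L = hol_frame_D[OF conjunct1[OF alpha]]
lemmas cusp_frame_E = hol_frame_D[OF conjunct1[OF E_trivial]]

text \<open>A branch of the logarithm of the coordinate at a puncture, on any region of the logarithmic plane where the exponential is
injective.\<close>

lemma log_chart:
  assumes a: "a \<in> D" and U: "open \<Delta>" "inj_on exp \<Delta>" "exp ` \<Delta> \<subseteq> snd (ch a) ` fst (ch a)"
  obtains c where "c \<in> \<A>" "fst c \<subseteq> fst (ch a) - {a}" "snd c ` fst c = \<Delta>"
    "\<And>y. y \<in> fst c \<Longrightarrow> snd (ch a) y = exp (snd c y)"
    "\<And>w y. w \<in> \<Delta> \<Longrightarrow> y \<in> fst (ch a) \<Longrightarrow> snd (ch a) y = exp w \<Longrightarrow> y \<in> fst c \<and> snd c y = w"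
proof -
  have cA: "ch a \<in> \<A>" and a0: "snd (ch a) a = 0" using coords[OF a] by auto
  have hol: "exp holomorphic_on \<Delta>" by (intro holomorphic_intros)
  obtain g where g: "g holomorphic_on exp ` \<Delta>" "\<And>w. w \<in> \<Delta> \<Longrightarrow> g (exp w) = w"
    using holomorphic_has_inverse[OF hol U(1,2)] by metis
  have inj: "inj_on g (exp ` \<Delta>)" by (rule inj_onI) (use g(2) in auto)
  let ?c = "({y \<in> fst (ch a). snd (ch a) y \<in> exp ` \<Delta>}, g \<circ> snd (ch a))"
  show thesis
  proof
    show "?c \<in> \<A>"
      by (rule compose_chart[OF cA open_mapping_thm3[OF hol U(1,2)] U(3) g(1) inj])
    show "fst ?c \<subseteq> fst (ch a) - {a}" using a0 by auto
    show "snd ?c ` fst ?c = \<Delta>"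
    proof
      show "snd ?c ` fst ?c \<subseteq> \<Delta>" using g(2) by auto
      show "\<Delta> \<subseteq> snd ?c ` fst ?c"
      proof
        fix w assume w: "w \<in> \<Delta>"
        then obtain y where "y \<in> fst (ch a)" "snd (ch a) y = exp w" using U(3) by (metis imageE image_subset_iff)
        then show "w \<in> snd ?c ` fst ?c" using w g(2)[OF w] by (intro image_eqI[of _ _ y]) auto
      qed
    qed
    show "snd (ch a) y = exp (snd ?c y)" if "y \<in> fst ?c" for y using that g(2) by auto
    show "y \<in> fst ?c \<and> snd ?c y = w" if "w \<in> \<Delta>" "y \<in> fst (ch a)" "snd (ch a) y = exp w" for w y
      using that g(2) by auto
  qed
qed

lemma cusp_norm_L:
  assumes a: "a \<in> D" and y: "y \<in> fst (ch a) - {a}" "snd (ch a) y = exp w" and w: "Re w < 0"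
    and i: "i \<in> idx L" "y \<in> patch L i"
  shows "(cmod (eL a i y))\<^sup>2 * h i y = - 2 * Re w"
proof -
  have yW: "y \<in> W" using y coords[OF a] by auto
  have "norm2 L h (eL a) y = \<bar>ln ((cmod (exp w))\<^sup>2)\<bar>"
    using alpha[OF a] y by auto
  also have "\<dots> = - 2 * Re w" using w by (simp add: norm_exp_eq_Re ln_realpow)
  finally show ?thesis
    using LB.norm2_eq[OF cusp_frame_L(1)[OF a i(1)] i] y yW by simp
qed

lemma cusp_norm_E:
  assumes a: "a \<in> D" and y: "y \<in> fst (ch a) - {a}" and k: "k \<in> idx E" "y \<in> patch E k"
  shows "(cmod (eE a k y))\<^sup>2 * hE k y = 1"
proof -
  have yW: "y \<in> W" using y coords[OF a] by auto
  have "norm2 E hE (eE a) y = 1" using E_trivial[OF a] y by auto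
  then show ?thesis
    using EB.norm2_eq[OF cusp_frame_E(1)[OF a k(1)] k y yW] by simp
qed

text \<open>In the cusps \<open>\<omega>\<close> is prescribed by the curvature, and \<open>h = (- 2 Re w) |1/e|\<^sup>2\<close> in a local frame, where \<open>e\<close> is the component
of the distinguished holomorphic frame; so the coefficient is that of the Poincare metric on a half-plane.\<close>

lemma cusp_omega:
  assumes a: "a \<in> D" and c: "c \<in> \<A>" "fst c \<subseteq> fst (ch a) - {a}"
    and ex: "\<And>y. y \<in> fst c \<Longrightarrow> snd (ch a) y = exp (snd c y)"
    and neg: "\<And>y. y \<in> fst c \<Longrightarrow> Re (snd c y) < 0"
    and y: "y \<in> fst c"
  shows "Im (\<omega> c y) = 1 / (4 * (Re (snd c y))\<^sup>2)"
proof -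
  have cW: "fst c \<subseteq> W" using c(2) coords[OF a] by auto
  then have yW: "y \<in> W" using y by auto
  define i where "i = idx_at L y"
  have i: "i \<in> idx L" "y \<in> patch L i" using LB.idx_at[OF yW] by (auto simp: i_def)
  let ?S = "snd c ` (fst c \<inter> (patch L i \<inter> W))" and ?S' = "{w. Re w < 0}"
  have "levi (log_weight c i) (snd c y) = levi (\<lambda>w. ln (- 2 * Re w)) (snd c y)
      * deriv (\<lambda>z. z) (snd c y) * cnj (deriv (\<lambda>z. z) (snd c y))"
  proof (rule levi_transform[where S = ?S and S' = ?S' and g = "\<lambda>w. inverse (in_chart c (eL a i) w)"])
    show "open ?S" by (rule weight_domain_open[OF c(1) i(1)])
    show "open ?S'" by (rule open_halfspace_Re_lt)
    show "snd c y \<in> ?S" using y yW i by auto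
    show "(\<lambda>z. z) holomorphic_on ?S" by (rule holomorphic_on_ident)
    show "(\<lambda>z. z) ` ?S \<subseteq> ?S'" using neg by auto
    show "C_diff 2 ?S' (\<lambda>w. ln (- 2 * Re w))" by (rule levi_log_Re(1)[OF neg[OF y]])
    have nz: "in_chart c (eL a i) w \<noteq> 0" if w: "w \<in> ?S" for w
    proof -
      obtain v where v: "v \<in> fst c" "v \<in> patch L i" "w = snd c v" using w by auto
      then show ?thesis using cusp_frame_L(2)[OF a i(1), of v] c(2) by (auto simp: in_chart_at[OF c(1)])
    qed
    have "in_chart c (eL a i) holomorphic_on ?S"
      by (rule holomorphic_on_subset[OF cusp_frame_L(3)[OF a i(1) c(1)]]) (use c(2) in auto)
    then show "(\<lambda>w. inverse (in_chart c (eL a i) w)) holomorphic_on ?S"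
      by (intro holomorphic_intros nz)
    show "inverse (in_chart c (eL a i) w) \<noteq> 0" if "w \<in> ?S" for w using nz[OF that] by simp
    show "log_weight c i w = ln (- 2 * Re w) + ln ((cmod (inverse (in_chart c (eL a i) w)))\<^sup>2)" if w: "w \<in> ?S" for w
    proof -
      obtain v where v: "v \<in> fst c" "v \<in> patch L i" "v \<in> W" "w = snd c v" using w by auto
      have vc: "v \<in> fst (ch a) - {a}" using c(2) v(1) by auto
      have n0: "Re w < 0" using neg v by simp
      have N: "(cmod (eL a i v))\<^sup>2 * h i v = - 2 * Re w"
        by (rule cusp_norm_L[OF a vc _ n0 i(1) v(2)]) (simp add: ex[OF v(1)] v(4))
      have e0: "eL a i v \<noteq> 0" using nz[OF w] v by (simp add: in_chart_at[OF c(1)])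
      have "h i v = (- 2 * Re w) * (cmod (inverse (eL a i v)))\<^sup>2"
        unfolding N[symmetric] using e0 by (simp add: norm_inverse power_inverse)
      then have "ln (h i v) = ln (- 2 * Re w) + ln ((cmod (inverse (eL a i v)))\<^sup>2)"
        using n0 e0 by (simp only:) (rule ln_mult_pos; simp)
      then show ?thesis using v by (simp add: in_chart_at[OF c(1)])
    qed
  qed
  then have "Re (levi (log_weight c i) (snd c y)) = - 1 / (4 * (Re (snd c y))\<^sup>2)"
    using levi_log_Re(2)[OF neg[OF y]] by simp
  moreover have "Im (\<omega> c y) = Re (curvature L h c y)"
  proof -
    have "y \<in> fst (ch a) - {a}" using c(2) y by auto
    then show ?thesis using curv_cusp[OF a _ c(1) y] by (auto simp: i_times_def complex_eq_iff)
  qed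
  ultimately show ?thesis
    using curvature_levi[OF c(1) y yW i] by simp
qed

text \<open>The components of a section in the local frames are divided by those of the distinguished frames of \<open>L\<close> and \<open>E\<close>. The
quotients do not depend on the local frames and therefore form one holomorphic function on the whole region, over
which no single member of the given covers need extend.\<close>

lemma cusp_section:
  assumes a: "a \<in> D" and c: "c \<in> \<A>" "fst c \<subseteq> fst (ch a) - {a}"
    and ex: "\<And>y. y \<in> fst c \<Longrightarrow> snd (ch a) y = exp (snd c y)"
    and neg: "\<And>y. y \<in> fst c \<Longrightarrow> Re (snd c y) < 0"
    and s: "hol_section \<A> W (LpE p) s"
  shows "\<exists>F. F holomorphic_on snd c ` fst c \<and>
       (\<forall>\<zeta>\<in>snd c ` fst c. in_chart c (norm2 (LpE p) (hp p) s) \<zeta> = (cmod (F \<zeta>))\<^sup>2 * (- 2 * Re \<zeta>) ^ p)"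
proof -
  define f where "f = (\<lambda>i k y. s (i, k) y / (eL a i y ^ p * eE a k y))"
  define F where "F = in_chart c (\<lambda>y. f (idx_at L y) (idx_at E y) y)"
  have cW: "fst c \<subseteq> W" using c(2) coords[OF a] by auto
  have idxs: "idx_at L y \<in> idx L" "y \<in> patch L (idx_at L y)" "idx_at E y \<in> idx E" "y \<in> patch E (idx_at E y)" if "y \<in> fst c" for y
    using LB.idx_at[of y] EB.idx_at[of y] cW that by auto
  have indep: "f i k y = f j l y"
    if "y \<in> fst c" "i \<in> idx L" "y \<in> patch L i" "k \<in> idx E" "y \<in> patch E k" "j \<in> idx L" "y \<in> patch L j" "l \<in> idx E" "y \<in> patch E l" for i j k l y
  proof -
    have yc: "y \<in> fst (ch a) - {a}" "y \<in> W" using that(1) c(2) cW by auto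
    have "s (i, k) y = cocycle (LpE p) (i, k) (j, l) y * s (j, l) y"
      using s that yc(2) unfolding hol_section_def by (simp add: twisted_idx twisted_patch)
    moreover have "eL a i y = cocycle L i j y * eL a j y"
      using cusp_frame_L(1)[OF a that(2)] that yc(1) unfolding hol_section_def by blast
    moreover have "eE a k y = cocycle E k l y * eE a l y"
      using cusp_frame_E(1)[OF a that(4)] that yc(1) unfolding hol_section_def by blast
    moreover have "eL a i y \<noteq> 0" "eE a k y \<noteq> 0"
      using cusp_frame_L(2)[OF a that(2,3)] cusp_frame_E(2)[OF a that(4,5)] yc(1) by auto
    ultimately show ?thesis
      by (simp add: f_def twisted_cocycle power_mult_distrib)
  qed
  have "F holomorphic_on snd c ` fst c"
    unfolding holomorphic_on_def
  proof
    fix w assume "w \<in> snd c ` fst c"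
    then obtain y where y: "y \<in> fst c" "w = snd c y" by auto
    define i k where "i = idx_at L y" and "k = idx_at E y"
    have i: "i \<in> idx L" "y \<in> patch L i" and k: "k \<in> idx E" "y \<in> patch E k"
      using idxs[OF y(1)] by (auto simp: i_def k_def)
    let ?N = "snd c ` (fst c \<inter> (patch L i \<inter> patch E k))"
    have op: "open ?N"
      by (rule chart_image_open[OF c(1)])
         (use chart_homeo(1)[OF c(1)] L_patch(1)[OF i(1)] E_patch(1)[OF k(1)] in \<open>auto intro!: openin_Int\<close>)
    have ik: "(i, k) \<in> idx (LpE p)" using i k by (simp add: twisted_idx)
    have "in_chart c (s (i, k)) holomorphic_on snd c ` (fst c \<inter> (patch (LpE p) (i, k) \<inter> W))"
      using s c(1) ik unfolding hol_section_def hol_fun_def by blast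
    then have h1: "in_chart c (s (i, k)) holomorphic_on ?N"
      by (rule holomorphic_on_subset) (use cW in \<open>auto simp: twisted_patch\<close>)
    have h2: "in_chart c (eL a i) holomorphic_on ?N"
      by (rule holomorphic_on_subset[OF cusp_frame_L(3)[OF a i(1) c(1)]]) (use c(2) in auto)
    have h3: "in_chart c (eE a k) holomorphic_on ?N"
      by (rule holomorphic_on_subset[OF cusp_frame_E(3)[OF a k(1) c(1)]]) (use c(2) in auto)
    have nz: "in_chart c (eL a i) v ^ p * in_chart c (eE a k) v \<noteq> 0" if v: "v \<in> ?N" for v
    proof -
      obtain y' where y': "y' \<in> fst c" "y' \<in> patch L i" "y' \<in> patch E k" "v = snd c y'" using v by auto
      then show ?thesis using cusp_frame_L(2)[OF a i(1), of y'] cusp_frame_E(2)[OF a k(1), of y'] c(2)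
        by (auto simp: in_chart_at[OF c(1)])
    qed
    have "(\<lambda>v. in_chart c (s (i, k)) v / (in_chart c (eL a i) v ^ p * in_chart c (eE a k) v)) holomorphic_on ?N"
      by (intro holomorphic_intros h1 h2 h3 nz)
    then have "F holomorphic_on ?N"
    proof (rule holomorphic_transform)
      fix v assume "v \<in> ?N"
      then obtain y' where y': "y' \<in> fst c" "y' \<in> patch L i" "y' \<in> patch E k" "v = snd c y'" by auto
      have "in_chart c (s (i, k)) v / (in_chart c (eL a i) v ^ p * in_chart c (eE a k) v) = f i k y'"
        using y' by (simp add: f_def in_chart_at[OF c(1)])
      also have "\<dots> = f (idx_at L y') (idx_at E y') y'"
        by (rule indep) (use y' i k idxs[OF y'(1)] in auto)
      finally show "in_chart c (s (i, k)) v / (in_chart c (eL a i) v ^ p * in_chart c (eE a k) v) = F v"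
        using y' by (simp add: F_def in_chart_at[OF c(1)])
    qed
    moreover have "w \<in> ?N" using y i k by auto
    ultimately have "F field_differentiable (at w)"
      using op holomorphic_on_imp_differentiable_at by blast
    then show "F field_differentiable (at w within snd c ` fst c)"
      by (rule field_differentiable_at_within)
  qed
  moreover have "in_chart c (norm2 (LpE p) (hp p) s) \<zeta> = (cmod (F \<zeta>))\<^sup>2 * (- 2 * Re \<zeta>) ^ p"
    if \<zeta>: "\<zeta> \<in> snd c ` fst c" for \<zeta>
  proof -
    obtain y where y: "y \<in> fst c" "\<zeta> = snd c y" using \<zeta> by auto
    define i k where "i = idx_at L y" and "k = idx_at E y"
    have i: "i \<in> idx L" "y \<in> patch L i" and k: "k \<in> idx E" "y \<in> patch E k"
      using idxs[OF y(1)] by (auto simp: i_def k_def)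
    have yc: "y \<in> fst (ch a) - {a}" "y \<in> W" using y(1) c(2) cW by auto
    have "norm2 (LpE p) (hp p) s y = (cmod (s (i, k) y))\<^sup>2 * (h i y ^ p * hE k y)"
      using TB.norm2_eq[OF s, of "(i, k)" y] i k yc by (simp add: twisted_idx twisted_patch twisted_metric_def)
    also have "\<dots> = (cmod (f i k y))\<^sup>2 * (((cmod (eL a i y))\<^sup>2 * h i y) ^ p * ((cmod (eE a k y))\<^sup>2 * hE k y))"
    proof -
      have "eL a i y \<noteq> 0" "eE a k y \<noteq> 0"
        using cusp_frame_L(2)[OF a i] cusp_frame_E(2)[OF a k] yc(1) by auto
      then have "cmod (s (i, k) y) = cmod (f i k y) * (cmod (eL a i y) ^ p * cmod (eE a k y))"
        by (simp add: f_def norm_divide norm_mult norm_power)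
      then show ?thesis by (simp add: power_mult_distrib power_mult[symmetric] mult_ac)
    qed
    also have "(cmod (eL a i y))\<^sup>2 * h i y = - 2 * Re \<zeta>"
      by (rule cusp_norm_L[OF a yc(1) _ _ i]) (use ex[OF y(1)] neg[OF y(1)] y in auto)
    also have "(cmod (eE a k y))\<^sup>2 * hE k y = 1"
      by (rule cusp_norm_E[OF a yc(1) k])
    finally show ?thesis
      using y by (simp add: F_def in_chart_at[OF c(1)] i_def k_def)
  qed
  ultimately show ?thesis by blast
qed

end

section \<open>Bergman density near the punctures\<close>

context bergman_setting
begin

text \<open>With \<open>u = - ln |z|\<close> and the logarithmic coordinate, the disc of radius \<open>r u\<close> around \<open>log z\<close> has the same shape
for all \<open>u\<close>, because scaling the half-plane is an isometry. So the bound does not depend on \<open>u\<close>; it tends to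
\<open>p / (2 \<pi>)\<close> when \<open>r \<longrightarrow> 0\<close> and \<open>p r\<^sup>2 \<longrightarrow> \<infinity>\<close>. The condition \<open>|z| < \<rho>\<^sup>2\<close> keeps the image of the disc inside
\<open>|z| < \<rho>\<close>, and \<open>r u < \<pi>\<close> makes the exponential injective on it.\<close>

lemma bergman_cusp_point:
  assumes a: "a \<in> D" and \<rho>: "0 < \<rho>" "\<rho> < 1" "ball 0 \<rho> \<subseteq> snd (ch a) ` fst (ch a)"
    and x: "x \<in> fst (ch a) - {a}" and xr: "cmod (snd (ch a) x) < \<rho>\<^sup>2"
    and r: "0 < r" "r \<le> 1 / 2" "r * (- ln (cmod (snd (ch a) x))) < pi"
    and p: "0 < p" and \<theta>: "gaussian_loss (real p * (1 / (1 - r)) * r\<^sup>2 / 4) < 1"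
  shows "B p x \<le> real p * ((1 / (1 - r)) * (1 + r)\<^sup>2 /
     (2 * pi * (1 - gaussian_loss (real p * (1 / (1 - r)) * r\<^sup>2 / 4))))"
proof -
  define z where "z = snd (ch a) x"
  define u where "u = - ln (cmod z)"
  define k where "k = 1 / (1 - r)"
  have cA: "ch a \<in> \<A>" "a \<in> fst (ch a)" "snd (ch a) a = 0" using coords[OF a] by auto
  have z0: "z \<noteq> 0" using inj_onD[OF chart_inj[OF cA(1)], of x a] cA x by (auto simp: z_def)
  have \<rho>2: "\<rho>\<^sup>2 < 1" using \<rho> by (simp add: power_less_one_iff)
  have u0: "0 < u" using xr \<rho>2 z0 by (simp add: u_def z_def[symmetric])
  have k0: "0 < k" using r by (simp add: k_def)
  define w1 where "w1 = Ln z"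
  have Re_w1: "Re w1 = - u" and exp_w1: "exp w1 = z" using z0 by (auto simp: w1_def u_def)
  define \<Delta> where "\<Delta> = ball w1 (r * u)"
  have ru: "r * u < pi" using r(3) by (simp add: u_def z_def)
  have inj: "inj_on exp \<Delta>"
    by (rule inj_on_subset[OF inj_on_exp_pi[of w1]]) (use ru in \<open>auto simp: \<Delta>_def\<close>)
  have Re_bounds: "- ((1 + r) * u) < Re w" "Re w < - ((1 - r) * u)" if "w \<in> \<Delta>" for w
  proof -
    have "\<bar>Re (w - w1)\<bar> \<le> cmod (w - w1)" by (rule abs_Re_le_cmod)
    also have "\<dots> < r * u" using that by (simp add: \<Delta>_def dist_norm norm_minus_commute)
    finally show "- ((1 + r) * u) < Re w" "Re w < - ((1 - r) * u)"
      by (auto simp: Re_w1 algebra_simps abs_if split: if_splits)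
  qed
  have Re_neg: "Re w < 0" if "w \<in> \<Delta>" for w
  proof -
    have "0 \<le> (1 - r) * u" using r u0 by simp
    then show ?thesis using Re_bounds(2)[OF that] by linarith
  qed
  have exp_sub: "exp ` \<Delta> \<subseteq> snd (ch a) ` fst (ch a)"
  proof -
    have "cmod (exp w) < \<rho>" if w: "w \<in> \<Delta>" for w
    proof -
      \<comment> \<open>\<open>Re w < - u / 2\<close>, so \<open>|exp w|\<^sup>2 < exp (- u) = |z| < \<rho>\<^sup>2\<close>.\<close>
      have "(1 / 2) * u \<le> (1 - r) * u" using r u0 by (intro mult_right_mono) auto
      then have "2 * Re w < - u" using Re_bounds(2)[OF w] by linarith
      then have "exp (2 * Re w) < exp (- u)" by simp
      also have "\<dots> = cmod z" using z0 by (simp add: u_def)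
      also have "\<dots> < \<rho>\<^sup>2" using xr by (simp add: z_def)
      finally have "(cmod (exp w))\<^sup>2 < \<rho>\<^sup>2" by (simp add: norm_exp_eq_Re exp_double)
      then show ?thesis using \<rho>(1) by (auto intro: power2_less_imp_less)
    qed
    then have "exp ` \<Delta> \<subseteq> ball 0 \<rho>" by auto
    then show ?thesis using \<rho>(3) by blast
  qed
  have "open \<Delta>" by (simp add: \<Delta>_def)
  then obtain c where c: "c \<in> \<A>" "fst c \<subseteq> fst (ch a) - {a}" "snd c ` fst c = \<Delta>"
    and ex: "\<And>y. y \<in> fst c \<Longrightarrow> snd (ch a) y = exp (snd c y)"
    and log: "\<And>w y. w \<in> \<Delta> \<Longrightarrow> y \<in> fst (ch a) \<Longrightarrow> snd (ch a) y = exp w \<Longrightarrow> y \<in> fst c \<and> snd c y = w"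
    by (rule log_chart[OF a _ inj exp_sub]) blast
  have neg: "Re (snd c y) < 0" if "y \<in> fst c" for y using Re_neg c(3) that by blast
  have cW: "fst c \<subseteq> W" using c(2) coords[OF a] by auto
  then have cW': "fst c \<inter> W = fst c" by auto
  have "w1 \<in> \<Delta>" using r u0 by (simp add: \<Delta>_def)
  then have xc: "x \<in> fst c" "snd c x = w1" using log[of w1 x] x exp_w1 by (auto simp: z_def)
  have dens: "Im (in_chart c (\<omega> c) w) = 1 / (4 * (Re w)\<^sup>2)" if w: "w \<in> \<Delta>" for w
  proof -
    obtain y where y: "y \<in> fst c" "w = snd c y" using w c(3) by blast
    then show ?thesis using cusp_omega[OF a c(1,2) ex neg y(1)] by (simp add: in_chart_at[OF c(1)])
  qed
  \<comment> \<open>Expand \<open>ln (1 - s)\<close> with \<open>s = Re w / u\<close> to second order, use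
      \<open>(Re w)\<^sup>2 = (|w|\<^sup>2 + Re (w\<^sup>2)) / 2\<close>, and multiply by \<open>p\<close>: half of the pluriharmonic part
      gives \<open>A'\<close> and \<open>B'\<close>, the coefficient of \<open>|w|\<^sup>2\<close> gives \<open>q\<close>.\<close>
  define A' where "A' = complex_of_real (- real p / (2 * u))"
  define B' where "B' = complex_of_real (- real p * k / (8 * u\<^sup>2))"
  define m where "m = 1 / (2 * u\<^sup>2 * (1 + r)\<^sup>2)"
  define q where "q = real p * k / (4 * u\<^sup>2)"
  have m0: "0 < m" using u0 r by (simp add: m_def)
  have q0: "0 < q" using u0 k0 p by (simp add: q_def)
  have q\<rho>: "q * (r * u)\<^sup>2 = real p * (1 / (1 - r)) * r\<^sup>2 / 4"
    using u0 by (simp add: q_def k_def power_mult_distrib)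
  have "B p x \<le> q / (m * pi * (1 - gaussian_loss (q * (r * u)\<^sup>2)))"
  proof (rule bergman_peak_bound[where z = w1 and K = "\<lambda>w. (- 2 * Re w) ^ p" and A' = A' and B' = B'])
    show "c \<in> \<A>" "x \<in> fst c" "x \<in> W" "snd c x = w1" using c(1) xc cW by auto
    show "ball w1 (r * u) \<subseteq> snd c ` (fst c \<inter> W)" using c(3) cW' by (simp add: \<Delta>_def)
    show "0 < q" "0 < r * u" "0 < m" using q0 r u0 m0 by auto
    show "gaussian_loss (q * (r * u)\<^sup>2) < 1" unfolding q\<rho> by (rule \<theta>)
    show "continuous_on (ball w1 (r * u)) (\<lambda>w. (- 2 * Re w) ^ p)" by (intro continuous_intros)
    show "0 \<le> (- 2 * Re \<zeta>) ^ p" if "\<zeta> \<in> ball w1 (r * u)" for \<zeta>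
      using Re_neg[of \<zeta>] that by (simp add: \<Delta>_def)
    show "\<exists>F. F holomorphic_on ball w1 (r * u) \<and>
       (\<forall>\<zeta>\<in>ball w1 (r * u). in_chart c (norm2 (LpE p) (hp p) s) \<zeta> = (cmod (F \<zeta>))\<^sup>2 * (- 2 * Re \<zeta>) ^ p)"
      if s: "hol_section \<A> W (LpE p) s" for s
      using cusp_section[OF a c(1,2) ex neg s] c(3) by (simp add: \<Delta>_def)
    fix w assume w: "cmod w < r * u"
    then have w\<Delta>: "w1 + w \<in> \<Delta>" by (simp add: \<Delta>_def dist_norm)
    define s where "s = Re w / u"
    have "\<bar>Re w\<bar> \<le> r * u" using abs_Re_le_cmod[of w] w by linarith
    then have sr: "\<bar>s\<bar> \<le> r" using u0 by (simp add: s_def field_simps)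
    have s1: "0 < 1 - s" using sr r by auto
    have Kw: "- 2 * Re (w1 + w) = 2 * u * (1 - s)" using u0 by (simp add: Re_w1 s_def field_simps)
    let ?G = "(cmod (exp (A' * w + B' * w\<^sup>2)))\<^sup>2 * exp (- (q * (cmod w)\<^sup>2))" and ?T = "exp (real p * (- s - s\<^sup>2 / (2 * (1 - r))))"
    have X: "?G = ?T"
    proof -
      have "2 * Re (A' * w + B' * w\<^sup>2) - q * (cmod w)\<^sup>2 = real p * (- s - k * s\<^sup>2 / 2)"
        unfolding cmod_power2 A'_def B'_def q_def s_def using u0
        by (simp add: power2_eq_square) (simp add: field_simps)
      moreover have "k * s\<^sup>2 / 2 = s\<^sup>2 / (2 * (1 - r))" by (simp add: k_def)
      moreover have "?G = exp (2 * Re (A' * w + B' * w\<^sup>2) - q * (cmod w)\<^sup>2)"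
        by (simp only: norm_exp_eq_Re exp_double[symmetric] exp_add[symmetric] diff_conv_add_uminus)
      ultimately show ?thesis by simp
    qed
    have "real p * (- s - s\<^sup>2 / (2 * (1 - r))) \<le> real p * ln (1 - s)"
      using ln_one_minus_quadratic_bound[OF sr] r by (intro mult_left_mono) auto
    then have "?T \<le> exp (real p * ln (1 - s))" by simp
    also have "\<dots> = (1 - s) ^ p" using s1 by (simp add: exp_of_nat_mult)
    finally have e: "?T \<le> (1 - s) ^ p" .
    have d: "m \<le> 2 * Im (in_chart c (\<omega> c) (w1 + w))"
    proof -
      have "1 - s \<le> 1 + r" using sr by auto
      then have "(1 - s)\<^sup>2 \<le> (1 + r)\<^sup>2" using s1 by (intro power_mono) auto
      then have "2 * u\<^sup>2 * (1 - s)\<^sup>2 \<le> 2 * u\<^sup>2 * (1 + r)\<^sup>2" by (intro mult_left_mono) auto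
      then have "1 / (2 * u\<^sup>2 * (1 + r)\<^sup>2) \<le> 1 / (2 * u\<^sup>2 * (1 - s)\<^sup>2)"
        using s1 u0 r by (intro divide_left_mono) auto
      also have "\<dots> = 2 * (1 / (4 * (Re (w1 + w))\<^sup>2))"
      proof -
        have "Re (w1 + w) = - (u * (1 - s))" using Kw by simp
        then show ?thesis by (simp add: power_mult_distrib)
      qed
      finally show ?thesis using dens[OF w\<Delta>] by (simp add: m_def)
    qed
    have "(2 * u) ^ p * ?T * m \<le> (2 * u) ^ p * (1 - s) ^ p * (2 * Im (in_chart c (\<omega> c) (w1 + w)))"
      using e d u0 m0 s1 by (intro mult_mono mult_nonneg_nonneg) auto
    moreover have "(- 2 * Re w1) ^ p * m * (cmod (exp (A' * w + B' * w\<^sup>2)))\<^sup>2 * exp (- (q * (cmod w)\<^sup>2))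
        = (2 * u) ^ p * ?T * m"
      unfolding X[symmetric] by (simp add: Re_w1 mult_ac)
    moreover have "(- 2 * Re (w1 + w)) ^ p = (2 * u) ^ p * (1 - s) ^ p"
      unfolding Kw by (rule power_mult_distrib)
    ultimately show "(- 2 * Re w1) ^ p * m * (cmod (exp (A' * w + B' * w\<^sup>2)))\<^sup>2 * exp (- (q * (cmod w)\<^sup>2))
        \<le> (- 2 * Re (w1 + w)) ^ p * (2 * Im (in_chart c (\<omega> c) (w1 + w)))"
      by (simp only:)
  qed
  also have "q / (m * pi * v) = real p * (k * (1 + r)\<^sup>2 / (2 * pi * v))" for v
    using u0 r by (simp add: q_def m_def field_simps)
  finally show ?thesis unfolding q\<rho> k_def .
qed

text \<open>The choice \<open>r = p powr (- \<gamma>')\<close> with \<open>\<gamma> < \<gamma>' < 1/2\<close> reconciles the two requirements on \<open>r\<close>: \<open>p r\<^sup>2 \<longrightarrow> \<infinity>\<close>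
because of \<open>\<gamma>' < 1/2\<close>, and \<open>r u \<longrightarrow> 0\<close> because \<open>u \<le> p powr \<gamma> - ln t\<close> and \<open>\<gamma> < \<gamma>'\<close>.\<close>

lemma bergman_cusp_bound:
  assumes a: "a \<in> D" and \<delta>: "0 < \<delta>" and C: "1 / (2 * pi) \<le> C"
    and t: "0 < t" "t < 1" and \<gamma>: "0 < \<gamma>" "\<gamma> < 1 / 2"
  shows "\<exists>\<rho>>0. \<forall>\<^sub>F p in sequentially. \<forall>x\<in>fst (ch a) - {a}. cmod (snd (ch a) x) < \<rho> \<longrightarrow>
      t * exp (- (real p powr \<gamma>)) \<le> cmod (snd (ch a) x) \<longrightarrow> B p x \<le> (C + \<delta>) * real p"
proof -
  have cA: "ch a \<in> \<A>" "a \<in> fst (ch a)" "snd (ch a) a = 0" using coords[OF a] by auto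
  have "0 \<in> snd (ch a) ` fst (ch a)" using cA by force
  then obtain \<rho>' where \<rho>': "0 < \<rho>'" "ball 0 \<rho>' \<subseteq> snd (ch a) ` fst (ch a)"
    using chart_homeo(2)[OF cA(1)] open_contains_ball by blast
  define \<rho> where "\<rho> = min \<rho>' (1/2)"
  have \<rho>: "0 < \<rho>" "\<rho> < 1" "ball 0 \<rho> \<subseteq> snd (ch a) ` fst (ch a)"
    using \<rho>' by (auto simp: \<rho>_def subset_iff)
  define \<gamma>' where "\<gamma>' = (\<gamma> + 1 / 2) / 2"
  have \<gamma>': "\<gamma> < \<gamma>'" "0 < \<gamma>'" "2 * \<gamma>' < 1" using \<gamma> by (auto simp: \<gamma>'_def)
  define r where "r = (\<lambda>p::nat. real p powr (- \<gamma>'))"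
  define y where "y = (\<lambda>p::nat. real p * (1 / (1 - r p)) * (r p)\<^sup>2 / 4)"
  define T where "T = (\<lambda>p. (1 + y p) * exp (- y p))"
  have r0: "r \<longlonglongrightarrow> 0"
    unfolding r_def using \<gamma>'(2) by (intro tendsto_neg_powr filterlim_real_sequentially) auto
  have y_top: "filterlim y at_top sequentially"
  proof -
    have "filterlim (\<lambda>p. real p powr (1 - 2 * \<gamma>')) at_top sequentially"
    proof -
      have "0 < 1 - 2 * \<gamma>'" using \<gamma>'(3) by simp
      then show ?thesis by real_asymp
    qed
    moreover have "((\<lambda>p. 1 / (1 - r p) / 4) \<longlongrightarrow> 1 / (1 - 0) / 4) sequentially"
      by (intro tendsto_intros r0) auto
    ultimately have "filterlim (\<lambda>p. 1 / (1 - r p) / 4 * real p powr (1 - 2 * \<gamma>')) at_top sequentially"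
      by (intro filterlim_tendsto_pos_mult_at_top) auto
    moreover have "\<forall>\<^sub>F p in sequentially. 1 / (1 - r p) / 4 * real p powr (1 - 2 * \<gamma>') = y p"
      using eventually_gt_at_top[of 0]
    proof eventually_elim
      case (elim p)
      have "real p powr (1 - 2 * \<gamma>') = real p * (r p)\<^sup>2"
        using elim by (simp add: r_def powr_diff powr_minus power2_eq_square powr_add[symmetric] field_simps)
      then show ?case by (simp add: y_def)
    qed
    ultimately show ?thesis by (rule filterlim_cong[THEN iffD1, OF refl refl, rotated])
  qed
  have "((\<lambda>v::real. (1 + v) * exp (- v)) \<longlongrightarrow> 0) at_top" by real_asymp
  from filterlim_compose[OF this y_top] have T0: "T \<longlonglongrightarrow> 0" by (simp add: T_def)
  have "(\<lambda>p. (1 / (1 - r p)) * (1 + r p)\<^sup>2 / (2 * pi * (1 - T p))) \<longlonglongrightarrow> (1 / (1 - 0)) * (1 + 0)\<^sup>2 / (2 * pi * (1 - 0))"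
    by (intro tendsto_intros r0 T0) auto
  then have ev1: "\<forall>\<^sub>F p in sequentially. (1 / (1 - r p)) * (1 + r p)\<^sup>2 / (2 * pi * (1 - T p)) < C + \<delta>"
    using C \<delta> by (intro order_tendstoD(2)) auto
  have ev2: "\<forall>\<^sub>F p in sequentially. r p < 1 / 2" using r0 by (intro order_tendstoD(2)) auto
  have ev3: "\<forall>\<^sub>F p in sequentially. T p < 1" using T0 by (intro order_tendstoD(2)) auto
  have ev4: "\<forall>\<^sub>F p in sequentially. r p * (real p powr \<gamma> - ln t) < pi"
  proof -
    have "(\<lambda>p. real p powr (\<gamma> - \<gamma>')) \<longlonglongrightarrow> 0"
      using \<gamma>'(1) by (intro tendsto_neg_powr filterlim_real_sequentially) auto
    then have "(\<lambda>p. real p powr (\<gamma> - \<gamma>') - r p * ln t) \<longlonglongrightarrow> 0 - 0 * ln t"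
      by (intro tendsto_intros r0)
    then have "\<forall>\<^sub>F p in sequentially. real p powr (\<gamma> - \<gamma>') - r p * ln t < pi"
      by (intro order_tendstoD(2)) auto
    then show ?thesis
      by eventually_elim (simp add: r_def right_diff_distrib powr_add[symmetric])
  qed
  have "\<forall>\<^sub>F p in sequentially. \<forall>x\<in>fst (ch a) - {a}. cmod (snd (ch a) x) < \<rho>\<^sup>2 \<longrightarrow>
      t * exp (- (real p powr \<gamma>)) \<le> cmod (snd (ch a) x) \<longrightarrow> B p x \<le> (C + \<delta>) * real p"
    using ev1 ev2 ev3 ev4 eventually_gt_at_top[of 0]
  proof eventually_elim
    case (elim p)
    show ?case
    proof (intro ballI impI)
      fix x assume x: "x \<in> fst (ch a) - {a}" "cmod (snd (ch a) x) < \<rho>\<^sup>2" "t * exp (- (real p powr \<gamma>)) \<le> cmod (snd (ch a) x)"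
      have rp: "0 < r p" using elim(5) by (simp add: r_def)
      have "ln (t * exp (- (real p powr \<gamma>))) \<le> ln (cmod (snd (ch a) x))"
        using x(3) t by (intro ln_mono) (auto intro: less_le_trans[OF mult_pos_pos])
      then have "- ln (cmod (snd (ch a) x)) \<le> real p powr \<gamma> - ln t" using t by (simp add: ln_mult)
      then have "r p * (- ln (cmod (snd (ch a) x))) \<le> r p * (real p powr \<gamma> - ln t)"
        using rp by (intro mult_left_mono) auto
      then have ru: "r p * (- ln (cmod (snd (ch a) x))) < pi" using elim(4) by linarith
      have "B p x \<le> real p * ((1 / (1 - r p)) * (1 + r p)\<^sup>2 / (2 * pi * (1 - T p)))"
        unfolding T_def y_def
        by (rule bergman_cusp_point[OF a \<rho> x(1,2) rp _ ru elim(5)]) (use elim(2,3) in \<open>auto simp: T_def y_def\<close>)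
      also have "\<dots> \<le> real p * (C + \<delta>)" using elim(1) by (intro mult_left_mono) auto
      finally show "B p x \<le> (C + \<delta>) * real p" by (simp add: mult.commute)
    qed
  qed
  moreover have "0 < \<rho>\<^sup>2" using \<rho> by simp
  ultimately show ?thesis by blast
qed

end

section \<open>The uniform upper bound\<close>

context bergman_setting
begin

lemma bergman_uniform_bound:
  assumes C: "0 \<le> C" and ratio: "\<And>x. x \<in> W \<Longrightarrow> curv_ratio x \<le> 2 * pi * C" and \<delta>: "0 < \<delta>"
    and t: "0 < t" "t < 1" and \<gamma>: "0 < \<gamma>" "\<gamma> < 1 / 2"
  shows "\<forall>\<^sub>F p in sequentially. \<forall>x\<in>cut_surface W D ch p t \<gamma>. B p x \<le> (C + \<delta>) * real p"
proof (rule eventually_uniform_on_surface)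
  show "cut_surface W D ch p t \<gamma> \<subseteq> W" for p by (auto simp: cut_surface_def)
  show "\<exists>N. openin X N \<and> x \<in> N \<and> (\<forall>\<^sub>F p in sequentially. \<forall>y\<in>N. B p y \<le> (C + \<delta>) * real p)" if "x \<in> W" for x
    by (rule bergman_local_bound[OF that \<delta> C ratio])
  fix a assume a: "a \<in> D"
  obtain y where y: "y \<in> fst (ch a) - {a}" using cusp_punctured_nonempty[OF a] by blast
  then have "y \<in> W" using coords[OF a] by auto
  then have "1 \<le> 2 * pi * C" using ratio[of y] curv_ratio_cusp[OF a y] by simp
  then have "1 / (2 * pi) \<le> C" by (simp add: field_simps)
  from bergman_cusp_bound[OF a \<delta> this t \<gamma>] obtain \<rho> where \<rho>: "0 < \<rho>"
    "\<forall>\<^sub>F p in sequentially. \<forall>x\<in>fst (ch a) - {a}. cmod (snd (ch a) x) < \<rho> \<longrightarrow>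
      t * exp (- (real p powr \<gamma>)) \<le> cmod (snd (ch a) x) \<longrightarrow> B p x \<le> (C + \<delta>) * real p" by blast
  have "\<forall>\<^sub>F p in sequentially. \<forall>y\<in>fst (ch a) - {a}. cmod (snd (ch a) y) < \<rho> \<longrightarrow>
      y \<in> cut_surface W D ch p t \<gamma> \<longrightarrow> B p y \<le> (C + \<delta>) * real p"
    using \<rho>(2) by eventually_elim (use cut_surface_cusp[OF a] in blast)
  then show "\<exists>\<rho>>0. \<forall>\<^sub>F p in sequentially. \<forall>y\<in>fst (ch a) - {a}. cmod (snd (ch a) y) < \<rho> \<longrightarrow>
      y \<in> cut_surface W D ch p t \<gamma> \<longrightarrow> B p y \<le> (C + \<delta>) * real p"
    using \<rho>(1) by blast
qed

end

text \<open>The relative error has to be truncated at 0, since the supremum may well be much smaller than \<open>C p\<close>. Nonemptiness of \<open>Z p\<close>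
matters because the supremum of the empty set is an unspecified real number.\<close>

lemma sup_bound_to_relative_error:
  fixes f :: "nat \<Rightarrow> 'a \<Rightarrow> real"
  assumes C: "0 < C" and Z: "\<forall>\<^sub>F p in sequentially. Z p \<noteq> {}"
    and bound: "\<And>\<delta>. 0 < \<delta> \<Longrightarrow> \<forall>\<^sub>F p in sequentially. \<forall>x\<in>Z p. f p x \<le> (C + \<delta>) * real p"
  shows "\<exists>\<epsilon> :: nat \<Rightarrow> real. \<epsilon> \<longlonglongrightarrow> 0 \<and> (\<forall>\<^sub>F p in sequentially.
       bdd_above (f p ` Z p) \<and> (SUP x\<in>Z p. f p x) \<le> C * (1 + \<epsilon> p) * real p)"
proof -
  define s where "s = (\<lambda>p. SUP x\<in>Z p. f p x)"
  define \<epsilon> where "\<epsilon> = (\<lambda>p. max 0 (s p / (C * real p) - 1))"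
  have "\<epsilon> \<longlonglongrightarrow> 0"
  proof (rule order_tendstoI)
    show "\<forall>\<^sub>F p in sequentially. e < \<epsilon> p" if "e < 0" for e
      using that by (intro always_eventually allI) (simp add: \<epsilon>_def less_max_iff_disj)
    fix e :: real assume e: "0 < e"
    then have "0 < C * (e / 2)" using C by simp
    from bound[OF this] Z eventually_gt_at_top[of 0]
    show "\<forall>\<^sub>F p in sequentially. \<epsilon> p < e"
    proof eventually_elim
      case (elim p)
      have "s p \<le> (C + C * (e / 2)) * real p"
        unfolding s_def using elim by (intro cSUP_least) auto
      then have "s p / (C * real p) \<le> 1 + e / 2" using C elim(3) by (simp add: field_simps)
      then show ?case using e by (simp add: \<epsilon>_def)
    qed
  qed
  moreover have "\<forall>\<^sub>F p in sequentially. bdd_above (f p ` Z p) \<and> (SUP x\<in>Z p. f p x) \<le> C * (1 + \<epsilon> p) * real p"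
    using bound[OF zero_less_one] eventually_gt_at_top[of 0]
  proof eventually_elim
    case (elim p)
    have "s p / (C * real p) \<le> 1 + \<epsilon> p" by (simp add: \<epsilon>_def)
    then have "s p \<le> C * (1 + \<epsilon> p) * real p" using C elim(2) by (simp add: field_simps)
    moreover have "bdd_above (f p ` Z p)" using elim(1) by (intro bdd_aboveI2) blast
    ultimately show ?case by (simp add: s_def)
  qed
  ultimately show ?thesis by blast
qed

theorem corollary1p2p3:
  fixes X :: "'a topology" and \<A> :: "'a chart set" and D W :: "'a set"
    and \<omega> :: "'a form11"
    and L :: "('a, 'i) line_bundle" and h :: "('a, 'i) metric"
    and E :: "('a, 'k) line_bundle" and hE :: "('a, 'k) metric"
    and ch :: "'a \<Rightarrow> 'a chart"
    and eL :: "'a \<Rightarrow> ('a, 'i) bsection" and eE :: "'a \<Rightarrow> ('a, 'k) bsection"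
    and d :: "nat \<Rightarrow> nat" and S :: "nat \<Rightarrow> nat \<Rightarrow> ('a, 'i \<times> 'k) bsection"
    and B :: "nat \<Rightarrow> 'a \<Rightarrow> real" and C0 t \<gamma> :: real
  assumes surface: "compact_riemann_surface X \<A>"
    and punctures: "finite D" "D \<subseteq> topspace X" "W = topspace X - D"
    and omega: "smooth_form11 \<A> W \<omega>" "real_form11 \<A> W \<omega>" "riemannian_form11 \<A> W \<omega>"
    and L: "hol_line_bundle X \<A> (topspace X) L" "smooth_metric \<A> W L h"
    and coords: "\<And>a. a \<in> D \<Longrightarrow>
          ch a \<in> \<A> \<and> a \<in> fst (ch a) \<and> snd (ch a) a = 0 \<and> fst (ch a) - {a} \<subseteq> W"
    and alpha: "\<And>a. a \<in> D \<Longrightarrow> hol_frame \<A> (fst (ch a)) L (eL a) \<and>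
          (\<forall>x \<in> fst (ch a) - {a}. norm2 L h (eL a) x = \<bar>ln ((cmod (snd (ch a) x))\<^sup>2)\<bar>)"
    and beta_i: "semipositive_form11 \<A> W (i_times (curvature L h))"
    and beta_ii: "\<And>a x c. a \<in> D \<Longrightarrow> x \<in> fst (ch a) - {a} \<Longrightarrow> c \<in> \<A> \<Longrightarrow> x \<in> fst c \<Longrightarrow>
          i_times (curvature L h) c x = \<omega> c x"
    and beta_iii: "\<And>x c. x \<in> W \<Longrightarrow> c \<in> \<A> \<Longrightarrow> x \<in> fst c \<Longrightarrow>
          vanishing_order (in_chart c (curvature L h c)) (snd c x) < \<infinity>"
    and E: "hol_line_bundle X \<A> W E" "smooth_metric \<A> W E hE"
    and E_trivial: "\<And>a. a \<in> D \<Longrightarrow> hol_frame \<A> (fst (ch a) - {a}) E (eE a) \<and>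
          (\<forall>x \<in> fst (ch a) - {a}. norm2 E hE (eE a) x = 1)"
    and basis: "\<And>p. orthonormal_basis \<A> W (twisted_power L p E) (twisted_metric h p hE)
          (form_volume X \<A> W \<omega>) (d p) (S p)"
    and B: "\<And>p x. B p x =
          bergman_density (twisted_power L p E) (twisted_metric h p hE) (d p) (S p) x"
    and C0: "C0 = (SUP x\<in>W. form_ratio \<A> (i_times (curvature L h)) \<omega> x / (2 * pi))"
    and t: "0 < t" "t < 1" and \<gamma>: "0 < \<gamma>" "\<gamma> < 1 / 2"
  shows "\<exists>\<epsilon> :: nat \<Rightarrow> real. \<epsilon> \<longlonglongrightarrow> 0 \<and>
    (\<forall>\<^sub>F p in sequentially.
       bdd_above (B p ` cut_surface W D ch p t \<gamma>) \<and>
       (SUP x\<in>cut_surface W D ch p t \<gamma>. B p x) \<le> C0 * (1 + \<epsilon> p) * real p)"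
proof -
  interpret bergman_setting X \<A> D W \<omega> L h E hE ch eL eE d S
    by unfold_locales (fact surface punctures omega L coords alpha beta_i beta_ii E E_trivial basis)+
  have B_eq: "B = (\<lambda>p. bergman_density (twisted_power L p E) (twisted_metric h p hE) (d p) (S p))"
    by (intro ext) (rule B)
  have bdd: "bdd_above ((\<lambda>x. curv_ratio x / (2 * pi)) ` W)"
  proof -
    obtain M where "\<And>x. x \<in> W \<Longrightarrow> curv_ratio x \<le> M" using curv_ratio_bounded unfolding bdd_above_def by auto
    then show ?thesis by (intro bdd_aboveI2[of _ _ "M / (2 * pi)"] divide_right_mono) auto
  qed
  have ratio: "curv_ratio x \<le> 2 * pi * C0" if "x \<in> W" for x
  proof -
    have "curv_ratio x / (2 * pi) \<le> C0" unfolding C0 by (rule cSUP_upper[OF that bdd])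
    then show ?thesis by (simp add: field_simps)
  qed
  obtain x0 where "x0 \<in> W" "0 < curv_ratio x0" using curv_ratio_pos_somewhere[OF beta_iii] by blast
  then have "0 < 2 * pi * C0" using ratio[of x0] by linarith
  then have C0_pos: "0 < C0" by (simp add: zero_less_mult_iff)
  show ?thesis
    unfolding B_eq
    by (rule sup_bound_to_relative_error[OF C0_pos cut_surface_nonempty[OF \<gamma>(1)]
        bergman_uniform_bound[OF less_imp_le[OF C0_pos] ratio _ t \<gamma>]])
qed

end
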